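(* Let $\nu>0$, $f\in V$, $T>0$, and let $U\in(0,\infty)$. Let $u(0),v(0)\in V$ be initial conditions with $\|u(0)\|_V+\|v(0)\|_V\le U$, and let $u,v\in C([0,T],V)$ be the corresponding strong solutions on $[0,T]$ of the two-dimensional periodic Navier-Stokes equations $\frac{du}{dt}+\nu Au+B(u,u)=f$ (with the same $\nu$ and $f$). A) There exists a constant $c_1$ depending only on $U,\nu,T,\|f\|_{L^2}$ such that $\sup_{0\le t\le T}\|u(t)-v(t)\|_{L^2}<c_1$ and $$\|u(0)-v(0)\|_{L^2(\Omega)}\le c_1\Big(\log\frac{c_1}{\|u(t)-v(t)\|_{L^2}}\Big)^{-1/2}\quad\text{for every }t\in[0,T].$$ B) Let further $0<c_P<\infty$ be a constant such that $$\frac{\|u(0)-v(0)\|_V^2}{\|u(0)-v(0)\|_{L^2}^2}\le c_P.$$ Then there exists a constant $c_2=c_2(U,\nu,T,\|f\|_{L^2})$ (depending only on these quantities) such that $$\|u(0)-v(0)\|_{L^2(\Omega)}\le e^{c_2c_P}\,\|u(t)-v(t)\|_{L^2(\Omega)}\quad\text{for every }t\in[0,T].$$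
   Context: $\Omega=[0,2\pi]^2$ is the flat two-dimensional torus (all functions are $2\pi$-periodic in each coordinate). For vector fields on $\Omega$ with values in $\mathbb R^2$ let $H=\{u\in L^2(\Omega)^2:\nabla\cdot u=0,\ \int_\Omega u=0\}$ with the $L^2$ inner product, and $V=\{u\in H^1(\Omega)^2:\nabla\cdot u=0,\ \int_\Omega u=0\}$ with inner product $\langle u,v\rangle_V=\langle\nabla u,\nabla v\rangle_{L^2}=\sum_{i,j=1}^2\int_\Omega \partial_{x_j}u_i\,\partial_{x_j}v_i\,dx$ and norm $\|\cdot\|_V$. $P$ is the $L^2$-orthogonal (Helmholtz-Leray) projector onto $H$ (extended to distributions). $A=-P\Delta$ is the Stokes operator with domain $\mathcal D(A)=H^2(\Omega)^2\cap V$ (here $A=-\Delta$ on $\mathcal D(A)$), and $B(u,v)=P[(u\cdot\nabla)v]$, where $[(u\cdot\nabla)v]_j=\sum_{i=1}^2u_i\,\partial_{x_i}v_j$. The forcing $f\in V$ is time-independent. For $\theta\in V$, the strong solution on $[0,T]$ with initial condition $\theta$ is the unique $u\in C([0,T],V)\cap L^2((0,T],\mathcal D(A))$ with $du/dt\in L^2((0,T],H)$, satisfying $\frac{du}{dt}+\nu Au+B(u,u)=f$ in $H$ and $u(0)=\theta$; such a solution exists for all $\theta \in V$. Convention: if $u(t)=v(t)$ the right-hand side in A) is read as $0$ (i.e. $\log(c_1/0)=\infty$); in B) the quotient is considered for $u(0)\ne v(0)$, the case $u(0)=v(0)$ being trivial. *)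

theory Defs
  imports "HOL-Analysis.Analysis" "HOL-Library.Function_Algebras"
begin

text \<open>
  Functions on the flat torus \<open>[0, 2\<pi>]\<^sup>2\<close> are represented by functions on the plane that are
  \<open>2\<pi>\<close>-periodic in each coordinate and are integrated over one period cell.  The function spaces
  below consist of representatives, so that equality in them is equality almost everywhere.
\<close>

definition torus :: "(real^2) measure" where
  "torus = lebesgue_on (cbox 0 (\<chi> i. 2 * pi))"

definition periodic :: "(real^2 \<Rightarrow> 'a) \<Rightarrow> bool" where
  "periodic w \<longleftrightarrow> (\<forall>x j. w (x + axis j (2 * pi)) = w x)"

definition L2_per :: "(real^2 \<Rightarrow> 'a::euclidean_space) set" where
  "L2_per = {w. periodic w \<and> w \<in> borel_measurable torus \<and> integrable torus (\<lambda>x. (norm (w x))\<^sup>2)}"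

definition L2_inner :: "(real^2 \<Rightarrow> 'a::euclidean_space) \<Rightarrow> (real^2 \<Rightarrow> 'a) \<Rightarrow> real" where
  "L2_inner u v = (\<integral>x. u x \<bullet> v x \<partial>torus)"

definition L2_norm :: "(real^2 \<Rightarrow> 'a::euclidean_space) \<Rightarrow> real" where
  "L2_norm u = sqrt (L2_inner u u)"


section \<open>Weak derivatives and Sobolev spaces\<close>

definition partial :: "2 \<Rightarrow> (real^2 \<Rightarrow> real) \<Rightarrow> real^2 \<Rightarrow> real" where
  "partial j \<phi> x = frechet_derivative \<phi> (at x) (axis j 1)"

text \<open>Being coinductive, this says that all iterated partial derivatives exist and are
  differentiable, that is, \<open>\<phi>\<close> is of class \<open>C\<^sup>\<infinity>\<close>.\<close>

coinductive smooth :: "(real^2 \<Rightarrow> real) \<Rightarrow> bool" where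
  smoothI: "(\<And>x. \<phi> differentiable at x) \<Longrightarrow> (\<And>j. smooth (partial j \<phi>)) \<Longrightarrow> smooth \<phi>"

definition has_weak_partial ::
    "2 \<Rightarrow> (real^2 \<Rightarrow> 'a::euclidean_space) \<Rightarrow> (real^2 \<Rightarrow> 'a) \<Rightarrow> bool" where
  "has_weak_partial j w g \<longleftrightarrow>
    (\<forall>\<phi>. smooth \<phi> \<and> periodic \<phi> \<longrightarrow>
      (\<integral>x. partial j \<phi> x *\<^sub>R w x \<partial>torus) = - (\<integral>x. \<phi> x *\<^sub>R g x \<partial>torus))"

text \<open>A representative of the weak derivative, which is unique up to null sets.  For a vector
  field \<open>u\<close> the value \<open>weak_partial j u x $ i\<close> is \<open>\<partial>\<^sub>j u\<^sub>i (x)\<close>.\<close>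

definition weak_partial :: "2 \<Rightarrow> (real^2 \<Rightarrow> 'a::euclidean_space) \<Rightarrow> real^2 \<Rightarrow> 'a" where
  "weak_partial j w = (SOME g. g \<in> L2_per \<and> has_weak_partial j w g)"

primrec Hk_per :: "nat \<Rightarrow> (real^2 \<Rightarrow> 'a::euclidean_space) set" where
  "Hk_per 0 = L2_per"
| "Hk_per (Suc k) = {w \<in> L2_per. \<forall>j. \<exists>g \<in> Hk_per k. has_weak_partial j w g}"


section \<open>The spaces and operators of the Navier-Stokes equations\<close>

type_synonym field2 = "real^2 \<Rightarrow> real^2"

definition div_free :: "field2 \<Rightarrow> bool" where
  "div_free u \<longleftrightarrow>
    (\<forall>\<phi>. smooth \<phi> \<and> periodic \<phi> \<longrightarrow> (\<integral>x. (\<Sum>i\<in>UNIV. u x $ i * partial i \<phi> x) \<partial>torus) = 0)"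

definition mean_zero :: "field2 \<Rightarrow> bool" where
  "mean_zero u \<longleftrightarrow> (\<integral>x. u x \<partial>torus) = 0"

definition H_space :: "field2 set" where
  "H_space = {u \<in> L2_per. div_free u \<and> mean_zero u}"

definition V_space :: "field2 set" where
  "V_space = {u \<in> Hk_per 1. div_free u \<and> mean_zero u}"

definition V_inner :: "field2 \<Rightarrow> field2 \<Rightarrow> real" where
  "V_inner u v =
    (\<Sum>i\<in>UNIV. \<Sum>j\<in>UNIV. \<integral>x. weak_partial j u x $ i * weak_partial j v x $ i \<partial>torus)"

definition V_norm :: "field2 \<Rightarrow> real" where
  "V_norm u = sqrt (V_inner u u)"

text \<open>The orthogonal projection of \<open>g \<in> L\<^sup>2\<close> onto \<open>H\<close>, up to the choice of a representative.
  It is applied below only to fields in \<open>L\<^sup>2\<close>.\<close>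

definition leray :: "field2 \<Rightarrow> field2" where
  "leray g = (SOME h. h \<in> H_space \<and> (\<forall>k \<in> H_space. L2_inner (g - h) k = 0))"

definition laplacian :: "field2 \<Rightarrow> field2" where
  "laplacian u = (\<lambda>x. \<Sum>j\<in>UNIV. weak_partial j (weak_partial j u) x)"

definition stokes_domain :: "field2 set" where
  "stokes_domain = Hk_per 2 \<inter> V_space"

definition stokes :: "field2 \<Rightarrow> field2" where
  "stokes u = - leray (laplacian u)"

definition convection :: "field2 \<Rightarrow> field2 \<Rightarrow> field2" where
  "convection u v = (\<lambda>x. \<Sum>i\<in>UNIV. u x $ i *\<^sub>R weak_partial i v x)"

definition NS_bilinear :: "field2 \<Rightarrow> field2 \<Rightarrow> field2" where
  "NS_bilinear u v = leray (convection u v)"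


section \<open>Functions of time with values in a space of fields\<close>

text \<open>
  Bochner measurability and the Bochner integral over a bounded set \<open>I\<close> of times, for functions
  with values in a space \<open>X\<close> of representatives with norm \<open>N\<close>.  The library integral does not
  apply directly, since \<open>X\<close> is a set and \<open>N\<close> vanishes on fields that are zero almost everywhere.
\<close>

definition simple_field_fun :: "field2 set \<Rightarrow> real set \<Rightarrow> (real \<Rightarrow> field2) \<Rightarrow> bool" where
  "simple_field_fun X I s \<longleftrightarrow>
    finite (s ` I) \<and> s ` I \<subseteq> X \<and> (\<forall>y. {t \<in> I. s t = y} \<in> lmeasurable)"

definition simple_field_integral :: "real set \<Rightarrow> (real \<Rightarrow> field2) \<Rightarrow> field2" where
  "simple_field_integral I s = (\<lambda>x. \<Sum>y\<in>s ` I. measure lebesgue {t \<in> I. s t = y} *\<^sub>R y x)"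

definition bochner_measurable ::
    "field2 set \<Rightarrow> (field2 \<Rightarrow> real) \<Rightarrow> real set \<Rightarrow> (real \<Rightarrow> field2) \<Rightarrow> bool" where
  "bochner_measurable X N I g \<longleftrightarrow>
    (\<exists>s. (\<forall>n. simple_field_fun X I (s n)) \<and>
         (AE t in lebesgue_on I. (\<lambda>n. N (s n t - g t)) \<longlonglongrightarrow> 0))"

definition has_bochner_integral_in ::
    "field2 set \<Rightarrow> (field2 \<Rightarrow> real) \<Rightarrow> real set \<Rightarrow> (real \<Rightarrow> field2) \<Rightarrow> field2 \<Rightarrow> bool" where
  "has_bochner_integral_in X N I g y \<longleftrightarrow>
    (\<exists>s. (\<forall>n. simple_field_fun X I (s n)) \<and>
         (\<forall>n. integrable (lebesgue_on I) (\<lambda>t. N (s n t - g t))) \<and>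
         (\<lambda>n. \<integral>t. N (s n t - g t) \<partial>lebesgue_on I) \<longlonglongrightarrow> 0 \<and>
         (\<lambda>n. N (simple_field_integral I (s n) - y)) \<longlonglongrightarrow> 0)"

definition L2_time ::
    "field2 set \<Rightarrow> (field2 \<Rightarrow> real) \<Rightarrow> real set \<Rightarrow> (real \<Rightarrow> field2) set" where
  "L2_time X N I =
    {g. (AE t in lebesgue_on I. g t \<in> X) \<and> bochner_measurable X N I g \<and>
        integrable (lebesgue_on I) (\<lambda>t. (N (g t))\<^sup>2)}"

definition continuous_in ::
    "field2 set \<Rightarrow> (field2 \<Rightarrow> real) \<Rightarrow> real set \<Rightarrow> (real \<Rightarrow> field2) \<Rightarrow> bool" where
  "continuous_in X N I u \<longleftrightarrow>
    (\<forall>t\<in>I. u t \<in> X \<and> ((\<lambda>s. N (u s - u t)) \<longlongrightarrow> 0) (at t within I))"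

text \<open>\<open>w = du/dt\<close> for continuous \<open>u\<close>: the function \<open>u\<close> is a primitive of \<open>w\<close>, the integrals being
  Bochner integrals in \<open>H\<close>.\<close>

definition has_time_derivative :: "real \<Rightarrow> (real \<Rightarrow> field2) \<Rightarrow> (real \<Rightarrow> field2) \<Rightarrow> bool" where
  "has_time_derivative T u w \<longleftrightarrow>
    (\<forall>s t. 0 \<le> s \<and> s \<le> t \<and> t \<le> T \<longrightarrow>
      has_bochner_integral_in H_space L2_norm {s..t} w (u t - u s))"

text \<open>The domain of the Stokes operator carries the norm \<open>u \<mapsto> \<parallel>A u\<parallel>\<close>, which is equivalent to
  both the graph norm and the \<open>H\<^sup>2\<close> norm.\<close>

definition strong_solution ::
    "real \<Rightarrow> field2 \<Rightarrow> real \<Rightarrow> field2 \<Rightarrow> (real \<Rightarrow> field2) \<Rightarrow> bool" where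
  "strong_solution \<nu> f T \<theta> u \<longleftrightarrow>
    continuous_in V_space V_norm {0..T} u \<and>
    u \<in> L2_time stokes_domain (\<lambda>w. L2_norm (stokes w)) {0<..T} \<and>
    (\<exists>w \<in> L2_time H_space L2_norm {0<..T}.
       has_time_derivative T u w \<and>
       (AE t in lebesgue_on {0<..T}. AE x in torus.
          w t x + \<nu> *\<^sub>R stokes (u t) x + NS_bilinear (u t) (u t) x = f x)) \<and>
    (AE x in torus. u 0 x = \<theta> x)"

end

(*
  Let z be the difference of the two solutions and Q = |z|_V^2 / |z|^2 its Dirichlet quotient.  The
  nonlinearity satisfies |B(u,u) - B(v,v)| <= c (|Au| + |Av|) |z|_V, and the identity
  <B(u,u), Au> = 0 of the planar periodic setting bounds the integral of |Au|^2 + |Av|^2 over [0,T] by U, nu,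
  T and the norm of f alone.  Hence Q' <= K Q with the integral of K under control, so that Q stays
  below a multiple of Q(0), and integrating (log |z|^2)' >= -c Q - c K gives the estimate B.
  Since Q(0) <= U^2 / |z(0)|^2, the estimate A is B solved for |z(0)|.

  Everything is carried out on Fourier coefficients: a strong solution has absolutely continuous
  coefficients, so that the energy identities for |z|^2 and |z|_V^2 follow by summation, and the Sobolev
  estimates reduce to the convergence of the sum of |k|^-4 over the nonzero frequencies k.
*)
theory Submission
  imports Defs
begin

section \<open>The space of square integrable periodic functions\<close>

text \<open>Q is the Rayleigh quotient of A at z. Without the nonlinear term it would not increase,
  and h = B(u,u) - B(v,v) adds at most |h|^2 / (2 \<nu> |z|^2) to Q', by completing a square. This
  is K Q with integrable K only if |h| is controlled by |z|_V with a square integrable coefficient.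
  Hence |z|_V has to suffice in both B(u,z) and B(z,v): the first uses that H^2 embeds into the
  bounded functions, the second that a product of two H^1 functions lies in L^2. The quotient is
  undefined where z vanishes, and that z never vanishes is part of the conclusion; the inequalities
  are therefore stated without division, and positivity is proved by continuation. The solutions are
  differentiable in time only in an integral sense, so chain rule and limits are proved for real
  primitives, where dominated convergence rests on the integrability of |Au|^2 + |du/dt|^2. Since Q
  is at least 1 by the Poincare inequality, additive constants are absorbed into multiples of Q, and
  the exponent becomes linear in \<open>c\<^sub>P\<close>.\<close>

lemma space_torus [simp]: "space torus = cbox 0 (\<chi> i. 2 * pi)"
  by (simp add: torus_def)

lemma finite_measure_torus: "finite_measure torus"
  unfolding torus_def by (rule finite_measure_lebesgue_on) simp

interpretation torus: finite_measure torus
  by (rule finite_measure_torus)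

lemma torus_measure: "measure torus (cbox 0 (\<chi> i. 2 * pi)) = (2 * pi)\<^sup>2"
proof -
  have "measure torus (cbox 0 (\<chi> i. 2 * pi)) = measure lebesgue (cbox 0 (\<chi> i. 2 * pi) :: (real^2) set)"
    unfolding torus_def by (subst measure_restrict_space) auto
  also have "\<dots> = (2 * pi)\<^sup>2"
    by (simp add: content_cbox_if_cart interval_eq_empty_cart not_less power2_eq_square UNIV_2)
  finally show ?thesis .
qed

lemma L2_per_periodic: "w \<in> L2_per \<Longrightarrow> periodic w"
  and L2_per_measurable: "w \<in> L2_per \<Longrightarrow> w \<in> borel_measurable torus"
  and L2_per_integrable_norm2: "w \<in> L2_per \<Longrightarrow> integrable torus (\<lambda>x. (norm (w x))\<^sup>2)"
  by (auto simp: L2_per_def)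

lemma L2_perI:
  "periodic w \<Longrightarrow> w \<in> borel_measurable torus \<Longrightarrow> integrable torus (\<lambda>x. (norm (w x))\<^sup>2) \<Longrightarrow> w \<in> L2_per"
  by (auto simp: L2_per_def)

text \<open>The comparison criterion behind the closure properties that follow. Periodicity and
  measurability are separate hypotheses, because domination almost everywhere says nothing about
  them.\<close>

lemma L2_perI_bound:
  fixes w :: "real^2 \<Rightarrow> 'a::euclidean_space" and g :: "real^2 \<Rightarrow> 'b::euclidean_space"
  assumes "periodic w" and w: "w \<in> borel_measurable torus"
    and g: "g \<in> L2_per" and "AE x in torus. norm (w x) \<le> c * norm (g x)"
  shows "w \<in> L2_per"
proof (rule L2_perI)
  show "integrable torus (\<lambda>x. (norm (w x))\<^sup>2)"
  proof (rule Bochner_Integration.integrable_bound)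
    show "integrable torus (\<lambda>x. c\<^sup>2 * (norm (g x))\<^sup>2)"
      using L2_per_integrable_norm2[OF g] by simp
    show "(\<lambda>x. (norm (w x))\<^sup>2) \<in> borel_measurable torus" using w by measurable
    show "AE x in torus. norm ((norm (w x))\<^sup>2) \<le> norm (c\<^sup>2 * (norm (g x))\<^sup>2)"
      using assms(4)
    proof eventually_elim
      case (elim x)
      then have "(norm (w x))\<^sup>2 \<le> (c * norm (g x))\<^sup>2" by (intro power_mono) auto
      then show ?case by (simp add: power_mult_distrib)
    qed
  qed
qed (use assms in auto)

lemma L2_per_bounded:
  fixes w :: "real^2 \<Rightarrow> 'a::euclidean_space"
  assumes "periodic w" "w \<in> borel_measurable torus" "\<And>x. norm (w x) \<le> B"
  shows "w \<in> L2_per"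
proof -
  have "(\<lambda>x. 1::real) \<in> L2_per" by (auto intro!: L2_perI simp: periodic_def)
  from L2_perI_bound[OF assms(1,2) this, of B] assms(3) show ?thesis by simp
qed

lemma L2_per_integrable_inner:
  fixes u v :: "real^2 \<Rightarrow> 'a::euclidean_space"
  assumes u: "u \<in> L2_per" and v: "v \<in> L2_per"
  shows "integrable torus (\<lambda>x. u x \<bullet> v x)"
proof (rule Bochner_Integration.integrable_bound)
  note [measurable] = L2_per_measurable[OF u] L2_per_measurable[OF v]
  show "integrable torus (\<lambda>x. (norm (u x))\<^sup>2 + (norm (v x))\<^sup>2)"
    using assms by (auto intro: L2_per_integrable_norm2)
  show "(\<lambda>x. u x \<bullet> v x) \<in> borel_measurable torus" by measurable
  have "\<bar>u x \<bullet> v x\<bar> \<le> (norm (u x))\<^sup>2 + (norm (v x))\<^sup>2" for x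
    using Cauchy_Schwarz_ineq2[of "u x" "v x"] sum_squares_bound[of "norm (u x)" "norm (v x)"]
      norm_ge_zero[of "u x"] norm_ge_zero[of "v x"] mult_nonneg_nonneg[of "norm (u x)" "norm (v x)"]
    by linarith
  then show "AE x in torus. norm (u x \<bullet> v x) \<le> norm ((norm (u x))\<^sup>2 + (norm (v x))\<^sup>2)"
    by simp
qed

lemma L2_per_const: "(\<lambda>x. c) \<in> (L2_per :: (real^2 \<Rightarrow> 'a::euclidean_space) set)"
  by (rule L2_per_bounded[of _ "norm c"]) (auto simp: periodic_def)

lemma L2_per_norm: "u \<in> L2_per \<Longrightarrow> (\<lambda>x. norm (u x)) \<in> L2_per"
  by (auto intro!: L2_perI simp: periodic_def L2_per_def)

lemma L2_per_integrable_norm_mult: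
  assumes "u \<in> L2_per" and "v \<in> L2_per"
  shows "integrable torus (\<lambda>x. norm (u x) * norm (v x))"
  using L2_per_integrable_inner[OF L2_per_norm[OF assms(1)] L2_per_norm[OF assms(2)]] by simp

lemma L2_per_integrable:
  fixes u :: "real^2 \<Rightarrow> 'a::euclidean_space"
  assumes u: "u \<in> L2_per"
  shows "integrable torus u"
proof (rule Bochner_Integration.integrable_bound)
  show "integrable torus (\<lambda>x. norm (u x) * norm (1::real))"
    by (rule L2_per_integrable_norm_mult[OF u L2_per_const])
qed (use L2_per_measurable[OF u] in auto)

lemma L2_per_add:
  fixes u v :: "real^2 \<Rightarrow> 'a::euclidean_space"
  assumes u: "u \<in> L2_per" and v: "v \<in> L2_per"
  shows "(\<lambda>x. u x + v x) \<in> L2_per"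
proof (rule L2_perI)
  note [measurable] = L2_per_measurable[OF u] L2_per_measurable[OF v]
  show "periodic (\<lambda>x. u x + v x)" using assms by (auto simp: L2_per_def periodic_def)
  show "(\<lambda>x. u x + v x) \<in> borel_measurable torus" by measurable
  have "integrable torus (\<lambda>x. (norm (u x))\<^sup>2 + (norm (v x))\<^sup>2 + 2 * (u x \<bullet> v x))"
    using assms by (auto intro!: L2_per_integrable_norm2 L2_per_integrable_inner)
  then show "integrable torus (\<lambda>x. (norm (u x + v x))\<^sup>2)"
    by (rule back_subst[of "integrable torus"])
      (simp add: power2_norm_eq_inner algebra_simps inner_commute)
qed

lemma L2_per_scaleR:
  fixes u :: "real^2 \<Rightarrow> 'a::euclidean_space"
  assumes u: "u \<in> L2_per"
  shows "(\<lambda>x. c *\<^sub>R u x) \<in> L2_per"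
  by (rule L2_perI_bound[OF _ _ u, of _ "\<bar>c\<bar>"])
     (use u in \<open>auto simp: L2_per_def periodic_def\<close>)

lemma L2_per_uminus:
  fixes u :: "real^2 \<Rightarrow> 'a::euclidean_space"
  shows "u \<in> L2_per \<Longrightarrow> (\<lambda>x. - u x) \<in> L2_per"
  using L2_per_scaleR[of u "-1"] by simp

lemma L2_per_diff:
  fixes u v :: "real^2 \<Rightarrow> 'a::euclidean_space"
  assumes "u \<in> L2_per" and "v \<in> L2_per"
  shows "(\<lambda>x. u x - v x) \<in> L2_per"
  using L2_per_add[OF assms(1) L2_per_uminus[OF assms(2)]] by simp

lemma L2_per_sum:
  fixes u :: "'i \<Rightarrow> real^2 \<Rightarrow> 'a::euclidean_space"
  shows "(\<And>i. i \<in> I \<Longrightarrow> u i \<in> L2_per) \<Longrightarrow> (\<lambda>x. \<Sum>i\<in>I. u i x) \<in> L2_per"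
  by (induction I rule: infinite_finite_induct) (auto intro: L2_per_const L2_per_add)

lemma L2_per_diff': "u \<in> L2_per \<Longrightarrow> v \<in> L2_per \<Longrightarrow> u - v \<in> L2_per"
  by (simp add: fun_diff_def L2_per_diff)

lemma L2_per_cnj: "u \<in> L2_per \<Longrightarrow> (\<lambda>x. cnj (u x)) \<in> L2_per"
  by (rule L2_perI_bound[where g=u and c=1]) (auto simp: L2_per_def periodic_def
      intro: borel_measurable_continuous_on[where f=cnj, OF continuous_on_cnj[OF continuous_on_id]])

lemma L2_per_mult_left:
  fixes u :: "real^2 \<Rightarrow> complex"
  shows "u \<in> L2_per \<Longrightarrow> (\<lambda>x. c * u x) \<in> L2_per"
  by (rule L2_perI_bound[where g=u and c="norm c"]) (auto simp: L2_per_def periodic_def norm_mult)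

lemma L2_per_of_real: "u \<in> L2_per \<Longrightarrow> (\<lambda>x. complex_of_real (u x)) \<in> L2_per"
  by (rule L2_perI_bound[where g=u and c=1]) (auto simp: L2_per_def periodic_def)

lemma L2_per_component: "u \<in> L2_per \<Longrightarrow> (\<lambda>x. u x $ i) \<in> L2_per" for u :: field2
  by (rule L2_perI_bound[where g=u and c=1]) (auto simp: L2_per_def periodic_def component_le_norm_cart
      intro!: borel_measurable_continuous_on[where f="\<lambda>x. x $ i"] continuous_intros)

section \<open>Inner product, norm, and limits in the norm\<close>

lemma L2_inner_commute: "L2_inner u v = L2_inner v u"
  by (simp add: L2_inner_def inner_commute)

lemma L2_inner_add_left:
  assumes "u \<in> L2_per" "v \<in> L2_per" "w \<in> L2_per"
  shows "L2_inner (\<lambda>x. u x + v x) w = L2_inner u w + L2_inner v w"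
  using assms by (simp add: L2_inner_def inner_add_left L2_per_integrable_inner)

lemma L2_inner_diff_left:
  assumes "u \<in> L2_per" "v \<in> L2_per" "w \<in> L2_per"
  shows "L2_inner (\<lambda>x. u x - v x) w = L2_inner u w - L2_inner v w"
  using assms by (simp add: L2_inner_def inner_diff_left L2_per_integrable_inner)

lemma L2_inner_scaleR_left: "L2_inner (\<lambda>x. c *\<^sub>R u x) w = c * L2_inner u w"
  by (simp add: L2_inner_def)

lemma L2_inner_add_right:
  assumes "u \<in> L2_per" "v \<in> L2_per" "w \<in> L2_per"
  shows "L2_inner w (\<lambda>x. u x + v x) = L2_inner w u + L2_inner w v"
  using L2_inner_add_left[OF assms] by (simp add: L2_inner_commute)

lemma L2_inner_diff_right:
  assumes "u \<in> L2_per" "v \<in> L2_per" "w \<in> L2_per"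
  shows "L2_inner w (\<lambda>x. u x - v x) = L2_inner w u - L2_inner w v"
  using L2_inner_diff_left[OF assms] by (simp add: L2_inner_commute)

lemma L2_inner_scaleR_right: "L2_inner w (\<lambda>x. c *\<^sub>R u x) = c * L2_inner w u"
  by (simp add: L2_inner_def)

lemma L2_inner_ge0: "0 \<le> L2_inner u u"
  by (simp add: L2_inner_def)

lemma L2_norm_ge0: "0 \<le> L2_norm u"
  by (simp add: L2_norm_def L2_inner_ge0)

lemma L2_norm_power2: "(L2_norm u)\<^sup>2 = L2_inner u u"
  by (simp add: L2_norm_def L2_inner_ge0)

lemma L2_norm_power2_integral: "(L2_norm u)\<^sup>2 = (\<integral>x. (norm (u x))\<^sup>2 \<partial>torus)"
  by (simp add: L2_norm_power2 L2_inner_def power2_norm_eq_inner)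

text \<open>Nonnegativity of the squared norm of u - t v for every t. On representatives the form is
  only semidefinite, so \<open>c = 0\<close> is a case of its own: the quadratic in t is then
  affine, and boundedness below forces \<open>b = 0\<close>.\<close>

lemma L2_inner_Cauchy_Schwarz:
  assumes u: "u \<in> L2_per" and v: "v \<in> L2_per"
  shows "\<bar>L2_inner u v\<bar> \<le> L2_norm u * L2_norm v"
proof -
  define a b c where "a = L2_inner u u" and "b = L2_inner u v" and "c = L2_inner v v"
  have q: "0 \<le> a - 2 * t * b + t\<^sup>2 * c" for t
  proof -
    let ?s = "\<lambda>x. t *\<^sub>R v x"
    have s: "?s \<in> L2_per" by (rule L2_per_scaleR[OF v])
    have "L2_inner (\<lambda>x. u x - ?s x) (\<lambda>x. u x - ?s x) = a - 2 * t * b + t\<^sup>2 * c"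
      using u v s L2_per_diff[OF u s]
      by (simp add: L2_inner_diff_left L2_inner_diff_right L2_inner_scaleR_left L2_inner_scaleR_right
          a_def b_def c_def L2_inner_commute[of v u] power2_eq_square algebra_simps)
    then show ?thesis using L2_inner_ge0 by metis
  qed
  have "b\<^sup>2 \<le> a * c"
  proof (cases "c = 0")
    case True
    have "b = 0"
    proof (rule ccontr)
      assume "b \<noteq> 0"
      \<comment> \<open>At this t the affine function a - 2 t b takes the value -1.\<close>
      then show False using q[of "(a + 1) / (2 * b)"] True by (simp add: field_simps)
    qed
    then show ?thesis using True by simp
  next
    case False
    then have "c > 0" using L2_inner_ge0[of v] by (simp add: c_def)
    then show ?thesis using q[of "b / c"] by (simp add: power2_eq_square field_simps)
  qed
  then have "sqrt (b\<^sup>2) \<le> sqrt (a * c)" by (rule real_sqrt_le_mono)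
  then show ?thesis by (simp add: a_def b_def c_def L2_norm_def real_sqrt_mult)
qed

lemma L2_norm_triangle:
  assumes u: "u \<in> L2_per" and v: "v \<in> L2_per"
  shows "L2_norm (\<lambda>x. u x + v x) \<le> L2_norm u + L2_norm v"
proof (rule power2_le_imp_le)
  have "(L2_norm (\<lambda>x. u x + v x))\<^sup>2 = L2_inner u u + 2 * L2_inner u v + L2_inner v v"
    using u v L2_per_add[OF u v]
    by (simp add: L2_norm_power2 L2_inner_add_left L2_inner_add_right L2_inner_commute[of v u])
  also have "\<dots> \<le> (L2_norm u + L2_norm v)\<^sup>2"
    using L2_inner_Cauchy_Schwarz[OF u v] by (simp add: L2_norm_power2 power2_sum)
  finally show "(L2_norm (\<lambda>x. u x + v x))\<^sup>2 \<le> (L2_norm u + L2_norm v)\<^sup>2" .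
qed (simp add: L2_norm_ge0)

lemma L2_norm_scaleR: "L2_norm (\<lambda>x. c *\<^sub>R u x) = \<bar>c\<bar> * L2_norm u"
proof -
  have "L2_inner (\<lambda>x. c *\<^sub>R u x) (\<lambda>x. c *\<^sub>R u x) = c\<^sup>2 * L2_inner u u"
    by (simp add: L2_inner_scaleR_left L2_inner_scaleR_right power2_eq_square)
  then show ?thesis by (simp add: L2_norm_def real_sqrt_mult)
qed

lemma L2_norm_uminus: "L2_norm (\<lambda>x. - u x) = L2_norm u"
  using L2_norm_scaleR[of "-1" u] by simp

lemma L2_norm_minus_commute: "L2_norm (\<lambda>x. u x - v x) = L2_norm (\<lambda>x. v x - u x)"
  using L2_norm_uminus[of "\<lambda>x. u x - v x"] by simp

lemma L2_norm_triangle_diff: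
  assumes "u \<in> L2_per" "v \<in> L2_per"
  shows "L2_norm (\<lambda>x. u x - v x) \<le> L2_norm u + L2_norm v"
  using L2_norm_triangle[OF assms(1) L2_per_uminus[OF assms(2)]] by (simp add: L2_norm_uminus)

lemma L2_inner_cong_AE:
  assumes "u \<in> L2_per" "u' \<in> L2_per" "v \<in> L2_per" "v' \<in> L2_per"
    and "AE x in torus. u x = u' x" "AE x in torus. v x = v' x"
  shows "L2_inner u v = L2_inner u' v'"
  unfolding L2_inner_def
proof (rule integral_cong_AE)
  show "AE x in torus. u x \<bullet> v x = u' x \<bullet> v' x" using assms(5,6) by eventually_elim simp
qed (use assms in \<open>auto intro: borel_measurable_integrable L2_per_integrable_inner\<close>)

lemma L2_norm_cong_AE:
  assumes "u \<in> L2_per" "u' \<in> L2_per" "AE x in torus. u x = u' x"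
  shows "L2_norm u = L2_norm u'"
  unfolding L2_norm_def using L2_inner_cong_AE[OF assms(1,2,1,2,3,3)] by simp

lemma L2_norm_eq_0_iff:
  assumes u: "u \<in> L2_per"
  shows "L2_norm u = 0 \<longleftrightarrow> (AE x in torus. u x = 0)"
proof -
  have "L2_norm u = 0 \<longleftrightarrow> (\<integral>x. (norm (u x))\<^sup>2 \<partial>torus) = 0"
    using L2_norm_power2_integral[of u] by (metis power_zero_numeral power_eq_0_iff)
  also have "\<dots> \<longleftrightarrow> (AE x in torus. (norm (u x))\<^sup>2 = 0)"
    by (rule integral_nonneg_eq_0_iff_AE[OF L2_per_integrable_norm2[OF u]]) simp
  finally show ?thesis by simp
qed

text \<open>Cauchy-Schwarz against the constant 1, whose norm is the square root of the area (2
  \<pi>)^2.\<close>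

lemma L2_norm_integral_bound:
  assumes u: "u \<in> L2_per"
  shows "(\<integral>x. norm (u x) \<partial>torus) \<le> 2 * pi * L2_norm u"
proof -
  have "\<bar>L2_inner (\<lambda>x. norm (u x)) (\<lambda>x. 1)\<bar> \<le> L2_norm (\<lambda>x. norm (u x)) * L2_norm (\<lambda>x. 1::real)"
    by (rule L2_inner_Cauchy_Schwarz[OF L2_per_norm[OF u] L2_per_const])
  moreover have "L2_norm (\<lambda>x. norm (u x)) = L2_norm u"
    by (simp add: L2_norm_def L2_inner_def power2_norm_eq_inner[symmetric] power2_eq_square[symmetric])
  moreover have "L2_norm (\<lambda>x::real^2. 1::real) = 2 * pi"
    by (simp add: L2_norm_def L2_inner_def torus_measure real_sqrt_mult)
  ultimately show ?thesis by (simp add: L2_inner_def mult.commute)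
qed

text \<open>Products need both factors to converge along one common subsequence, so the L^1
  criterion is applied to the sum of the two errors. On a cell of finite area, convergence in L^2
  implies convergence in L^1.\<close>

lemma L2_converge_subseq_AE:
  fixes f :: "nat \<Rightarrow> real^2 \<Rightarrow> 'a::euclidean_space" and g :: "nat \<Rightarrow> real^2 \<Rightarrow> 'b::euclidean_space"
  assumes f: "\<And>n. f n \<in> L2_per" "f0 \<in> L2_per" "(\<lambda>n. L2_norm (\<lambda>x. f n x - f0 x)) \<longlonglongrightarrow> 0"
    and g: "\<And>n. g n \<in> L2_per" "g0 \<in> L2_per" "(\<lambda>n. L2_norm (\<lambda>x. g n x - g0 x)) \<longlonglongrightarrow> 0"
  obtains r where "strict_mono r"
    "AE x in torus. (\<lambda>n. f (r n) x) \<longlonglongrightarrow> f0 x \<and> (\<lambda>n. g (r n) x) \<longlonglongrightarrow> g0 x"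
proof -
  let ?h = "\<lambda>n x. norm (f n x - f0 x) + norm (g n x - g0 x)"
  have i: "integrable torus (\<lambda>x. norm (f n x - f0 x))" "integrable torus (\<lambda>x. norm (g n x - g0 x))" for n
    using f g by (auto intro!: integrable_norm[OF L2_per_integrable] L2_per_diff)
  have "(\<lambda>n. \<integral>x. norm (?h n x) \<partial>torus) \<longlonglongrightarrow> 0"
  proof (rule tendsto_sandwich[OF _ _ tendsto_const])
    show "eventually (\<lambda>n. (\<integral>x. norm (?h n x) \<partial>torus) \<le>
        2 * pi * L2_norm (\<lambda>x. f n x - f0 x) + 2 * pi * L2_norm (\<lambda>x. g n x - g0 x)) sequentially"
    proof (rule always_eventually, rule allI)
      fix n
      have "(\<integral>x. norm (?h n x) \<partial>torus) = (\<integral>x. norm (f n x - f0 x) \<partial>torus) + (\<integral>x. norm (g n x - g0 x) \<partial>torus)"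
        using i by simp
      then show "(\<integral>x. norm (?h n x) \<partial>torus) \<le>
        2 * pi * L2_norm (\<lambda>x. f n x - f0 x) + 2 * pi * L2_norm (\<lambda>x. g n x - g0 x)"
        using L2_norm_integral_bound[OF L2_per_diff[OF f(1)[of n] f(2)]]
          L2_norm_integral_bound[OF L2_per_diff[OF g(1)[of n] g(2)]] by linarith
    qed
    show "(\<lambda>n. 2 * pi * L2_norm (\<lambda>x. f n x - f0 x) + 2 * pi * L2_norm (\<lambda>x. g n x - g0 x)) \<longlonglongrightarrow> 0"
      using tendsto_add[OF tendsto_mult_left[OF f(3), of "2*pi"] tendsto_mult_left[OF g(3), of "2*pi"]] by simp
  qed (auto intro!: always_eventually integral_nonneg_AE)
  then obtain r :: "nat \<Rightarrow> nat" where r: "strict_mono r" and ae: "AE x in torus. (\<lambda>n. ?h (r n) x) \<longlonglongrightarrow> 0"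
    using tendsto_L1_AE_subseq[of torus ?h] i by auto
  have "AE x in torus. (\<lambda>n. f (r n) x) \<longlonglongrightarrow> f0 x \<and> (\<lambda>n. g (r n) x) \<longlonglongrightarrow> g0 x"
    using ae
  proof eventually_elim
    case (elim x)
    have "(\<lambda>n. norm (f (r n) x - f0 x)) \<longlonglongrightarrow> 0" "(\<lambda>n. norm (g (r n) x - g0 x)) \<longlonglongrightarrow> 0"
      by (rule tendsto_sandwich[OF _ _ tendsto_const elim]; auto intro!: always_eventually)+
    then show ?case by (simp add: LIM_zero_iff tendsto_norm_zero_iff)
  qed
  with r that show thesis by blast
qed

text \<open>Fatou's lemma. Square integrability of the limit is part of the conclusion, which
  matters for limits of products.\<close>

lemma L2_norm_limit_bound:
  fixes f :: "nat \<Rightarrow> real^2 \<Rightarrow> 'a::euclidean_space"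
  assumes f: "\<And>n. f n \<in> L2_per" and g: "g \<in> borel_measurable torus" "periodic g"
    and lim: "AE x in torus. (\<lambda>n. f n x) \<longlonglongrightarrow> g x"
    and bd: "eventually (\<lambda>n. L2_norm (f n) \<le> B) sequentially"
  shows "g \<in> L2_per \<and> L2_norm g \<le> B"
proof -
  have B: "0 \<le> B"
    using bd L2_norm_ge0 by (meson eventually_sequentially order_refl order_trans)
  have m[measurable]: "\<And>n. f n \<in> borel_measurable torus" "g \<in> borel_measurable torus"
    using f g by (auto intro: L2_per_measurable)
  have "(\<integral>\<^sup>+x. ennreal ((norm (g x))\<^sup>2) \<partial>torus) = (\<integral>\<^sup>+x. liminf (\<lambda>n. ennreal ((norm (f n x))\<^sup>2)) \<partial>torus)"
  proof (rule nn_integral_cong_AE)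
    show "AE x in torus. ennreal ((norm (g x))\<^sup>2) = liminf (\<lambda>n. ennreal ((norm (f n x))\<^sup>2))"
      using lim
    proof eventually_elim
      case (elim x)
      have "(\<lambda>n. ennreal ((norm (f n x))\<^sup>2)) \<longlonglongrightarrow> ennreal ((norm (g x))\<^sup>2)"
        by (intro tendsto_ennrealI tendsto_intros elim)
      then show ?case by (intro lim_imp_Liminf[symmetric]) auto
    qed
  qed
  also have "\<dots> \<le> liminf (\<lambda>n. \<integral>\<^sup>+x. ennreal ((norm (f n x))\<^sup>2) \<partial>torus)"
    by (rule nn_integral_liminf) simp
  also have "\<dots> \<le> ennreal (B\<^sup>2)"
  proof (rule order_trans[OF Liminf_le_Limsup Limsup_bounded], simp, rule eventually_mono[OF bd])
    fix n assume "L2_norm (f n) \<le> B"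
    have "(\<integral>\<^sup>+x. ennreal ((norm (f n x))\<^sup>2) \<partial>torus) = ennreal ((L2_norm (f n))\<^sup>2)"
      unfolding L2_norm_power2_integral
      by (rule nn_integral_eq_integral[OF L2_per_integrable_norm2[OF f]]) simp
    also have "\<dots> \<le> ennreal (B\<^sup>2)" using \<open>L2_norm (f n) \<le> B\<close>
      by (intro ennreal_leI power_mono) (auto simp: L2_norm_ge0)
    finally show "(\<integral>\<^sup>+x. ennreal ((norm (f n x))\<^sup>2) \<partial>torus) \<le> ennreal (B\<^sup>2)" .
  qed
  finally have le: "(\<integral>\<^sup>+x. ennreal ((norm (g x))\<^sup>2) \<partial>torus) \<le> ennreal (B\<^sup>2)" .
  have int: "integrable torus (\<lambda>x. (norm (g x))\<^sup>2)"
    using le by (intro integrableI_bounded) (auto simp: less_top[symmetric] top_unique)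
  have "ennreal ((L2_norm g)\<^sup>2) \<le> ennreal (B\<^sup>2)"
    unfolding L2_norm_power2_integral using le by (subst (asm) nn_integral_eq_integral[OF int]) auto
  then have "(L2_norm g)\<^sup>2 \<le> B\<^sup>2" by (simp add: ennreal_le_iff)
  then show ?thesis using int g B by (auto intro!: L2_perI power2_le_imp_le)
qed

text \<open>The Riesz-Fischer argument: a subsequence whose increments have norm at most 2^-k has
  summable increments in L^1, hence converges almost everywhere, and Fatou's lemma turns the
  pointwise limit into a limit in norm.\<close>

lemma L2_complete:
  fixes f :: "nat \<Rightarrow> real^2 \<Rightarrow> 'a::euclidean_space"
  assumes f: "\<And>n. f n \<in> L2_per"
    and cauchy: "\<And>\<epsilon>. \<epsilon> > 0 \<Longrightarrow> \<exists>M. \<forall>m\<ge>M. \<forall>n\<ge>M. L2_norm (\<lambda>x. f m x - f n x) \<le> \<epsilon>"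
  obtains g where "g \<in> L2_per" "(\<lambda>n. L2_norm (\<lambda>x. f n x - g x)) \<longlonglongrightarrow> 0"
proof -
  have "\<forall>k. \<exists>M. \<forall>m\<ge>M. \<forall>n\<ge>M. L2_norm (\<lambda>x. f m x - f n x) \<le> (1/2)^k"
    using cauchy by (simp del: power_one_over)
  then obtain M where M: "\<And>k m n. m \<ge> M k \<Longrightarrow> n \<ge> M k \<Longrightarrow> L2_norm (\<lambda>x. f m x - f n x) \<le> (1/2)^k"
    by metis
  \<comment> \<open>The maximum makes r strictly increasing and keeps r k at least M k.\<close>
  define r where "r = rec_nat (M 0) (\<lambda>k s. max (Suc s) (M (Suc k)))"
  have r_Suc: "r (Suc k) = max (Suc (r k)) (M (Suc k))" and r_0: "r 0 = M 0" for k by (simp_all add: r_def)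
  have "strict_mono r" by (rule strict_monoI_Suc) (simp add: r_Suc)
  have rM: "M k \<le> r k" for k by (cases k) (simp_all add: r_Suc r_0)
  have d: "L2_norm (\<lambda>x. f (r (Suc k)) x - f (r k) x) \<le> (1/2)^k" for k
    by (rule M) (use rM[of k] strict_monoD[OF \<open>strict_mono r\<close>, of k "Suc k"] in linarith)+
  define h where "h = (\<lambda>k x. f (r (Suc k)) x - f (r k) x)"
  have hL: "h k \<in> L2_per" for k unfolding h_def by (intro L2_per_diff f)
  note [measurable] = L2_per_measurable[OF hL] L2_per_measurable[OF f]
  have "(\<integral>\<^sup>+x. (\<Sum>k. ennreal (norm (h k x))) \<partial>torus) = (\<Sum>k. \<integral>\<^sup>+x. ennreal (norm (h k x)) \<partial>torus)"
    by (rule nn_integral_suminf) simp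
  also have "\<dots> \<le> (\<Sum>k. ennreal (2 * pi * (1/2)^k))"
  proof (rule suminf_le)
    fix k
    have "(\<integral>\<^sup>+x. ennreal (norm (h k x)) \<partial>torus) = ennreal (\<integral>x. norm (h k x) \<partial>torus)"
      by (rule nn_integral_eq_integral) (auto intro!: integrable_norm[OF L2_per_integrable] hL)
    also have "\<dots> \<le> ennreal (2 * pi * (1/2)^k)"
    proof (rule ennreal_leI)
      have "(\<integral>x. norm (h k x) \<partial>torus) \<le> 2 * pi * L2_norm (h k)" by (rule L2_norm_integral_bound[OF hL])
      also have "\<dots> \<le> 2 * pi * (1/2)^k" using d[of k] by (intro mult_left_mono) (auto simp: h_def)
      finally show "(\<integral>x. norm (h k x) \<partial>torus) \<le> 2 * pi * (1/2)^k" .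
    qed
    finally show "(\<integral>\<^sup>+x. ennreal (norm (h k x)) \<partial>torus) \<le> ennreal (2 * pi * (1/2)^k)" .
  qed auto
  also have "\<dots> < \<infinity>"
    by (subst suminf_ennreal2) (auto intro!: summable_mult summable_geometric)
  finally have "AE x in torus. (\<Sum>k. ennreal (norm (h k x))) \<noteq> \<infinity>"
    by (intro nn_integral_noteq_infinite) auto
  then have conv: "AE x in torus. convergent (\<lambda>k. f (r k) x)"
  proof eventually_elim
    case (elim x)
    have "summable (\<lambda>k. norm (h k x))"
      by (rule summable_suminf_not_top) (use elim in auto)
    then have "summable (\<lambda>k. h k x)" by (rule summable_norm_cancel)
    then have "convergent (\<lambda>n. (\<Sum>k<n. h k x) + f (r 0) x)"
      by (intro convergent_add convergent_const) (simp add: summable_iff_convergent)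
    moreover have "(\<Sum>k<n. h k x) + f (r 0) x = f (r n) x" for n
      unfolding h_def by (simp add: sum_lessThan_telescope[of "\<lambda>k. f (r k) x"])
    ultimately show ?case by simp
  qed
  \<comment> \<open>A shift by a period does not change the sequence of values, so
    \<open>lim\<close> yields a function that is periodic at every point, also where the sequence
    diverges.\<close>
  define g where "g = (\<lambda>x. lim (\<lambda>k. f (r k) x))"
  have gm: "g \<in> borel_measurable torus" unfolding g_def by measurable
  have gp: "periodic g" using f by (auto simp: g_def periodic_def L2_per_def)
  have lim: "AE x in torus. (\<lambda>k. f (r k) x) \<longlonglongrightarrow> g x"
    using conv by eventually_elim (simp add: g_def convergent_LIMSEQ_iff)
  have tail: "(\<lambda>x. f n x - g x) \<in> L2_per \<and> L2_norm (\<lambda>x. f n x - g x) \<le> (1/2)^k" if "n \<ge> M k" for n k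
  proof (rule L2_norm_limit_bound[where f = "\<lambda>j x. f n x - f (r j) x"])
    show "(\<lambda>x. f n x - g x) \<in> borel_measurable torus" using gm by measurable
    show "periodic (\<lambda>x. f n x - g x)" using gp f[of n] by (auto simp: periodic_def L2_per_def)
    show "AE x in torus. (\<lambda>j. f n x - f (r j) x) \<longlonglongrightarrow> f n x - g x"
      using lim by eventually_elim (intro tendsto_intros)
    have "eventually (\<lambda>j. j \<ge> M k) sequentially" by (rule eventually_ge_at_top)
    then show "eventually (\<lambda>j. L2_norm (\<lambda>x. f n x - f (r j) x) \<le> (1/2)^k) sequentially"
    proof eventually_elim
      case (elim j)
      then have "M k \<le> r j" using seq_suble[OF \<open>strict_mono r\<close>, of j] by linarith
      then show ?case using M[OF that] by simp
    qed
  qed (intro L2_per_diff f)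
  show thesis
  proof
    have "(\<lambda>x. f (M 0) x - (f (M 0) x - g x)) \<in> L2_per" by (rule L2_per_diff[OF f conjunct1[OF tail[of 0]]]) simp
    then show "g \<in> L2_per" by simp
    show "(\<lambda>n. L2_norm (\<lambda>x. f n x - g x)) \<longlonglongrightarrow> 0"
    proof (rule LIMSEQ_I)
      fix e :: real assume "0 < e"
      then obtain k where k: "(1/2::real)^k < e" using real_arch_pow_inv[of e "1/2"] by auto
      have "norm (L2_norm (\<lambda>x. f n x - g x) - 0) < e" if "n \<ge> M k" for n
        using tail[OF that] k L2_norm_ge0[of "\<lambda>x. f n x - g x"] by simp
      then show "\<exists>no. \<forall>n\<ge>no. norm (L2_norm (\<lambda>x. f n x - g x) - 0) < e" by blast
    qed
  qed
qed

section \<open>Fourier series on the torus\<close>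

definition wave :: "int^2 \<Rightarrow> real^2 \<Rightarrow> complex" where
  "wave k x = cis (\<Sum>j\<in>UNIV. of_int (k $ j) * x $ j)"

definition fbox :: "nat \<Rightarrow> (int^2) set" where
  "fbox N = {k. \<forall>j. \<bar>k $ j\<bar> \<le> int N}"

text \<open>The functions wave k / (2 \<pi>) are orthonormal, so coefficients with respect to them
  satisfy Bessel and Parseval with constant 1. \<open>fourier\<close> is normalised to
  match.\<close>

definition trig_sum :: "(int^2) set \<Rightarrow> (int^2 \<Rightarrow> complex) \<Rightarrow> real^2 \<Rightarrow> complex" where
  "trig_sum S a x = (\<Sum>k\<in>S. a k * (wave k x / (2 * pi)))"

definition fourier :: "(real^2 \<Rightarrow> complex) \<Rightarrow> int^2 \<Rightarrow> complex" where
  "fourier f k = (\<integral>x. f x * cnj (wave k x) \<partial>torus) / (2 * pi)"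

lemma finite_fbox [simp]: "finite (fbox N)"
proof (rule finite_subset)
  show "fbox N \<subseteq> (\<lambda>(a, b). \<chi> j. if j = 1 then a else b) ` ({- int N..int N} \<times> {- int N..int N})"
  proof
    fix k assume "k \<in> fbox N"
    then have "(k $ 1, k $ 2) \<in> {- int N..int N} \<times> {- int N..int N}"
      by (auto simp: fbox_def abs_le_iff minus_le_iff)
    moreover have "k = (\<lambda>(a, b). \<chi> j. if j = 1 then a else b) (k $ 1, k $ 2)"
      by (auto simp: vec_eq_iff forall_2)
    ultimately show "k \<in> (\<lambda>(a, b). \<chi> j. if j = 1 then a else b) ` ({- int N..int N} \<times> {- int N..int N})"
      by blast
  qed
qed auto

lemma fbox_mono: "M \<le> N \<Longrightarrow> fbox M \<subseteq> fbox N"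
  unfolding fbox_def using order_trans[OF _ of_nat_mono[of M N, where ?'a = int]] by blast

lemma self_le_int_nat: "n \<le> int (nat n)"
  by linarith

lemma finite_subset_fbox:
  assumes "finite S"
  obtains N where "S \<subseteq> fbox N"
proof
  show "S \<subseteq> fbox (nat (\<Sum>k\<in>S. \<Sum>j\<in>UNIV. \<bar>k $ j\<bar>))"
  proof
    fix k assume "k \<in> S"
    have "\<bar>k $ j\<bar> \<le> (\<Sum>k\<in>S. \<Sum>j\<in>UNIV. \<bar>k $ j\<bar>)" for j
    proof -
      have "\<bar>k $ j\<bar> \<le> (\<Sum>j\<in>UNIV. \<bar>k $ j\<bar>)" by (rule member_le_sum) auto
      also have "\<dots> \<le> (\<Sum>k\<in>S. \<Sum>j\<in>UNIV. \<bar>k $ j\<bar>)"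
        using \<open>k \<in> S\<close> assms by (intro member_le_sum[of k S "\<lambda>k. \<Sum>j\<in>UNIV. \<bar>k $ j\<bar>"]) (auto intro: sum_nonneg)
      finally show ?thesis .
    qed
    then show "k \<in> fbox (nat (\<Sum>k\<in>S. \<Sum>j\<in>UNIV. \<bar>k $ j\<bar>))"
      unfolding fbox_def using order_trans[OF _ self_le_int_nat] by blast
  qed
qed

lemma eventually_in_fbox: "eventually (\<lambda>N. k \<in> fbox N) sequentially"
proof -
  obtain N where "{k} \<subseteq> fbox N" by (rule finite_subset_fbox[of "{k}"]) auto
  then show ?thesis using fbox_mono unfolding eventually_sequentially by blast
qed

section \<open>The exponentials and their orthogonality\<close>

lemma wave_0 [simp]: "wave 0 x = 1"
  by (simp add: wave_def)

lemma wave_add: "wave (k + l) x = wave k x * wave l x"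
  by (simp add: wave_def cis_mult algebra_simps sum.distrib)

lemma wave_uminus: "wave (- k) x = cnj (wave k x)"
  by (simp add: wave_def cis_cnj sum_negf)

lemma wave_diff: "wave (k - l) x = wave k x * cnj (wave l x)"
  using wave_add[of k "-l" x] by (simp add: wave_uminus)

lemma norm_wave [simp]: "norm (wave k x) = 1"
  by (simp add: wave_def)

lemma wave_periodic: "periodic (wave k)"
  unfolding periodic_def
proof (intro allI)
  fix x :: "real^2" and j :: 2
  have "(\<Sum>i\<in>UNIV. of_int (k $ i) * (x + axis j (2 * pi)) $ i) =
    (\<Sum>i\<in>UNIV. of_int (k $ i) * x $ i) + of_int (k $ j) * (2 * pi)"
    by (simp add: algebra_simps sum.distrib axis_def if_distrib[of "\<lambda>x. _ * x"] cong: if_cong)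
  moreover have "cis (of_int (k $ j) * (2 * pi)) = 1"
    by (simp add: complex_eq_iff mult.commute[of _ "2 * pi"] cos_int_2pin sin_int_2pin)
  ultimately show "wave k (x + axis j (2 * pi)) = wave k x"
    unfolding wave_def by (simp add: cis_mult[symmetric])
qed

lemma continuous_on_wave [continuous_intros]: "continuous_on S (wave k)"
  unfolding wave_def by (intro continuous_intros)

lemma measurable_torus_continuous: "continuous_on UNIV f \<Longrightarrow> f \<in> borel_measurable torus"
  unfolding torus_def
  by (intro measurable_restrict_space1 measurable_completion)
     (auto intro: borel_measurable_continuous_onI measurable_lborel1)

lemma wave_measurable [measurable]: "wave k \<in> borel_measurable torus"
  by (intro measurable_torus_continuous continuous_intros)

lemma wave_L2_per: "wave k \<in> L2_per"
  by (rule L2_per_bounded[where B=1]) (auto simp: wave_periodic)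

lemma torus_integral_eq_lborel:
  fixes f :: "real^2 \<Rightarrow> 'a::euclidean_space"
  assumes "continuous_on UNIV f"
  shows "(\<integral>x. f x \<partial>torus) = (\<integral>x. indicator (cbox 0 (\<chi> i. 2 * pi)) x *\<^sub>R f x \<partial>lborel)"
proof -
  have [measurable]: "f \<in> borel_measurable borel" by (rule borel_measurable_continuous_onI[OF assms])
  show ?thesis unfolding torus_def
    by (subst integral_restrict_space, simp, rule integral_completion) measurable
qed

lemma integral_cis_period:
  "(\<integral>y. indicator {0..2 * pi} y *\<^sub>R cis (of_int n * y) \<partial>lborel) = (if n = 0 then 2 * pi else 0)"
proof (cases "n = 0")
  case False
  have "(\<integral>y. indicator {0..2 * pi} y *\<^sub>R cis (of_int n * y) \<partial>lborel) =
     cis (of_int n * (2 * pi)) / (\<i> * of_int n) - cis (of_int n * 0) / (\<i> * of_int n)"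
  proof (rule integral_FTC_atLeastAtMost)
    fix y
    show "((\<lambda>y. cis (of_int n * y) / (\<i> * of_int n)) has_vector_derivative cis (of_int n * y)) (at y within {0..2 * pi})"
      unfolding cis_conv_exp
      by (rule derivative_eq_intros has_vector_derivative_real_field refl | use False in \<open>simp add: field_simps\<close>)+
  qed (auto intro!: continuous_intros)
  moreover have "cis (of_int n * (2 * pi)) = 1"
    by (simp add: complex_eq_iff mult.commute[of _ "2 * pi"] cos_int_2pin sin_int_2pin)
  ultimately show ?thesis using False by simp
qed (simp add: zero_complex.code scaleR_conv_of_real)

lemma Basis_real2: "(Basis :: (real^2) set) = range (\<lambda>j. axis j 1)"
  by (auto simp: Basis_vec_def)

text \<open>Fubini: Lebesgue measure on the plane is the image of the product measure indexed by the
  basis vectors, and both the indicator of the cell and the exponential factor over the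
  coordinates.\<close>

lemma wave_integral: "(\<integral>x. wave k x \<partial>torus) = (if k = 0 then (2 * pi)\<^sup>2 else 0)"
proof -
  interpret P: product_sigma_finite "\<lambda>b::real^2. lborel :: real measure" ..
  have [measurable]: "wave k \<in> borel_measurable borel"
    by (intro borel_measurable_continuous_onI continuous_intros)
  have m1: "(\<lambda>f. \<Sum>b\<in>Basis. f b *\<^sub>R b) \<in> measurable (\<Pi>\<^sub>M b\<in>(Basis::(real^2) set). (lborel::real measure)) borel"
    by (intro borel_measurable_sum borel_measurable_scaleR borel_measurable_const)
       (simp add: measurable_component_singleton)
  have m2: "(\<lambda>x. indicator (cbox 0 (\<chi> i. 2 * pi)) x *\<^sub>R wave k x) \<in> borel_measurable borel"
    by (intro borel_measurable_scaleR borel_measurable_indicator) auto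
  have inj: "inj (\<lambda>j::2. axis j (1::real))" by (auto simp: inj_def axis_eq_axis)
  have "(\<integral>x. wave k x \<partial>torus) = (\<integral>x. indicator (cbox 0 (\<chi> i. 2 * pi)) x *\<^sub>R wave k x \<partial>lborel)"
    by (rule torus_integral_eq_lborel) (intro continuous_intros)
  also have "\<dots> = (\<integral>f. indicator (cbox 0 (\<chi> i. 2 * pi)) (\<Sum>b\<in>Basis. f b *\<^sub>R b) *\<^sub>R wave k (\<Sum>b\<in>Basis. f b *\<^sub>R b)
      \<partial>(\<Pi>\<^sub>M b\<in>(Basis::(real^2) set). (lborel::real measure)))"
    unfolding lborel_eq[where 'a="real^2"] by (rule integral_distr[OF m1 m2])
  \<comment> \<open>The factors are indexed by basis vectors b and not by coordinates j; the sum
    with \<open>if\<close> reads off the component of k that belongs to b.\<close>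
  also have "\<dots> = (\<integral>f. (\<Prod>b\<in>Basis. indicator {0..2 * pi} (f b) *\<^sub>R cis (of_int (\<Sum>j\<in>UNIV. if b = axis j 1 then k $ j else 0) * f b))
      \<partial>(\<Pi>\<^sub>M b\<in>(Basis::(real^2) set). (lborel::real measure)))"
  proof (rule Bochner_Integration.integral_cong[OF refl])
    fix f :: "real^2 \<Rightarrow> real"
    define x where "x = (\<Sum>b\<in>Basis. f b *\<^sub>R b)"
    have x: "x $ j = f (axis j 1)" for j
      unfolding x_def Basis_real2 using inj
      by (simp add: sum.reindex) (simp add: axis_def if_distrib[of "\<lambda>x. _ * x"] cong: if_cong)
    have "indicator (cbox 0 (\<chi> i. 2 * pi)) x *\<^sub>R wave k x =
        (\<Prod>j\<in>UNIV. indicator {0..2 * pi} (f (axis j 1)) *\<^sub>R cis (of_int (k $ j) * f (axis j 1)))"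
      unfolding wave_def
      by (auto simp: UNIV_2 x forall_2 indicator_def mem_box_cart cis_mult)
    also have "\<dots> = (\<Prod>b\<in>Basis. indicator {0..2 * pi} (f b) *\<^sub>R cis (of_int (\<Sum>j\<in>UNIV. if b = axis j 1 then k $ j else 0) * f b))"
      unfolding Basis_real2 using inj
      by (simp add: prod.reindex) (simp add: axis_eq_axis if_distrib[of of_int] cong: if_cong)
    finally show "indicator (cbox 0 (\<chi> i. 2 * pi)) (\<Sum>b\<in>Basis. f b *\<^sub>R b) *\<^sub>R wave k (\<Sum>b\<in>Basis. f b *\<^sub>R b) =
      (\<Prod>b\<in>Basis. indicator {0..2 * pi} (f b) *\<^sub>R cis (of_int (\<Sum>j\<in>UNIV. if b = axis j 1 then k $ j else 0) * f b))"
      by (simp add: x_def)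
  qed
  also have "\<dots> = (\<Prod>b\<in>(Basis::(real^2) set). \<integral>y. indicator {0..2 * pi} y *\<^sub>R
      cis (of_int (\<Sum>j\<in>UNIV. if b = axis j 1 then k $ j else 0) * y) \<partial>lborel)"
    by (rule P.product_integral_prod)
       (auto intro!: borel_integrable_compact[unfolded set_integrable_def] continuous_intros)
  also have "\<dots> = (\<Prod>j\<in>UNIV. \<integral>y. indicator {0..2 * pi} y *\<^sub>R cis (of_int (k $ j) * y) \<partial>lborel)"
    unfolding Basis_real2 using inj
    by (simp add: prod.reindex) (simp add: axis_eq_axis if_distrib[of of_int] cong: if_cong)
  also have "\<dots> = (if k = 0 then (2 * pi)\<^sup>2 else 0)"
    unfolding integral_cis_period by (auto simp: UNIV_2 vec_eq_iff forall_2 power2_eq_square)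
  finally show ?thesis .
qed

subsection \<open>Trigonometric polynomials with their partial derivatives\<close>

text \<open>A trigonometric polynomial is carried together with its formal partial derivatives. The
  derivatives of a product then come out by rule, and all the calculus that is needed reduces to
  each formal derivative having integral zero.\<close>

inductive trig :: "(real^2 \<Rightarrow> complex) \<Rightarrow> (2 \<Rightarrow> real^2 \<Rightarrow> complex) \<Rightarrow> bool" where
  trig_wave: "trig (\<lambda>x. c * wave k x) (\<lambda>j x. c * (\<i> * of_int (k $ j)) * wave k x)"
| trig_add: "trig p dp \<Longrightarrow> trig q dq \<Longrightarrow> trig (\<lambda>x. p x + q x) (\<lambda>j x. dp j x + dq j x)"

lemma trig_mult:
  assumes "trig p dp" "trig q dq"
  shows "trig (\<lambda>x. p x * q x) (\<lambda>j x. dp j x * q x + p x * dq j x)"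
  using assms
proof (induction p dp rule: trig.induct)
  case (trig_wave c k)
  from trig_wave show ?case
  proof (induction q dq rule: trig.induct)
    case (trig_wave d l)
    show ?case using trig.trig_wave[of "c * d" "k + l"] by (simp add: wave_add algebra_simps)
  next
    case (trig_add p dp q dq)
    show ?case using trig.trig_add[OF trig_add.IH] by (simp add: algebra_simps)
  qed
next
  case (trig_add p dp q' dq')
  show ?case using trig.trig_add[OF trig_add.IH[OF trig_add.prems]] by (simp add: algebra_simps)
qed

lemma trig_const: "trig (\<lambda>x. c) (\<lambda>j x. 0)"
  using trig_wave[of c 0] by simp

lemma trig_cmult: "trig p dp \<Longrightarrow> trig (\<lambda>x. c * p x) (\<lambda>j x. c * dp j x)"
  using trig_mult[OF trig_const[of c]] by simp

lemma trig_finite_sum: "(\<And>i. i \<in> I \<Longrightarrow> trig (p i) (dp i)) \<Longrightarrow> trig (\<lambda>x. \<Sum>i\<in>I. p i x) (\<lambda>j x. \<Sum>i\<in>I. dp i j x)"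
  by (induction I rule: infinite_finite_induct) (auto intro: trig_const trig_add)

lemma trig_trig_sum:
  "trig (trig_sum S a) (\<lambda>j. trig_sum S (\<lambda>k. \<i> * of_int (k $ j) * a k))"
proof -
  have "trig (\<lambda>x. \<Sum>k\<in>S. (a k / (2 * pi)) * wave k x) (\<lambda>j x. \<Sum>k\<in>S. (a k / (2 * pi)) * (\<i> * of_int (k $ j)) * wave k x)"
    by (intro trig_finite_sum trig_wave)
  then show ?thesis by (simp add: trig_sum_def[abs_def] algebra_simps)
qed

lemma trig_L2_per: "trig p dp \<Longrightarrow> p \<in> L2_per \<and> dp j \<in> L2_per"
  by (induction rule: trig.induct) (auto intro!: L2_per_add L2_per_mult_left wave_L2_per)

text \<open>For k = 0 the factor \<open>k $ j\<close> vanishes; for every other k the exponential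
  integrates to zero.\<close>

lemma trig_integral_partial: "trig p dp \<Longrightarrow> (\<integral>x. dp j x \<partial>torus) = 0"
proof (induction rule: trig.induct)
  case (trig_wave c k)
  then show ?case by (auto simp: wave_integral)
next
  case (trig_add p dp q dq)
  then show ?case using trig_L2_per by (subst Bochner_Integration.integral_add) (auto intro: L2_per_integrable)
qed

subsection \<open>Completeness of the trigonometric system\<close>

lemma L2_per_integrable_mult:
  fixes f g :: "real^2 \<Rightarrow> complex"
  assumes f: "f \<in> L2_per" and g: "g \<in> L2_per"
  shows "integrable torus (\<lambda>x. f x * g x)"
proof (rule Bochner_Integration.integrable_bound[OF L2_per_integrable_norm_mult[OF f g]])
  note [measurable] = L2_per_measurable[OF f] L2_per_measurable[OF g]
  show "(\<lambda>x. f x * g x) \<in> borel_measurable torus" by measurable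
qed (simp add: norm_mult)

lemma measurable_indicator_scaleR:
  fixes f :: "real^2 \<Rightarrow> 'a::euclidean_space"
  assumes "f \<in> borel_measurable torus" "A \<in> sets lebesgue"
  shows "(\<lambda>x. indicator A x *\<^sub>R f x) \<in> borel_measurable torus"
proof -
  have "(indicator A :: _ \<Rightarrow> real) \<in> borel_measurable torus"
    unfolding torus_def using assms(2) by (intro measurable_restrict_space1 borel_measurable_indicator)
  then show ?thesis using assms(1) by (intro borel_measurable_scaleR)
qed

text \<open>Maps the torus to a product of two unit circles, a compact subset of a real vector
  space, where continuous functions can be approximated by real polynomials.\<close>

definition circles :: "real^2 \<Rightarrow> complex \<times> complex" where
  "circles x = (cis (x $ 1), cis (x $ 2))"

lemma trig_cos_sin:
  "\<exists>dp. trig (\<lambda>x. complex_of_real (cos (x $ j))) dp" "\<exists>dp. trig (\<lambda>x. complex_of_real (sin (x $ j))) dp"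
proof -
  define e :: "int^2" where "e = axis j 1"
  have "(\<Sum>i\<in>UNIV. of_int (e $ i) * x $ i) = x $ j" for x :: "real^2"
    by (simp add: e_def axis_def if_distrib[of "\<lambda>x. x * _"] if_distrib[of of_int] cong: if_cong)
  then have w: "wave e x = cis (x $ j)" for x by (simp add: wave_def)
  have "complex_of_real (cos (x $ j)) = 1/2 * wave e x + 1/2 * wave (-e) x" for x
    by (simp add: w wave_uminus complex_eq_iff)
  then show "\<exists>dp. trig (\<lambda>x. complex_of_real (cos (x $ j))) dp"
    using trig_add[OF trig_wave[of "1/2" e] trig_wave[of "1/2" "-e"]] by (auto simp flip: cos_of_real)
  have "complex_of_real (sin (x $ j)) = -\<i>/2 * wave e x + \<i>/2 * wave (-e) x" for x
    by (simp add: w wave_uminus complex_eq_iff)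
  then show "\<exists>dp. trig (\<lambda>x. complex_of_real (sin (x $ j))) dp"
    using trig_add[OF trig_wave[of "-\<i>/2" e] trig_wave[of "\<i>/2" "-e"]] by (auto simp flip: sin_of_real)
qed

text \<open>Only linear functions need work: a real-linear functional on pairs of complex numbers is
  determined by its values on (1, 0), (\<i>, 0), (0, 1), (0, \<i>), and the corresponding real
  coordinates of a point are cosines and sines. Sums and products are closure rules of
  \<open>trig\<close>.\<close>

lemma trig_polynomial: "real_polynomial_function q \<Longrightarrow> \<exists>dp. trig (\<lambda>x. complex_of_real (q (circles x))) dp"
proof (induction rule: real_polynomial_function.induct)
  case (linear l)
  have *: "complex_of_real (l (circles x)) =
      complex_of_real (l (1, 0)) * complex_of_real (cos (x $ 1)) + complex_of_real (l (\<i>, 0)) * complex_of_real (sin (x $ 1))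
      + (complex_of_real (l (0, 1)) * complex_of_real (cos (x $ 2)) + complex_of_real (l (0, \<i>)) * complex_of_real (sin (x $ 2)))" for x
  proof -
    interpret bounded_linear l by fact
    have "circles x = cos (x $ 1) *\<^sub>R (1, 0) + sin (x $ 1) *\<^sub>R (\<i>, 0) + (cos (x $ 2) *\<^sub>R (0, 1) + sin (x $ 2) *\<^sub>R (0, \<i>))"
      by (simp add: circles_def complex_eq_iff)
    then have "l (circles x) = cos (x $ 1) * l (1, 0) + sin (x $ 1) * l (\<i>, 0) + (cos (x $ 2) * l (0, 1) + sin (x $ 2) * l (0, \<i>))"
      by (simp only: add scaleR real_scaleR_def)
    then show ?thesis by (simp add: mult.commute)
  qed
  obtain c s where cs: "\<And>j. trig (\<lambda>x. complex_of_real (cos (x $ j))) (c j)"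
    "\<And>j. trig (\<lambda>x. complex_of_real (sin (x $ j))) (s j)"
    using trig_cos_sin by metis
  show ?case unfolding *
    by (rule exI, rule trig_add[OF trig_add[OF trig_cmult[OF cs(1)] trig_cmult[OF cs(2)]]
          trig_add[OF trig_cmult[OF cs(1)] trig_cmult[OF cs(2)]]])
next
  case (const c)
  then show ?case using trig_const by auto
next
  case (add f g)
  then show ?case using trig_add by (simp, blast)
next
  case (mult f g)
  then show ?case using trig_mult by (simp, blast)
qed

lemma circles_measurable: "continuous_on S F \<Longrightarrow> range circles \<subseteq> S \<Longrightarrow> (\<lambda>x. F (circles x)) \<in> borel_measurable torus"
  for F :: "complex \<times> complex \<Rightarrow> 'b::real_normed_vector"
proof (rule measurable_torus_continuous, rule continuous_on_compose2[of S F])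
  show "continuous_on UNIV circles" unfolding circles_def[abs_def] by (intro continuous_intros)
qed auto

text \<open>The indicator of a box inside the period cell is the monotone limit of the continuous
  functions \<open>min 1 (n * max 0 (cos (x - m) - cos r))\<close> of \<open>cos x\<close> and \<open>sin x\<close>, where \<open>m\<close> is the
  midpoint and \<open>r\<close> half the length of a side.\<close>

lemma cos_gt_cos_iff:
  fixes a b y :: real
  assumes "0 \<le> a" "a < b" "b \<le> 2 * pi" "0 \<le> y" "y \<le> 2 * pi"
  shows "cos (y - (a + b) / 2) > cos ((b - a) / 2) \<longleftrightarrow> a < y \<and> y < b"
proof -
  define d r where "d = \<bar>y - (a + b) / 2\<bar>" and "r = (b - a) / 2"
  have r: "0 < r" "r \<le> pi" and d: "0 \<le> d" "d \<le> 2 * pi - r"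
    using assms by (auto simp: d_def r_def abs_if field_simps)
  have cd: "cos (y - (a + b) / 2) = cos d" by (simp add: d_def)
  have iff: "a < y \<and> y < b \<longleftrightarrow> d < r" using assms by (auto simp: d_def r_def abs_if field_simps)
  have "cos r < cos d \<longleftrightarrow> d < r"
  proof (cases "d \<le> pi")
    case True
    then show ?thesis using r d by (subst cos_mono_less_eq) auto
  next
    case False
    \<comment> \<open>Beyond \<pi> the cosine increases again. The reflected angle 2 \<pi> - d is
      still at least r because the interval lies inside one period.\<close>
    have "cos d = cos (2 * pi - d)" by simp
    also have "\<dots> \<le> cos r" using r d False by (subst cos_mono_le_eq) auto
    finally show ?thesis using False r by auto
  qed
  then show ?thesis using cd iff by (simp add: r_def)
qed

definition bump :: "real \<Rightarrow> real \<Rightarrow> nat \<Rightarrow> complex \<Rightarrow> real" where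
  "bump a b n z = min 1 (real n * max 0 (Re z * cos ((a + b) / 2) + Im z * sin ((a + b) / 2) - cos ((b - a) / 2)))"

lemma bump_bounds: "0 \<le> bump a b n z" "bump a b n z \<le> 1"
  by (auto simp: bump_def)

lemma bump_tendsto:
  assumes "0 \<le> a" "a < b" "b \<le> 2 * pi" "0 \<le> y" "y \<le> 2 * pi"
  shows "(\<lambda>n. bump a b n (cis y)) \<longlonglongrightarrow> indicator {a<..<b} y"
proof -
  define c where "c = cos (y - (a + b) / 2) - cos ((b - a) / 2)"
  have b: "bump a b n (cis y) = min 1 (real n * max 0 c)" for n
    by (simp add: bump_def c_def cos_diff)
  show ?thesis
  proof (cases "c > 0")
    case True
    then obtain N where N: "1 < real N * c" using reals_Archimedean3 by blast
    have "eventually (\<lambda>n. bump a b n (cis y) = 1) sequentially"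
      unfolding eventually_sequentially
    proof (intro exI allI impI)
      fix n assume "N \<le> n"
      then have "real N * c \<le> real n * c" using True by (intro mult_right_mono) auto
      with N have "1 \<le> real n * c" by linarith
      then show "bump a b n (cis y) = 1" using True by (simp add: b min_def)
    qed
    moreover have "a < y \<and> y < b" using True cos_gt_cos_iff[OF assms] by (simp add: c_def)
    ultimately show ?thesis by (auto intro: tendsto_eventually)
  next
    case False
    then have "\<not> (a < y \<and> y < b)" using cos_gt_cos_iff[OF assms] by (simp add: c_def)
    moreover have "bump a b n (cis y) = 0" for n using False by (simp add: b max_def)
    ultimately show ?thesis by (auto simp: indicator_def)
  qed
qed

text \<open>The boundary of the cell is null. This allows an arbitrary open box to be replaced by
  its part inside the cell.\<close>

lemma AE_torus_interior: "AE x in torus. x \<in> box 0 (\<chi> i. 2 * pi)"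
proof -
  have "negligible (cbox 0 (\<chi> i. 2 * pi) - box 0 (\<chi> i. 2 * pi) :: (real^2) set)"
    by (rule negligible_frontier_interval)
  from AE_not_in[OF this[unfolded negligible_iff_null_sets]]
  have "AE x::real^2 in lebesgue. x \<in> cbox 0 (\<chi> i. 2 * pi) \<longrightarrow> x \<in> box 0 (\<chi> i. 2 * pi)"
    by eventually_elim auto
  then show ?thesis unfolding torus_def by (subst AE_restrict_space_iff) auto
qed

context
  fixes f :: "real^2 \<Rightarrow> complex"
  assumes f: "f \<in> L2_per" and orth: "\<And>k. (\<integral>x. f x * wave k x \<partial>torus) = 0"
begin

text \<open>Begins the proof that a function orthogonal to all exponentials vanishes: orthogonality
  is extended to trigonometric polynomials, to continuous functions, to boxes and finally to all
  measurable sets.\<close>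

lemma orth_trig: "trig p dp \<Longrightarrow> (\<integral>x. f x * p x \<partial>torus) = 0"
proof (induction rule: trig.induct)
  case (trig_wave c k)
  have "(\<integral>x. f x * (c * wave k x) \<partial>torus) = (\<integral>x. c * (f x * wave k x) \<partial>torus)"
    by (simp add: algebra_simps)
  then show ?case using orth by simp
next
  case (trig_add p dp q dq)
  have "(\<integral>x. f x * (p x + q x) \<partial>torus) = (\<integral>x. f x * p x + f x * q x \<partial>torus)"
    by (simp add: algebra_simps)
  also have "\<dots> = 0"
    using trig_add trig_L2_per by (subst Bochner_Integration.integral_add) (auto intro!: L2_per_integrable_mult f)
  finally show ?case .
qed

text \<open>Stone-Weierstrass approximates F uniformly on the product of circles by polynomials,
  which become trigonometric polynomials on the torus. Integrability of f turns a uniform error e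
  into e times the L^1 norm of f.\<close>

lemma orth_continuous:
  fixes F :: "complex \<times> complex \<Rightarrow> real"
  assumes F: "continuous_on (sphere 0 1 \<times> sphere 0 1) F"
  shows "(\<integral>x. f x * F (circles x) \<partial>torus) = 0"
proof -
  let ?S = "sphere (0::complex) 1 \<times> sphere (0::complex) 1"
  have cS: "circles x \<in> ?S" for x by (auto simp: circles_def)
  have cpt: "compact ?S" by (intro compact_Times) auto
  have intf: "integrable torus f" by (rule L2_per_integrable[OF f])
  have [measurable]: "(\<lambda>x. F (circles x)) \<in> borel_measurable torus"
    using F by (intro circles_measurable) (auto simp: circles_def)
  note [measurable] = L2_per_measurable[OF f]
  obtain B where B: "\<And>z. z \<in> ?S \<Longrightarrow> \<bar>F z\<bar> \<le> B"
    using compact_imp_bounded[OF compact_continuous_image[OF F cpt]] by (auto simp: bounded_iff)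
  have intF: "integrable torus (\<lambda>x. f x * F (circles x))"
  proof (rule Bochner_Integration.integrable_bound)
    show "integrable torus (\<lambda>x. B * norm (f x))" using intf by simp
    show "AE x in torus. norm (f x * F (circles x)) \<le> norm (B * norm (f x))"
    proof (intro AE_I2)
      fix x
      have "norm (f x) * \<bar>F (circles x)\<bar> \<le> norm (f x) * B" by (intro mult_left_mono B cS) auto
      moreover have "0 \<le> B" using B[OF cS, of x] by linarith
      ultimately show "norm (f x * F (circles x)) \<le> norm (B * norm (f x))"
        by (simp add: norm_mult mult.commute)
    qed
  qed measurable
  have bd: "norm (\<integral>x. f x * F (circles x) \<partial>torus) \<le> e * (\<integral>x. norm (f x) \<partial>torus)" if "e > 0" for e
  proof -
    obtain q where q: "real_polynomial_function q" "\<And>z. z \<in> ?S \<Longrightarrow> \<bar>F z - q z\<bar> < e"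
      using Stone_Weierstrass_real_polynomial_function[OF cpt F \<open>e > 0\<close>] by blast
    obtain dp where t: "trig (\<lambda>x. complex_of_real (q (circles x))) dp"
      using trig_polynomial[OF q(1)] by auto
    have intq: "integrable torus (\<lambda>x. f x * q (circles x))"
      using L2_per_integrable_mult[OF f] trig_L2_per[OF t] by blast
    have "(\<integral>x. f x * F (circles x) \<partial>torus) = (\<integral>x. f x * F (circles x) - f x * q (circles x) \<partial>torus)"
      using intF intq orth_trig[OF t] by simp
    also have "norm \<dots> \<le> (\<integral>x. e * norm (f x) \<partial>torus)"
    proof (rule order_trans[OF Bochner_Integration.integral_norm_bound integral_mono])
      fix x
      have "norm (f x * F (circles x) - f x * q (circles x)) = norm (f x) * \<bar>F (circles x) - q (circles x)\<bar>"
        by (simp add: norm_mult right_diff_distrib[symmetric] flip: of_real_diff)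
      also have "\<dots> \<le> norm (f x) * e" using q(2)[OF cS] by (intro mult_left_mono) (auto intro: less_imp_le)
      finally show "norm (f x * F (circles x) - f x * q (circles x)) \<le> e * norm (f x)" by (simp add: mult.commute)
    qed (use intF intq intf in auto)
    finally show ?thesis by simp
  qed
  then have "norm (\<integral>x. f x * F (circles x) \<partial>torus) \<le> 0 + e" if "e > 0" for e
  proof -
    define I where "I = (\<integral>x. norm (f x) \<partial>torus)"
    have I: "0 \<le> I" by (simp add: I_def integral_nonneg_AE)
    have "norm (\<integral>x. f x * F (circles x) \<partial>torus) \<le> e / (I + 1) * I"
      unfolding I_def using I[unfolded I_def] by (intro bd divide_pos_pos \<open>e > 0\<close> add_nonneg_pos) auto
    also have "\<dots> \<le> e" using I \<open>e > 0\<close> by (simp add: field_simps)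
    finally show ?thesis by simp
  qed
  then have "norm (\<integral>x. f x * F (circles x) \<partial>torus) \<le> 0" by (rule field_le_epsilon)
  then show ?thesis by simp
qed

lemma orth_box_inside:
  assumes "0 \<le> a $ 1" "a $ 1 < b $ 1" "b $ 1 \<le> 2 * pi" "0 \<le> a $ 2" "a $ 2 < b $ 2" "b $ 2 \<le> 2 * pi"
  shows "(\<integral>x. indicator (box a b) x *\<^sub>R f x \<partial>torus) = 0"
proof -
  define F where "F = (\<lambda>n z. bump (a $ 1) (b $ 1) n (fst z) * bump (a $ 2) (b $ 2) n (snd z))"
  have contF: "continuous_on S (F n)" for n S
    unfolding F_def bump_def by (intro continuous_intros)
  have m: "(\<lambda>x. F n (circles x)) \<in> borel_measurable torus" for n
    by (rule circles_measurable[OF contF[of UNIV]]) simp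
  note [measurable] = this L2_per_measurable[OF f]
  have "(\<lambda>n. \<integral>x. f x * F n (circles x) \<partial>torus) \<longlonglongrightarrow> (\<integral>x. indicator (box a b) x *\<^sub>R f x \<partial>torus)"
  proof (rule integral_dominated_convergence[where w="\<lambda>x. norm (f x)"])
    show "(\<lambda>x. indicator (box a b) x *\<^sub>R f x) \<in> borel_measurable torus"
      by (intro measurable_indicator_scaleR L2_per_measurable[OF f]) simp
    show "AE x in torus. (\<lambda>n. f x * F n (circles x)) \<longlonglongrightarrow> indicator (box a b) x *\<^sub>R f x"
    proof (intro AE_I2)
      fix x assume "x \<in> space torus"
      then have x: "0 \<le> x $ 1" "x $ 1 \<le> 2 * pi" "0 \<le> x $ 2" "x $ 2 \<le> 2 * pi"
        by (auto simp: mem_box_cart)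
      have ind: "indicator {a $ 1<..<b $ 1} (x $ 1) * indicator {a $ 2<..<b $ 2} (x $ 2) = (indicator (box a b) x :: real)"
        by (auto simp: indicator_def mem_box_cart forall_2)
      have "(\<lambda>n. F n (circles x)) \<longlonglongrightarrow> indicator (box a b) x"
        unfolding F_def circles_def fst_conv snd_conv ind[symmetric]
        by (intro tendsto_mult bump_tendsto assms x)
      from tendsto_mult[OF tendsto_const[of "f x"] tendsto_of_real[OF this]]
      show "(\<lambda>n. f x * F n (circles x)) \<longlonglongrightarrow> indicator (box a b) x *\<^sub>R f x"
        by (simp add: scaleR_conv_of_real mult.commute)
    qed
    show "AE x in torus. norm (f x * F n (circles x)) \<le> norm (f x)" for n
      using bump_bounds unfolding F_def
      by (intro AE_I2) (auto simp: norm_mult abs_mult intro!: mult_left_le mult_le_one)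
  qed (auto intro!: integrable_norm[OF L2_per_integrable] f)
  moreover have "(\<integral>x. f x * F n (circles x) \<partial>torus) = 0" for n
    by (rule orth_continuous[OF contF])
  ultimately show ?thesis by (simp add: LIMSEQ_const_iff)
qed

lemma orth_box: "(\<integral>x. indicator (box a b) x *\<^sub>R f x \<partial>torus) = 0"
proof -
  define a' b' :: "real^2" where "a' = (\<chi> j. max 0 (a $ j))" and "b' = (\<chi> j. min (2 * pi) (b $ j))"
  have ae: "AE x in torus. indicator (box a b) x *\<^sub>R f x = indicator (box a' b') x *\<^sub>R f x"
    using AE_torus_interior
    by eventually_elim (auto simp: indicator_def mem_box_cart a'_def b'_def)
  have m: "(\<lambda>x. indicator (box a b) x *\<^sub>R f x) \<in> borel_measurable torus" for a b
      by (intro measurable_indicator_scaleR L2_per_measurable[OF f]) simp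
  have "(\<integral>x. indicator (box a b) x *\<^sub>R f x \<partial>torus) = (\<integral>x. indicator (box a' b') x *\<^sub>R f x \<partial>torus)"
    by (rule integral_cong_AE[OF m m ae])
  also have "\<dots> = 0"
  proof (cases "\<forall>j. a' $ j < b' $ j")
    case True
    then show ?thesis by (intro orth_box_inside) (auto simp: a'_def b'_def)
  next
    case False
    then have "box a' b' = {}" by (auto simp: interval_eq_empty_cart not_less)
    then show ?thesis by simp
  qed
  finally show ?thesis .
qed

text \<open>Open boxes form an intersection-stable generator, and the sets over which f integrates
  to zero form a Dynkin system. For complements the integral of f itself has to vanish, which is
  orthogonality to the exponential with k = 0.\<close>

lemma orth_borel:
  assumes "A \<in> sets borel"
  shows "(\<integral>x. indicator A x *\<^sub>R f x \<partial>torus) = 0"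
proof -
  have m: "integrable torus (\<lambda>x. indicator A x *\<^sub>R f x)" if "A \<in> sets borel" for A
  proof (rule Bochner_Integration.integrable_bound[OF integrable_norm[OF L2_per_integrable[OF f]]])
    show "(\<lambda>x. indicator A x *\<^sub>R f x) \<in> borel_measurable torus"
      using that by (intro measurable_indicator_scaleR L2_per_measurable[OF f]) simp
  qed (auto simp: indicator_def)
  have sb: "sets borel = sigma_sets UNIV (range (\<lambda>(a, b). box a b :: (real^2) set))"
    by (subst borel_eq_box) simp
  have "Int_stable (range (\<lambda>(a, b). box a b :: (real^2) set))"
    by (auto simp: Int_stable_def box_Int_box)
  moreover have "range (\<lambda>(a, b). box a b :: (real^2) set) \<subseteq> Pow UNIV" by simp
  moreover have "A \<in> sigma_sets UNIV (range (\<lambda>(a, b). box a b :: (real^2) set))" using assms sb by simp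
  ultimately show ?thesis
  proof (induction rule: sigma_sets_induct_disjoint)
    case (basic A)
    then show ?case using orth_box by auto
  next
    case (compl A)
    then have A: "A \<in> sets borel" using sb by blast
    have "(\<integral>x. indicator (UNIV - A) x *\<^sub>R f x \<partial>torus) = (\<integral>x. f x - indicator A x *\<^sub>R f x \<partial>torus)"
      by (intro Bochner_Integration.integral_cong) (auto simp: indicator_def)
    also have "\<dots> = 0"
      using m[OF A] compl L2_per_integrable[OF f] orth[of 0] by simp
    finally show ?case .
  next
    case (union A)
    then have A: "A i \<in> sets borel" for i using sb by blast
    have "(\<integral>x. indicator (\<Union>i. A i) x *\<^sub>R f x \<partial>torus) = (\<Sum>i. \<integral>x. indicator (A i) x *\<^sub>R f x \<partial>torus)"
    proof -
      have "(\<lambda>n. \<integral>x. indicator (\<Union>i<n. A i) x *\<^sub>R f x \<partial>torus) \<longlonglongrightarrow> (\<integral>x. indicator (\<Union>i. A i) x *\<^sub>R f x \<partial>torus)"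
      proof (rule integral_dominated_convergence[where w="\<lambda>x. norm (f x)"])
        show "AE x in torus. (\<lambda>n. indicator (\<Union>i<n. A i) x *\<^sub>R f x) \<longlonglongrightarrow> indicator (\<Union>i. A i) x *\<^sub>R f x"
          by (intro AE_I2 tendsto_scaleR tendsto_const LIMSEQ_indicator_UN)
        show "integrable torus (\<lambda>x. norm (f x))" by (rule integrable_norm[OF L2_per_integrable[OF f]])
        show "(\<lambda>x. indicator (\<Union>i. A i) x *\<^sub>R f x) \<in> borel_measurable torus"
          using A by (intro borel_measurable_integrable m) auto
        show "(\<lambda>x. indicator (\<Union>i<n. A i) x *\<^sub>R f x) \<in> borel_measurable torus" for n
          using A by (intro borel_measurable_integrable m) auto
      qed (simp add: indicator_def)
      moreover have "(\<integral>x. indicator (\<Union>i<n. A i) x *\<^sub>R f x \<partial>torus) = 0" for n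
      proof -
        have "(\<integral>x. indicator (\<Union>i<n. A i) x *\<^sub>R f x \<partial>torus) = (\<integral>x. (\<Sum>i<n. indicator (A i) x *\<^sub>R f x) \<partial>torus)"
          using union(1)
          by (intro Bochner_Integration.integral_cong refl)
             (simp add: indicator_UN_disjoint disjoint_family_on_def scaleR_sum_left)
        also have "\<dots> = (\<Sum>i<n. \<integral>x. indicator (A i) x *\<^sub>R f x \<partial>torus)"
          by (rule Bochner_Integration.integral_sum) (rule m[OF A])
        finally show ?thesis using union by simp
      qed
      ultimately have "(\<integral>x. indicator (\<Union>i. A i) x *\<^sub>R f x \<partial>torus) = 0"
        by (simp add: LIMSEQ_const_iff)
      then show ?thesis using union by simp
    qed
    then show ?case using union by simp
  qed auto
qed

text \<open>A Lebesgue measurable set differs from its Borel main part by a null set, so f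
  integrates to zero over every measurable set and is therefore zero as a density.\<close>

lemma orth_imp_zero: "AE x in torus. f x = 0"
proof (rule torus.density_zero[OF L2_per_integrable[OF f]])
  fix A assume "A \<in> sets torus"
  then have "A \<in> sets lebesgue" by (auto simp: torus_def sets_restrict_space)
  define B where "B = main_part lborel A"
  have B: "B \<in> sets borel" using main_part_sets[OF \<open>A \<in> sets lebesgue\<close>] by (simp add: B_def)
  have ae: "AE x in lebesgue. x \<in> A \<longleftrightarrow> x \<in> B"
    using AE_in_main_part[OF \<open>A \<in> sets lebesgue\<close>] unfolding B_def by (intro AE_completion) auto
  have "AE x in torus. indicator A x *\<^sub>R f x = indicator B x *\<^sub>R f x"
    unfolding torus_def by (subst AE_restrict_space_iff) (use ae in \<open>auto simp: indicator_def\<close>)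
  moreover have "(\<lambda>x. indicator A x *\<^sub>R f x) \<in> borel_measurable torus" if "A \<in> sets lebesgue" for A
    by (intro measurable_indicator_scaleR L2_per_measurable[OF f] that)
  ultimately have "(\<integral>x. indicator A x *\<^sub>R f x \<partial>torus) = (\<integral>x. indicator B x *\<^sub>R f x \<partial>torus)"
    using \<open>A \<in> sets lebesgue\<close> B by (intro integral_cong_AE) auto
  then show "set_lebesgue_integral torus A f = 0"
    using orth_borel[OF B] by (simp add: set_lebesgue_integral_def)
qed

end


section \<open>Fourier coefficients, Bessel's inequality and Parseval's identity\<close>

lemma inner_complex_Re: "z \<bullet> w = Re (z * cnj w)" for z w :: complex
  by (simp add: inner_complex_def)

lemma fourier_integrable: "f \<in> L2_per \<Longrightarrow> integrable torus (\<lambda>x. f x * cnj (wave k x))"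
  using L2_per_integrable_mult[OF _ wave_L2_per[of "-k"], of f] by (simp add: wave_uminus)

lemma fourier_zero_imp:
  assumes "f \<in> L2_per" "\<And>k. fourier f k = 0"
  shows "AE x in torus. f x = 0"
proof (rule orth_imp_zero[OF assms(1)])
  fix k show "(\<integral>x. f x * wave k x \<partial>torus) = 0"
    using assms(2)[of "-k"] by (simp add: fourier_def wave_uminus)
qed

lemma fourier_diff: "f \<in> L2_per \<Longrightarrow> g \<in> L2_per \<Longrightarrow> fourier (\<lambda>x. f x - g x) k = fourier f k - fourier g k"
  by (simp add: fourier_def left_diff_distrib fourier_integrable diff_divide_distrib)

lemma fourier_add: "f \<in> L2_per \<Longrightarrow> g \<in> L2_per \<Longrightarrow> fourier (\<lambda>x. f x + g x) k = fourier f k + fourier g k"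
  by (simp add: fourier_def distrib_right fourier_integrable add_divide_distrib)

lemma fourier_cmult: "fourier (\<lambda>x. c * f x) k = c * fourier f k"
  by (simp add: fourier_def mult.assoc)

lemma fourier_uminus: "fourier (\<lambda>x. - f x) k = - fourier f k"
  by (simp add: fourier_def)

lemma fourier_sum: "(\<And>i. i \<in> I \<Longrightarrow> f i \<in> L2_per) \<Longrightarrow> fourier (\<lambda>x. \<Sum>i\<in>I. f i x) k = (\<Sum>i\<in>I. fourier (f i) k)"
  by (simp add: fourier_def sum_distrib_right fourier_integrable sum_divide_distrib)

lemma fourier_cong_AE:
  assumes "f \<in> L2_per" "g \<in> L2_per" "AE x in torus. f x = g x"
  shows "fourier f k = fourier g k"
proof -
  have "(\<integral>x. f x * cnj (wave k x) \<partial>torus) = (\<integral>x. g x * cnj (wave k x) \<partial>torus)"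
    by (rule integral_cong_AE) (use assms in \<open>auto intro: borel_measurable_integrable fourier_integrable\<close>)
  then show ?thesis by (simp add: fourier_def)
qed

lemma fourier_wave: "fourier (wave l) k = (if k = l then 2 * pi else 0)"
  by (simp add: fourier_def wave_diff[symmetric] wave_integral power2_eq_square)

lemma norm_fourier_le:
  assumes f: "f \<in> L2_per"
  shows "norm (fourier f k) \<le> L2_norm f"
proof -
  have "norm (\<integral>x. f x * cnj (wave k x) \<partial>torus) \<le> (\<integral>x. norm (f x * cnj (wave k x)) \<partial>torus)"
    by (rule Bochner_Integration.integral_norm_bound)
  also have "\<dots> \<le> 2 * pi * L2_norm f" using L2_norm_integral_bound[OF f] by (simp add: norm_mult)
  finally show ?thesis by (simp add: fourier_def norm_divide field_simps)
qed

lemma fourier_tendsto: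
  assumes "\<And>n. f n \<in> L2_per" "g \<in> L2_per" "(\<lambda>n. L2_norm (\<lambda>x. f n x - g x)) \<longlonglongrightarrow> 0"
  shows "(\<lambda>n. fourier (f n) k) \<longlonglongrightarrow> fourier g k"
proof (rule Lim_transform_bound[THEN LIM_zero_cancel, OF always_eventually assms(3)], rule allI)
  fix n
  show "norm (fourier (f n) k - fourier g k) \<le> norm (L2_norm (\<lambda>x. f n x - g x))"
    using norm_fourier_le[OF L2_per_diff[OF assms(1)[of n] assms(2)]] assms
    by (simp add: fourier_diff L2_norm_ge0)
qed

lemma trig_sum_L2_per: "trig_sum S a \<in> L2_per"
  using trig_L2_per[OF trig_trig_sum] by blast

lemma fourier_trig_sum: "finite S \<Longrightarrow> fourier (trig_sum S a) k = (if k \<in> S then a k else 0)"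
proof -
  assume S: "finite S"
  define b where "b = (\<lambda>l. a l / (2 * pi))"
  have eq: "trig_sum S a = (\<lambda>x. \<Sum>l\<in>S. b l * wave l x)"
    by (simp add: trig_sum_def fun_eq_iff b_def)
  have "fourier (trig_sum S a) k = (\<Sum>l\<in>S. b l * fourier (wave l) k)"
    unfolding eq by (subst fourier_sum) (auto intro!: L2_per_mult_left wave_L2_per simp: fourier_cmult)
  also have "\<dots> = (\<Sum>l\<in>S. if k = l then a l else 0)"
    by (intro sum.cong) (auto simp: fourier_wave b_def)
  finally show ?thesis using S by simp
qed

lemma L2_inner_trig_sum:
  assumes g: "g \<in> L2_per"
  shows "L2_inner (trig_sum S a) g = (\<Sum>k\<in>S. Re (a k * cnj (fourier g k)))"
proof -
  have i: "integrable torus (\<lambda>x. wave k x * cnj (g x))" for k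
    by (rule L2_per_integrable_mult[OF wave_L2_per L2_per_cnj[OF g]])
  have c: "(\<integral>x. wave k x * cnj (g x) \<partial>torus) = 2 * pi * cnj (fourier g k)" for k
  proof -
    have "(\<integral>x. wave k x * cnj (g x) \<partial>torus) = (\<integral>x. cnj (g x * cnj (wave k x)) \<partial>torus)"
      by (simp add: mult.commute)
    also have "\<dots> = cnj (\<integral>x. g x * cnj (wave k x) \<partial>torus)" by (rule integral_bounded_linear[OF bounded_linear_cnj fourier_integrable[OF g]])
    finally show ?thesis by (simp add: fourier_def)
  qed
  define b where "b = (\<lambda>l. a l / (2 * pi))"
  have eq: "trig_sum S a = (\<lambda>x. \<Sum>l\<in>S. b l * wave l x)"
    by (simp add: trig_sum_def fun_eq_iff b_def)
  have "L2_inner (trig_sum S a) g = (\<integral>x. Re (\<Sum>k\<in>S. b k * (wave k x * cnj (g x))) \<partial>torus)"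
    unfolding L2_inner_def inner_complex_Re eq by (simp add: sum_distrib_right mult.assoc)
  also have "\<dots> = Re (\<integral>x. (\<Sum>k\<in>S. b k * (wave k x * cnj (g x))) \<partial>torus)"
    by (rule integral_Re) (auto intro!: i)
  also have "(\<integral>x. (\<Sum>k\<in>S. b k * (wave k x * cnj (g x))) \<partial>torus) = (\<Sum>k\<in>S. b k * (2 * pi * cnj (fourier g k)))"
    using i by (simp add: c)
  finally show ?thesis by (simp add: b_def)
qed

lemma L2_norm_trig_sum:
  assumes "finite S"
  shows "(L2_norm (trig_sum S a))\<^sup>2 = (\<Sum>k\<in>S. (norm (a k))\<^sup>2)"
  unfolding L2_norm_power2 L2_inner_trig_sum[OF trig_sum_L2_per]
  by (intro sum.cong) (simp_all add: fourier_trig_sum[OF assms] complex_mult_cnj cmod_power2)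

lemma Bessel:
  assumes f: "f \<in> L2_per" and S: "finite S"
  shows "(\<Sum>k\<in>S. (norm (fourier f k))\<^sup>2) \<le> (L2_norm f)\<^sup>2"
proof -
  let ?p = "trig_sum S (fourier f)"
  have p: "?p \<in> L2_per" by (rule trig_sum_L2_per)
  have 1: "L2_inner ?p f = (\<Sum>k\<in>S. (norm (fourier f k))\<^sup>2)"
    unfolding L2_inner_trig_sum[OF f] by (intro sum.cong) (simp_all add: complex_mult_cnj cmod_power2)
  have "0 \<le> L2_inner (\<lambda>x. f x - ?p x) (\<lambda>x. f x - ?p x)" by (rule L2_inner_ge0)
  also have "\<dots> = L2_inner f f - 2 * L2_inner ?p f + L2_inner ?p ?p"
    using f p L2_per_diff[OF f p]
    by (simp add: L2_inner_diff_left L2_inner_diff_right L2_inner_commute[of f ?p])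
  finally show ?thesis using L2_norm_trig_sum[OF S, of "fourier f"] 1 by (simp add: L2_norm_power2)
qed

abbreviation fpart :: "nat \<Rightarrow> (real^2 \<Rightarrow> complex) \<Rightarrow> real^2 \<Rightarrow> complex" where
  "fpart N f \<equiv> trig_sum (fbox N) (fourier f)"

lemma trig_sum_diff:
  assumes "finite T" "S \<subseteq> T"
  shows "trig_sum T a x - trig_sum S a x = trig_sum (T - S) a x"
  unfolding trig_sum_def using sum_diff[OF assms, of "\<lambda>k. a k * (wave k x / (2 * pi))"] by simp

text \<open>By Bessel's inequality the partial sums are a Cauchy sequence. Their limit has the same
  coefficients as f, so completeness of the trigonometric system identifies it with f almost
  everywhere.\<close>

lemma fpart_tendsto:
  assumes f: "f \<in> L2_per"
  shows "(\<lambda>N. L2_norm (\<lambda>x. fpart N f x - f x)) \<longlonglongrightarrow> 0"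
proof -
  define s where "s = (\<lambda>N. \<Sum>k\<in>fbox N. (norm (fourier f k))\<^sup>2)"
  have s_mono: "s M \<le> s N" if "M \<le> N" for M N
    unfolding s_def by (rule sum_mono2) (use fbox_mono[OF that] in auto)
  have "\<exists>l. s \<longlonglongrightarrow> l"
    by (rule incseq_convergent[of s "(L2_norm f)\<^sup>2"])
       (auto simp: s_def intro!: Bessel f monoI s_mono[unfolded s_def])
  then have s_cauchy: "Cauchy s" using LIMSEQ_imp_Cauchy by blast
  have d: "(L2_norm (\<lambda>x. fpart N f x - fpart M f x))\<^sup>2 = s N - s M" if "M \<le> N" for M N
    using L2_norm_trig_sum[of "fbox N - fbox M" "fourier f"] fbox_mono[OF that]
    by (simp add: trig_sum_diff s_def sum_diff)
  have d': "(L2_norm (\<lambda>x. fpart N f x - fpart M f x))\<^sup>2 = \<bar>s N - s M\<bar>" for M N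
    using d[of M N] d[of N M] s_mono[of M N] s_mono[of N M]
      L2_norm_minus_commute[of "fpart N f" "fpart M f"]
    by (cases "M \<le> N") auto
  obtain g where g: "g \<in> L2_per" "(\<lambda>N. L2_norm (\<lambda>x. fpart N f x - g x)) \<longlonglongrightarrow> 0"
  proof (rule L2_complete[of "\<lambda>N. fpart N f"])
    fix e :: real assume "e > 0"
    then obtain M where M: "\<forall>m\<ge>M. \<forall>n\<ge>M. dist (s m) (s n) < e\<^sup>2"
      using s_cauchy unfolding Cauchy_def by (meson zero_less_power)
    have "L2_norm (\<lambda>x. fpart m f x - fpart n f x) \<le> e" if "m \<ge> M" "n \<ge> M" for m n
      by (rule power2_le_imp_le) (use M that d'[of m n] \<open>e > 0\<close> in \<open>auto simp: dist_real_def intro: less_imp_le\<close>)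
    then show "\<exists>M. \<forall>m\<ge>M. \<forall>n\<ge>M. L2_norm (\<lambda>x. fpart m f x - fpart n f x) \<le> e" by blast
  qed (auto intro: trig_sum_L2_per)
  have "fourier g k = fourier f k" for k
  proof (rule LIMSEQ_unique[OF fourier_tendsto[OF trig_sum_L2_per g]])
    show "(\<lambda>N. fourier (fpart N f) k) \<longlonglongrightarrow> fourier f k"
      by (rule tendsto_eventually, rule eventually_mono[OF eventually_in_fbox[of k]]) (simp add: fourier_trig_sum)
  qed
  then have "AE x in torus. g x - f x = 0"
    using f g by (intro fourier_zero_imp L2_per_diff) (auto simp: fourier_diff)
  then have ae: "AE x in torus. f x = g x" by eventually_elim auto
  have "L2_norm (\<lambda>x. fpart N f x - f x) = L2_norm (\<lambda>x. fpart N f x - g x)" for N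
    by (rule L2_norm_cong_AE) (use ae f g in \<open>auto intro!: L2_per_diff trig_sum_L2_per\<close>)
  then show ?thesis using g(2) by simp
qed

lemma L2_inner_tendsto:
  assumes "\<And>n. f n \<in> L2_per" "f0 \<in> L2_per" "(\<lambda>n. L2_norm (\<lambda>x. f n x - f0 x)) \<longlonglongrightarrow> 0" and g: "g \<in> L2_per"
  shows "(\<lambda>n. L2_inner (f n) g) \<longlonglongrightarrow> L2_inner f0 g"
proof (rule Lim_null_comparison[THEN LIM_zero_cancel, OF always_eventually], rule allI)
  fix n
  show "norm (L2_inner (f n) g - L2_inner f0 g) \<le> L2_norm (\<lambda>x. f n x - f0 x) * L2_norm g"
    using L2_inner_Cauchy_Schwarz[OF L2_per_diff[OF assms(1)[of n] assms(2)] g] assms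
    by (simp add: L2_inner_diff_left)
  show "(\<lambda>n. L2_norm (\<lambda>x. f n x - f0 x) * L2_norm g) \<longlonglongrightarrow> 0"
    using tendsto_mult_right[OF assms(3), of "L2_norm g"] by simp
qed

text \<open>The formula is exact when f is replaced by a partial sum, and passes to the limit by
  continuity of the inner product. \<open>Re\<close> appears because the real inner product of
  complex functions is the real part of the Hermitian one.\<close>

theorem Parseval:
  assumes "f \<in> L2_per" "g \<in> L2_per"
  shows "(\<lambda>N. \<Sum>k\<in>fbox N. Re (fourier f k * cnj (fourier g k))) \<longlonglongrightarrow> L2_inner f g"
  using L2_inner_tendsto[OF trig_sum_L2_per assms(1) fpart_tendsto[OF assms(1)] assms(2)]
  by (simp add: L2_inner_trig_sum[OF assms(2)])

section \<open>Weak derivatives on the Fourier side\<close>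

definition phase :: "int^2 \<Rightarrow> real^2 \<Rightarrow> real" where
  "phase k x = (\<Sum>j\<in>UNIV. of_int (k $ j) * x $ j)"

lemma wave_phase: "wave k x = cis (phase k x)"
  by (simp add: wave_def phase_def)

lemma bounded_linear_phase: "bounded_linear (phase k)"
  unfolding phase_def
  by (intro bounded_linear_sum bounded_linear_compose[OF bounded_linear_mult_right] bounded_linear_vec_nth)

lemma phase_axis [simp]: "phase k (axis j 1) = of_int (k $ j)"
  by (simp add: phase_def axis_def if_distrib[of "\<lambda>x. _ * x"] cong: if_cong)

lemma has_derivative_phase [derivative_intros]: "(phase k has_derivative phase k) (at x within S)"
  using bounded_linear_phase bounded_linear_imp_has_derivative by blast

lemma partial_has_derivative: "(\<phi> has_derivative D) (at x) \<Longrightarrow> partial j \<phi> x = D (axis j 1)"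
  unfolding partial_def using frechet_derivative_at by metis

lemma has_derivative_wave_comb:
  "((\<lambda>x. a * cos (phase k x) + b * sin (phase k x)) has_derivative
     (\<lambda>h. (b * cos (phase k x) - a * sin (phase k x)) * phase k h)) (at x)"
  by (auto intro!: derivative_eq_intros simp: algebra_simps)

lemma partial_wave_comb:
  "partial j (\<lambda>x. a * cos (phase k x) + b * sin (phase k x)) =
    (\<lambda>x. (b * of_int (k $ j)) * cos (phase k x) + (- a * of_int (k $ j)) * sin (phase k x))"
  using partial_has_derivative[OF has_derivative_wave_comb[of a k b]] by (auto simp: algebra_simps)

text \<open>Test functions are real, so exponentials are tested through real combinations of cosine
  and sine; the choices (1, 0) and (0, 1) of (a, b) later yield real and imaginary parts. The
  coinduction uses the set of all combinations with the same k, which differentiation maps into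
  itself.\<close>

lemma smooth_wave_comb: "smooth (\<lambda>x. a * cos (phase k x) + b * sin (phase k x))"
proof -
  define X where "X \<phi> \<longleftrightarrow> (\<exists>a b. \<phi> = (\<lambda>x. a * cos (phase k x) + b * sin (phase k x)))" for \<phi>
  have "X (\<lambda>x. a * cos (phase k x) + b * sin (phase k x))" by (auto simp: X_def)
  then show ?thesis
  proof (rule smooth.coinduct)
    fix \<phi> assume "X \<phi>"
    then obtain a b where \<phi>: "\<phi> = (\<lambda>x. a * cos (phase k x) + b * sin (phase k x))" by (auto simp: X_def)
    have "\<phi> differentiable at x" for x
      unfolding \<phi> differentiable_def using has_derivative_wave_comb[of a k b x] by (rule exI[where P="\<lambda>D. (_ has_derivative D) _"])
    moreover have "X (partial j \<phi>)" for j
      unfolding \<phi> partial_wave_comb X_def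
      by (rule exI[of _ "b * of_int (k $ j)"], rule exI[of _ "- a * of_int (k $ j)"], rule refl)
    ultimately show "\<exists>\<psi>. \<phi> = \<psi> \<and> (\<forall>x. \<psi> differentiable at x) \<and> (\<forall>j. X (partial j \<psi>) \<or> smooth (partial j \<psi>))"
      by (intro exI[of _ \<phi>]) simp
  qed
qed

lemma periodic_wave_comb: "periodic (\<lambda>x. a * cos (phase k x) + b * sin (phase k x))"
proof -
  have "cos (phase k x) = Re (wave k x)" "sin (phase k x) = Im (wave k x)" for x
    by (simp_all add: wave_phase)
  then show ?thesis using wave_periodic[of k] by (simp add: periodic_def)
qed

lemma smooth_differentiable: "smooth \<phi> \<Longrightarrow> \<phi> differentiable at x"
  and smooth_partial: "smooth \<phi> \<Longrightarrow> smooth (partial j \<phi>)"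
  by (auto elim: smooth.cases)

lemma smooth_continuous: "smooth \<phi> \<Longrightarrow> continuous_on S \<phi>"
  using smooth_differentiable differentiable_imp_continuous_on
  by (metis differentiable_at_withinI differentiable_on_def)

lemma periodic_partial:
  assumes "periodic \<phi>" "\<And>x. \<phi> differentiable at x"
  shows "periodic (partial j \<phi>)"
  unfolding periodic_def
proof (intro allI)
  fix x i
  let ?c = "axis i (2 * pi) :: real^2"
  have "(\<phi> has_derivative frechet_derivative \<phi> (at (x + ?c))) (at (x + ?c))"
    using assms(2) frechet_derivative_works by blast
  then have "((\<lambda>y. \<phi> (y + ?c)) has_derivative frechet_derivative \<phi> (at (x + ?c))) (at x)"
    by (rule has_derivative_compose[rotated, where f="\<lambda>y. y + ?c", unfolded o_def, simplified])
       (auto intro!: derivative_eq_intros)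
  then have "(\<phi> has_derivative frechet_derivative \<phi> (at (x + ?c))) (at x)"
    using assms(1) by (simp add: periodic_def)
  from partial_has_derivative[OF this] show "partial j \<phi> (x + ?c) = partial j \<phi> x"
    by (simp add: partial_def)
qed

lemma L2_per_continuous:
  fixes \<phi> :: "real^2 \<Rightarrow> 'a::euclidean_space"
  assumes "periodic \<phi>" "continuous_on UNIV \<phi>"
  shows "\<phi> \<in> L2_per"
proof (rule L2_perI)
  show m: "\<phi> \<in> borel_measurable torus" by (rule measurable_torus_continuous[OF assms(2)])
  have "compact (\<phi> ` cbox 0 (\<chi> i. 2 * pi))"
    by (intro compact_continuous_image compact_cbox continuous_on_subset[OF assms(2)]) auto
  then have "\<exists>B. \<forall>x\<in>cbox 0 (\<chi> i. 2 * pi). norm (\<phi> x) \<le> B"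
    by (auto dest!: compact_imp_bounded simp: bounded_iff)
  then obtain B where B: "\<And>x. x \<in> cbox 0 (\<chi> i. 2 * pi) \<Longrightarrow> norm (\<phi> x) \<le> B" by blast
  show "integrable torus (\<lambda>x. (norm (\<phi> x))\<^sup>2)"
  proof (rule torus.integrable_const_bound)
    show "AE x in torus. norm ((norm (\<phi> x))\<^sup>2) \<le> B\<^sup>2"
      by (intro AE_I2) (auto intro!: power_mono B)
  qed (use m in measurable)
qed (use assms in auto)

lemma smooth_periodic_L2_per: "smooth \<phi> \<Longrightarrow> periodic \<phi> \<Longrightarrow> \<phi> \<in> L2_per"
  "smooth \<phi> \<Longrightarrow> periodic \<phi> \<Longrightarrow> partial j \<phi> \<in> L2_per"
  by (auto intro!: L2_per_continuous smooth_continuous smooth_partial periodic_partial smooth_differentiable)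

text \<open>The fundamental theorem of calculus in direction j, with Fubini arranged so that this
  coordinate is integrated innermost. The boundary terms cancel by periodicity.\<close>

lemma torus_integral_partial:
  fixes \<phi> :: "real^2 \<Rightarrow> real"
  assumes diff: "\<And>x. \<phi> differentiable at x" and cont: "continuous_on UNIV (partial j \<phi>)"
    and per: "periodic \<phi>"
  shows "(\<integral>x. partial j \<phi> x \<partial>torus) = 0"
proof -
  interpret P: product_sigma_finite "\<lambda>b::real^2. lborel :: real measure" ..
  define b where "b = (axis j 1 :: real^2)"
  define I where "I = Basis - {b}"
  have bB: "b \<in> Basis" by (simp add: b_def axis_in_Basis_iff)
  then have ins: "insert b I = Basis" "b \<notin> I" "finite I" by (auto simp: I_def)
  define F where "F = (\<lambda>x. indicator (cbox 0 (\<chi> i. 2 * pi)) x *\<^sub>R partial j \<phi> x)"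
  have pm: "partial j \<phi> \<in> borel_measurable borel" by (rule borel_measurable_continuous_onI[OF cont])
  have Fm: "F \<in> borel_measurable borel"
    unfolding F_def by (intro borel_measurable_scaleR borel_measurable_indicator pm) auto
  have Fi: "integrable lborel F"
    unfolding F_def
    by (rule borel_integrable_compact[unfolded set_integrable_def]) (auto intro: continuous_on_subset[OF cont])
  have m1: "(\<lambda>f. \<Sum>b\<in>Basis. f b *\<^sub>R b) \<in> measurable (\<Pi>\<^sub>M b\<in>(Basis::(real^2) set). (lborel::real measure)) borel"
    by (intro borel_measurable_sum borel_measurable_scaleR borel_measurable_const)
       (simp add: measurable_component_singleton)
  have Fi': "integrable (\<Pi>\<^sub>M b\<in>(insert b I). (lborel::real measure)) (\<lambda>f. F (\<Sum>b\<in>Basis. f b *\<^sub>R b))"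
    unfolding ins(1) using Fi by (subst (asm) lborel_eq) (simp add: integrable_distr_eq[OF m1 Fm])
  have "(\<integral>x. partial j \<phi> x \<partial>torus) = (\<integral>x. F x \<partial>lborel)"
    unfolding F_def by (rule torus_integral_eq_lborel[OF cont])
  also have "\<dots> = (\<integral>f. F (\<Sum>b\<in>Basis. f b *\<^sub>R b) \<partial>(\<Pi>\<^sub>M b\<in>(insert b I). (lborel::real measure)))"
    unfolding ins(1) lborel_eq[where 'a="real^2"] by (rule integral_distr[OF m1 Fm])
  also have "\<dots> = (\<integral>f. (\<integral>y. F (\<Sum>c\<in>Basis. (f(b := y)) c *\<^sub>R c) \<partial>lborel) \<partial>(\<Pi>\<^sub>M b\<in>I. (lborel::real measure)))"
    by (rule P.product_integral_insert[OF ins(3,2) Fi'])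
  also have "\<dots> = (\<integral>f. 0 \<partial>(\<Pi>\<^sub>M b\<in>I. (lborel::real measure)))"
  proof (rule Bochner_Integration.integral_cong[OF refl])
    fix f :: "real^2 \<Rightarrow> real"
    define z where "z = (\<Sum>c\<in>I. f c *\<^sub>R c)"
    have x: "(\<Sum>c\<in>Basis. (f(b := y)) c *\<^sub>R c) = z + y *\<^sub>R b" for y
    proof -
      have "(\<Sum>c\<in>I. (f(b := y)) c *\<^sub>R c) = z"
        unfolding z_def using ins(2) by (intro sum.cong) auto
      then show ?thesis
        using sum.insert[OF ins(3,2), of "\<lambda>c. (f(b := y)) c *\<^sub>R c"] unfolding ins(1) by (simp add: add.commute)
    qed
    have zj: "z $ j = 0"
    proof -
      have "c $ j = 0" if "c \<in> I" for c using that by (auto simp: I_def b_def Basis_real2 axis_def)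
      then show ?thesis by (simp add: z_def)
    qed
    \<comment> \<open>Whether the remaining coordinate lies in the cell. The base point z has j-th
      coordinate zero, since its sum omits b.\<close>
    define C where "C = (\<forall>i. i \<noteq> j \<longrightarrow> 0 \<le> z $ i \<and> z $ i \<le> 2 * pi)"
    have nth: "(z + y *\<^sub>R b) $ i = (if i = j then y else z $ i)" for y i
      using zj by (simp add: b_def axis_def)
    have mem: "z + y *\<^sub>R b \<in> cbox 0 (\<chi> i. 2 * pi) \<longleftrightarrow> C \<and> y \<in> {0..2 * pi}" for y
      unfolding mem_box_cart nth C_def by auto
    have "F (z + y *\<^sub>R b) = (if C then 1 else 0) * (indicator {0..2 * pi} y *\<^sub>R partial j \<phi> (z + y *\<^sub>R b))" for y
      by (simp add: F_def indicator_def mem)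
    moreover have "(\<integral>y. indicator {0..2 * pi} y *\<^sub>R partial j \<phi> (z + y *\<^sub>R b) \<partial>lborel) = \<phi> (z + (2 * pi) *\<^sub>R b) - \<phi> (z + 0 *\<^sub>R b)"
    proof (rule integral_FTC_atLeastAtMost)
      fix y
      have "(\<phi> has_derivative frechet_derivative \<phi> (at (z + y *\<^sub>R b))) (at (z + y *\<^sub>R b))"
        using diff frechet_derivative_works by blast
      then have "((\<lambda>y. \<phi> (z + y *\<^sub>R b)) has_derivative (\<lambda>h. frechet_derivative \<phi> (at (z + y *\<^sub>R b)) (h *\<^sub>R b))) (at y)"
        by (rule has_derivative_compose[rotated]) (auto intro!: derivative_eq_intros)
      moreover have "frechet_derivative \<phi> (at (z + y *\<^sub>R b)) (h *\<^sub>R b) = h *\<^sub>R partial j \<phi> (z + y *\<^sub>R b)" for h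
        unfolding partial_def b_def[symmetric]
        using linear_frechet_derivative[OF diff] by (simp add: linear_cmul)
      ultimately show "((\<lambda>y. \<phi> (z + y *\<^sub>R b)) has_vector_derivative partial j \<phi> (z + y *\<^sub>R b)) (at y within {0..2 * pi})"
        unfolding has_vector_derivative_def by (auto intro: has_derivative_at_withinI)
    qed (auto intro!: continuous_on_compose2[OF cont] continuous_intros)
    moreover have "\<phi> (z + (2 * pi) *\<^sub>R b) = \<phi> z"
    proof -
      have "(2 * pi) *\<^sub>R b = axis j (2 * pi)" by (simp add: b_def vec_eq_iff axis_def)
      then show ?thesis using per by (simp add: periodic_def)
    qed
    ultimately show "(\<integral>y. F (\<Sum>c\<in>Basis. (f(b := y)) c *\<^sub>R c) \<partial>lborel) = 0"
      unfolding x by simp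
  qed
  finally show ?thesis by simp
qed

lemma fourier_of_real:
  fixes h :: "real^2 \<Rightarrow> real"
  assumes h: "h \<in> L2_per"
  shows "fourier (\<lambda>x. complex_of_real (h x)) k =
    Complex ((\<integral>x. h x * cos (phase k x) \<partial>torus) / (2 * pi)) (- (\<integral>x. h x * sin (phase k x) \<partial>torus) / (2 * pi))"
proof -
  let ?z = "\<integral>x. complex_of_real (h x) * cnj (wave k x) \<partial>torus"
  note i = fourier_integrable[OF L2_per_of_real[OF h], of k]
  have "Re ?z = (\<integral>x. h x * cos (phase k x) \<partial>torus)"
    using integral_Re[OF i] by (simp add: wave_phase)
  moreover have "Im ?z = - (\<integral>x. h x * sin (phase k x) \<partial>torus)"
    using integral_Im[OF i] by (simp add: wave_phase)
  ultimately show ?thesis by (simp add: fourier_def complex_eq_iff)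
qed

text \<open>Integration by parts against cosine and sine: the derivative of the product of two
  periodic functions has integral zero. It serves to test a divergence with an arbitrary smooth
  function.\<close>

lemma fourier_partial_smooth:
  assumes "smooth \<phi>" "periodic \<phi>"
  shows "fourier (\<lambda>x. complex_of_real (partial j \<phi> x)) k = \<i> * of_int (k $ j) * fourier (\<lambda>x. complex_of_real (\<phi> x)) k"
proof -
  have p: "\<phi> \<in> L2_per" "partial j \<phi> \<in> L2_per"
    using assms by (auto intro!: smooth_periodic_L2_per)
  have ibp: "(\<integral>x. partial j \<phi> x * (a * cos (phase k x) + b * sin (phase k x)) \<partial>torus) =
     - (\<integral>x. \<phi> x * partial j (\<lambda>x. a * cos (phase k x) + b * sin (phase k x)) x \<partial>torus)" for a b
  proof -
    let ?\<psi> = "\<lambda>x. a * cos (phase k x) + b * sin (phase k x)"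
    note s = smooth_wave_comb[of a k b] periodic_wave_comb[of a k b]
    have q: "?\<psi> \<in> L2_per" "partial j ?\<psi> \<in> L2_per"
      using s by (auto intro!: smooth_periodic_L2_per)
    have D: "((\<lambda>x. \<phi> x * ?\<psi> x) has_derivative
        (\<lambda>h. \<phi> x * frechet_derivative ?\<psi> (at x) h + frechet_derivative \<phi> (at x) h * ?\<psi> x)) (at x)" for x
      using assms s smooth_differentiable frechet_derivative_works by (intro has_derivative_mult) blast+
    have pe: "partial j (\<lambda>x. \<phi> x * ?\<psi> x) = (\<lambda>x. \<phi> x * partial j ?\<psi> x + partial j \<phi> x * ?\<psi> x)"
      using partial_has_derivative[OF D] by (auto simp: partial_def)
    have "(\<integral>x. partial j (\<lambda>x. \<phi> x * ?\<psi> x) x \<partial>torus) = 0"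
    proof (rule torus_integral_partial)
      show "(\<lambda>x. \<phi> x * ?\<psi> x) differentiable at x" for x using D unfolding differentiable_def by blast
      show "continuous_on UNIV (partial j (\<lambda>x. \<phi> x * ?\<psi> x))"
        unfolding pe by (intro continuous_intros smooth_continuous smooth_partial assms s)
      show "periodic (\<lambda>x. \<phi> x * ?\<psi> x)" using assms(2) s(2) by (simp add: periodic_def)
    qed
    moreover have "integrable torus (\<lambda>x. \<phi> x * partial j ?\<psi> x)" "integrable torus (\<lambda>x. partial j \<phi> x * ?\<psi> x)"
      using L2_per_integrable_inner[OF p(1) q(2)] L2_per_integrable_inner[OF p(2) q(1)] by simp_all
    ultimately show ?thesis unfolding pe by simp
  qed
  show ?thesis
    using ibp[of 1 0] ibp[of 0 1]
    unfolding partial_wave_comb fourier_of_real[OF p(1)] fourier_of_real[OF p(2)]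
    by (simp add: complex_eq_iff mult.left_commute[of "\<phi> _"] )
qed

subsection \<open>Fourier coefficients of vector fields\<close>

definition fcoeff :: "field2 \<Rightarrow> 2 \<Rightarrow> int^2 \<Rightarrow> complex" where
  "fcoeff u i k = fourier (\<lambda>x. complex_of_real (u x $ i)) k"

definition freq2 :: "int^2 \<Rightarrow> real" where
  "freq2 k = (\<Sum>j\<in>UNIV. (of_int (k $ j))\<^sup>2)"

lemma L2_per_component_of_real: "u \<in> L2_per \<Longrightarrow> (\<lambda>x. complex_of_real (u x $ i)) \<in> L2_per" for u :: field2
  by (intro L2_per_of_real L2_per_component)

lemma fcoeff_diff: "u \<in> L2_per \<Longrightarrow> v \<in> L2_per \<Longrightarrow> fcoeff (\<lambda>x. u x - v x) i k = fcoeff u i k - fcoeff v i k"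
  by (simp add: fcoeff_def fourier_diff L2_per_component_of_real)

lemma fcoeff_add: "u \<in> L2_per \<Longrightarrow> v \<in> L2_per \<Longrightarrow> fcoeff (\<lambda>x. u x + v x) i k = fcoeff u i k + fcoeff v i k"
  by (simp add: fcoeff_def fourier_add L2_per_component_of_real)

lemma fcoeff_scaleR: "fcoeff (\<lambda>x. c *\<^sub>R u x) i k = c * fcoeff u i k"
  by (simp add: fcoeff_def fourier_cmult)

lemma fcoeff_uminus: "fcoeff (\<lambda>x. - u x) i k = - fcoeff u i k"
  by (simp add: fcoeff_def fourier_uminus)

lemma fcoeff_sum: "(\<And>j. j \<in> I \<Longrightarrow> u j \<in> L2_per) \<Longrightarrow> fcoeff (\<lambda>x. \<Sum>j\<in>I. u j x) i k = (\<Sum>j\<in>I. fcoeff (u j) i k)"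
  by (simp add: fcoeff_def fourier_sum L2_per_component_of_real)

lemma fcoeff_cong_AE:
  assumes "u \<in> L2_per" "v \<in> L2_per" "AE x in torus. u x = v x"
  shows "fcoeff u i k = fcoeff v i k"
  unfolding fcoeff_def using assms(3)
  by (intro fourier_cong_AE L2_per_component_of_real assms(1,2)) auto

lemma L2_inner_components:
  fixes u v :: field2
  assumes "u \<in> L2_per" "v \<in> L2_per"
  shows "L2_inner u v = (\<Sum>i\<in>UNIV. L2_inner (\<lambda>x. complex_of_real (u x $ i)) (\<lambda>x. complex_of_real (v x $ i)))"
proof -
  have "integrable torus (\<lambda>x. u x $ i * v x $ i)" for i
    using L2_per_integrable_inner[OF L2_per_component[OF assms(1)] L2_per_component[OF assms(2)], of i i] by simp
  then show ?thesis by (simp add: L2_inner_def inner_vec_def inner_complex_def)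
qed

lemma field_Parseval:
  assumes "u \<in> L2_per" "v \<in> L2_per"
  shows "(\<lambda>N. \<Sum>k\<in>fbox N. \<Sum>i\<in>UNIV. Re (fcoeff u i k * cnj (fcoeff v i k))) \<longlonglongrightarrow> L2_inner u v"
  unfolding L2_inner_components[OF assms] fcoeff_def
  by (subst sum.swap) (intro tendsto_sum Parseval L2_per_component_of_real assms)

lemma field_norm_Parseval:
  assumes "u \<in> L2_per"
  shows "(\<lambda>N. \<Sum>k\<in>fbox N. \<Sum>i\<in>UNIV. (norm (fcoeff u i k))\<^sup>2) \<longlonglongrightarrow> (L2_norm u)\<^sup>2"
  using field_Parseval[OF assms assms] by (simp add: L2_norm_power2 complex_mult_cnj cmod_power2)

text \<open>By Parseval. Weak derivatives and projections are chosen representatives, so identities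
  between them are proved by comparing coefficients and hold almost everywhere.\<close>

lemma field_eq_AE:
  assumes u: "u \<in> L2_per" and v: "v \<in> L2_per" and eq: "\<And>i k. fcoeff u i k = fcoeff v i k"
  shows "AE x in torus. u x = v x"
proof -
  have "AE x in torus. u x - v x = 0"
  proof (subst L2_norm_eq_0_iff[OF L2_per_diff[OF u v], symmetric])
    have "(\<lambda>N. 0) \<longlonglongrightarrow> (L2_norm (\<lambda>x. u x - v x))\<^sup>2"
      using field_norm_Parseval[OF L2_per_diff[OF u v]] by (simp add: fcoeff_diff u v eq)
    then show "L2_norm (\<lambda>x. u x - v x) = 0" by (simp add: LIMSEQ_const_iff)
  qed
  then show ?thesis by eventually_elim simp
qed

lemma fcoeff_norm_le:
  assumes u: "u \<in> L2_per"
  shows "norm (fcoeff u i k) \<le> L2_norm u"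
proof -
  have "norm (fcoeff u i k) \<le> L2_norm (\<lambda>x. complex_of_real (u x $ i))"
    unfolding fcoeff_def by (intro norm_fourier_le L2_per_component_of_real u)
  also have "\<dots> \<le> L2_norm u"
  proof (rule power2_le_imp_le[OF _ L2_norm_ge0])
    show "(L2_norm (\<lambda>x. complex_of_real (u x $ i)))\<^sup>2 \<le> (L2_norm u)\<^sup>2"
      unfolding L2_norm_power2 L2_inner_components[OF u u]
      by (rule member_le_sum) (auto simp: L2_inner_ge0)
  qed
  finally show ?thesis .
qed

text \<open>Among all test functions, the cosine and the sine of frequency k already determine the
  coefficient at k.\<close>

lemma fcoeff_weak_partial:
  assumes u: "u \<in> L2_per" and g: "g \<in> L2_per" and w: "has_weak_partial j u g"
  shows "fcoeff g i k = \<i> * of_int (k $ j) * fcoeff u i k"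
proof -
  note L = L2_per_component[OF u, of i] L2_per_component[OF g, of i]
  have comp: "(\<integral>x. \<phi> x *\<^sub>R h x \<partial>torus) $ i = (\<integral>x. \<phi> x * h x $ i \<partial>torus)"
    if "\<phi> \<in> L2_per" "h \<in> L2_per" for \<phi> :: "real^2 \<Rightarrow> real" and h :: field2
  proof -
    have "integrable torus (\<lambda>x. \<phi> x *\<^sub>R h x)"
      by (rule Bochner_Integration.integrable_bound[OF L2_per_integrable_norm_mult[OF that]])
         (use that[THEN L2_per_measurable] in \<open>auto intro!: borel_measurable_scaleR\<close>)
    from integral_bounded_linear[OF bounded_linear_vec_nth this, of i] show ?thesis by simp
  qed
  have ibp: "(\<integral>x. g x $ i * (a * cos (phase k x) + b * sin (phase k x)) \<partial>torus) =
     - (\<integral>x. u x $ i * partial j (\<lambda>x. a * cos (phase k x) + b * sin (phase k x)) x \<partial>torus)" for a b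
  proof -
    let ?\<psi> = "\<lambda>x. a * cos (phase k x) + b * sin (phase k x)"
    note s = smooth_wave_comb[of a k b] periodic_wave_comb[of a k b]
    have q: "?\<psi> \<in> L2_per" "partial j ?\<psi> \<in> L2_per"
      using s by (auto intro!: smooth_periodic_L2_per)
    have "(\<integral>x. partial j ?\<psi> x *\<^sub>R u x \<partial>torus) = - (\<integral>x. ?\<psi> x *\<^sub>R g x \<partial>torus)"
      using w s unfolding has_weak_partial_def by blast
    from arg_cong[OF this, of "\<lambda>v. v $ i"] show ?thesis
      unfolding vector_uminus_component comp[OF q(1) g] comp[OF q(2) u] by (simp add: mult.commute)
  qed
  show ?thesis
    using ibp[of 1 0] ibp[of 0 1]
    unfolding partial_wave_comb fcoeff_def fourier_of_real[OF L(1)] fourier_of_real[OF L(2)]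
    by (simp add: complex_eq_iff mult.left_commute[of "u _ $ _"])
qed

text \<open>One direction tests with cosine and sine. The other expands an arbitrary test function
  by Parseval, where the condition at each k makes the term for that k vanish.\<close>

lemma div_free_iff:
  assumes u: "u \<in> L2_per"
  shows "div_free u \<longleftrightarrow> (\<forall>k. (\<Sum>i\<in>UNIV. of_int (k $ i) * fcoeff u i k) = 0)"
proof
  assume d: "div_free u"
  show "\<forall>k. (\<Sum>i\<in>UNIV. of_int (k $ i) * fcoeff u i k) = 0"
  proof
    fix k
    have *: "(\<Sum>i\<in>UNIV. \<integral>x. u x $ i * partial i (\<lambda>x. a * cos (phase k x) + b * sin (phase k x)) x \<partial>torus) = 0" for a b
    proof -
      let ?\<psi> = "\<lambda>x. a * cos (phase k x) + b * sin (phase k x)"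
      note s = smooth_wave_comb[of a k b] periodic_wave_comb[of a k b]
      have q: "partial j ?\<psi> \<in> L2_per" for j
        using s by (auto intro!: smooth_periodic_L2_per)
      have "(\<integral>x. (\<Sum>i\<in>UNIV. u x $ i * partial i ?\<psi> x) \<partial>torus) = 0"
        using d s unfolding div_free_def by blast
      then show ?thesis
        using L2_per_integrable_inner[OF L2_per_component[OF u] q] by (subst (asm) Bochner_Integration.integral_sum) auto
    qed
    show "(\<Sum>i\<in>UNIV. of_int (k $ i) * fcoeff u i k) = 0"
      using *[of 1 0] *[of 0 1] unfolding partial_wave_comb fcoeff_def fourier_of_real[OF L2_per_component[OF u]]
      by (simp add: complex_eq_iff mult.left_commute[of "u _ $ _"] sum_divide_distrib[symmetric] sum_negf)
  qed
next
  assume k: "\<forall>k. (\<Sum>i\<in>UNIV. of_int (k $ i) * fcoeff u i k) = 0"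
  show "div_free u" unfolding div_free_def
  proof (intro allI impI)
    fix \<phi> assume \<phi>: "smooth \<phi> \<and> periodic \<phi>"
    have q: "partial j \<phi> \<in> L2_per" for j
      using \<phi> by (auto intro!: smooth_periodic_L2_per)
    let ?f = "fourier (\<lambda>x. complex_of_real (\<phi> x))"
    have "(\<integral>x. (\<Sum>i\<in>UNIV. u x $ i * partial i \<phi> x) \<partial>torus) =
        (\<Sum>i\<in>UNIV. L2_inner (\<lambda>x. complex_of_real (u x $ i)) (\<lambda>x. complex_of_real (partial i \<phi> x)))"
      using L2_per_integrable_inner[OF L2_per_component[OF u] q]
      by (subst Bochner_Integration.integral_sum) (auto simp: L2_inner_def inner_complex_def)
    moreover have "(\<lambda>N. \<Sum>i\<in>UNIV. \<Sum>k\<in>fbox N. Re (fcoeff u i k * cnj (\<i> * of_int (k $ i) * ?f k)))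
      \<longlonglongrightarrow> (\<Sum>i\<in>UNIV. L2_inner (\<lambda>x. complex_of_real (u x $ i)) (\<lambda>x. complex_of_real (partial i \<phi> x)))"
      unfolding fcoeff_def
      using \<phi> Parseval[OF L2_per_component_of_real[OF u] L2_per_of_real[OF q]]
      by (intro tendsto_sum) (simp add: fourier_partial_smooth)
    moreover have "(\<Sum>i\<in>UNIV. \<Sum>k\<in>fbox N. Re (fcoeff u i k * cnj (\<i> * of_int (k $ i) * ?f k))) = 0" for N
    proof -
      have "(\<Sum>i\<in>UNIV. Re (fcoeff u i k * cnj (\<i> * of_int (k $ i) * ?f k))) =
          Re ((\<Sum>i\<in>UNIV. of_int (k $ i) * fcoeff u i k) * cnj (\<i> * ?f k))" for k
        by (simp add: UNIV_2 algebra_simps)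
      then show ?thesis using k by (subst sum.swap) simp
    qed
    ultimately show "(\<integral>x. (\<Sum>i\<in>UNIV. u x $ i * partial i \<phi> x) \<partial>torus) = 0"
      by (simp add: LIMSEQ_const_iff)
  qed
qed

lemma mean_zero_iff:
  assumes u: "u \<in> L2_per"
  shows "mean_zero u \<longleftrightarrow> (\<forall>i. fcoeff u i 0 = 0)"
proof -
  have "(\<integral>x. u x \<partial>torus) $ i = (\<integral>x. u x $ i \<partial>torus)" for i
    using integral_bounded_linear[OF bounded_linear_vec_nth L2_per_integrable[OF u], of i] by simp
  moreover have "fcoeff u i 0 = complex_of_real (\<integral>x. u x $ i \<partial>torus) / (2 * pi)" for i
    by (simp add: fcoeff_def fourier_def)
  ultimately show ?thesis by (simp add: mean_zero_def vec_eq_iff)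
qed

lemma H_space_iff:
  "u \<in> H_space \<longleftrightarrow> u \<in> L2_per \<and> (\<forall>k. (\<Sum>i\<in>UNIV. of_int (k $ i) * fcoeff u i k) = 0) \<and> (\<forall>i. fcoeff u i 0 = 0)"
  using div_free_iff mean_zero_iff by (auto simp: H_space_def)

section \<open>The Leray projector and the Stokes operator\<close>

lemma H_space_L2_per: "u \<in> H_space \<Longrightarrow> u \<in> L2_per"
  by (simp add: H_space_def)

lemma H_space_add: "u \<in> H_space \<Longrightarrow> v \<in> H_space \<Longrightarrow> (\<lambda>x. u x + v x) \<in> H_space"
  unfolding H_space_iff by (simp add: L2_per_add fcoeff_add distrib_left sum.distrib)

lemma H_space_scaleR: "u \<in> H_space \<Longrightarrow> (\<lambda>x. c *\<^sub>R u x) \<in> H_space"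
  unfolding H_space_iff by (simp add: L2_per_scaleR fcoeff_scaleR mult.left_commute sum_distrib_left[symmetric])

lemma H_space_uminus: "u \<in> H_space \<Longrightarrow> (\<lambda>x. - u x) \<in> H_space"
  using H_space_scaleR[of u "-1"] by simp

lemma H_space_diff: "u \<in> H_space \<Longrightarrow> v \<in> H_space \<Longrightarrow> (\<lambda>x. u x - v x) \<in> H_space"
  using H_space_add[OF _ H_space_uminus, of u v] by simp

lemma fcoeff_tendsto:
  assumes "\<And>n. f n \<in> L2_per" "g \<in> L2_per" "(\<lambda>n. L2_norm (\<lambda>x. f n x - g x)) \<longlonglongrightarrow> 0"
  shows "(\<lambda>n. fcoeff (f n) i k) \<longlonglongrightarrow> fcoeff g i k"
proof (rule Lim_null_comparison[THEN LIM_zero_cancel, OF always_eventually assms(3)], rule allI)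
  fix n
  show "norm (fcoeff (f n) i k - fcoeff g i k) \<le> L2_norm (\<lambda>x. f n x - g x)"
    using fcoeff_norm_le[OF L2_per_diff[OF assms(1)[of n] assms(2)]] assms by (simp add: fcoeff_diff)
qed

text \<open>The conditions on the coefficients are linear, and each coefficient is continuous in the
  L^2 norm.\<close>

lemma H_space_closed:
  assumes f: "\<And>n. f n \<in> H_space" and g: "g \<in> L2_per" and lim: "(\<lambda>n. L2_norm (\<lambda>x. f n x - g x)) \<longlonglongrightarrow> 0"
  shows "g \<in> H_space"
proof -
  have c: "(\<lambda>n. fcoeff (f n) i k) \<longlonglongrightarrow> fcoeff g i k" for i k
    by (rule fcoeff_tendsto[OF H_space_L2_per[OF f] g lim])
  have Z: "(\<Sum>i\<in>UNIV. of_int (k $ i) * fcoeff (f n) i k) = 0" "fcoeff (f n) i 0 = 0" for n k i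
    using f[of n] unfolding H_space_iff by simp_all
  have "(\<lambda>n. \<Sum>i\<in>UNIV. of_int (k $ i) * fcoeff (f n) i k) \<longlonglongrightarrow> (\<Sum>i\<in>UNIV. of_int (k $ i) * fcoeff g i k)" for k
    by (intro tendsto_intros c)
  then have "(\<Sum>i\<in>UNIV. of_int (k $ i) * fcoeff g i k) = 0" for k
    unfolding Z by (simp add: LIMSEQ_const_iff)
  moreover have "fcoeff g i 0 = 0" for i using c[of i 0] unfolding Z by (simp add: LIMSEQ_const_iff)
  ultimately show ?thesis using g by (simp add: H_space_iff)
qed

lemma L2_parallelogram:
  assumes a: "a \<in> L2_per" and b: "b \<in> L2_per"
  shows "(L2_norm (\<lambda>x. a x - b x))\<^sup>2 + (L2_norm (\<lambda>x. a x + b x))\<^sup>2 = 2 * (L2_norm a)\<^sup>2 + 2 * (L2_norm b)\<^sup>2"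
  using a b L2_per_diff[OF a b] L2_per_add[OF a b]
  by (simp add: L2_norm_power2 L2_inner_add_left L2_inner_add_right L2_inner_diff_left L2_inner_diff_right)

lemma L2_norm_tendsto:
  assumes f: "\<And>n. f n \<in> L2_per" and g: "g \<in> L2_per" and lim: "(\<lambda>n. L2_norm (\<lambda>x. f n x - g x)) \<longlonglongrightarrow> 0"
  shows "(\<lambda>n. L2_norm (f n)) \<longlonglongrightarrow> L2_norm g"
proof (rule Lim_null_comparison[THEN LIM_zero_cancel, OF always_eventually lim], rule allI)
  fix n
  show "norm (L2_norm (f n) - L2_norm g) \<le> L2_norm (\<lambda>x. f n x - g x)"
    using L2_norm_triangle[OF L2_per_diff[OF f[of n] g] g] L2_norm_triangle[OF L2_per_diff[OF g f[of n]] f[of n]]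
    by (simp add: L2_norm_minus_commute[of g "f n"] abs_le_iff)
qed

text \<open>The projection theorem, which gives content to the choice in \<open>leray\<close>. A
  sequence minimising the distance from g to \<open>H_space\<close> is Cauchy by the parallelogram
  law, and the first variation at its limit yields orthogonality.\<close>

lemma Leray_projection_exists:
  assumes g: "g \<in> L2_per"
  shows "\<exists>h. h \<in> H_space \<and> (\<forall>k\<in>H_space. L2_inner (g - h) k = 0)"
proof -
  define q where "q h = (L2_norm (\<lambda>x. g x - h x))\<^sup>2" for h
  define D where "D = (INF h\<in>H_space. q h)"
  have H0: "(\<lambda>x. 0) \<in> H_space" by (simp add: H_space_def div_free_def mean_zero_def L2_per_const)
  have bdd: "bdd_below (q ` H_space)" by (rule bdd_belowI[of _ 0]) (auto simp: q_def)
  have D_le: "D \<le> q h" if "h \<in> H_space" for h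
    unfolding D_def using that bdd by (intro cINF_lower) auto
  have "\<exists>h\<in>H_space. q h < D + 1 / real (Suc n)" for n
  proof -
    have "(INF h\<in>H_space. q h) < D + 1 / real (Suc n)" by (simp add: D_def)
    then show ?thesis using H0 bdd by (subst (asm) cINF_less_iff) auto
  qed
  then obtain h where hH: "\<And>n. h n \<in> H_space" and hq: "\<And>n. q (h n) < D + 1 / real (Suc n)" by metis
  note hL = H_space_L2_per[OF hH]
  have close: "(L2_norm (\<lambda>x. h m x - h n x))\<^sup>2 \<le> 2 / real (Suc m) + 2 / real (Suc n)" for m n
  proof -
    \<comment> \<open>The midpoint lies in \<open>H_space\<close>, so its squared distance from g is
      at least D; this turns near-minimality of both points into closeness of the two.\<close>
    let ?m = "\<lambda>x. (1/2) *\<^sub>R (h m x + h n x)"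
    have mH: "?m \<in> H_space" by (intro H_space_scaleR H_space_add hH)
    have "(L2_norm (\<lambda>x. h m x - h n x))\<^sup>2 + (L2_norm (\<lambda>x. (g x - h n x) + (g x - h m x)))\<^sup>2 = 2 * q (h n) + 2 * q (h m)"
      using L2_parallelogram[OF L2_per_diff[OF g hL[of n]] L2_per_diff[OF g hL[of m]]] by (simp add: q_def)
    moreover have "(\<lambda>x. (g x - h n x) + (g x - h m x)) = (\<lambda>x. 2 *\<^sub>R (g x - ?m x))"
      by (auto simp: fun_eq_iff algebra_simps scaleR_2)
    then have "(L2_norm (\<lambda>x. (g x - h n x) + (g x - h m x)))\<^sup>2 = 4 * q ?m"
      by (simp only: L2_norm_scaleR q_def power_mult_distrib) simp
    ultimately show ?thesis using D_le[OF mH] hq[of m] hq[of n] by simp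
  qed
  obtain h0 where h0: "h0 \<in> L2_per" "(\<lambda>n. L2_norm (\<lambda>x. h n x - h0 x)) \<longlonglongrightarrow> 0"
  proof (rule L2_complete[OF hL])
    fix e :: real assume "e > 0"
    obtain M where M: "4 / e\<^sup>2 < real M" using reals_Archimedean2 by blast
    have "L2_norm (\<lambda>x. h m x - h n x) \<le> e" if "m \<ge> M" "n \<ge> M" for m n
    proof (rule power2_le_imp_le)
      have M0: "0 < real M" using M \<open>e > 0\<close> by (meson divide_nonneg_pos le_less_trans zero_le_numeral zero_less_power)
      have "2 / real (Suc j) \<le> 2 / real M" if "j \<ge> M" for j using that M0 by (intro divide_left_mono) auto
      then have "(L2_norm (\<lambda>x. h m x - h n x))\<^sup>2 \<le> 2 / real M + 2 / real M"
        using close[of m n] that by (meson add_mono order_trans)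
      also have "\<dots> \<le> e\<^sup>2" using M M0 \<open>e > 0\<close> by (simp add: field_simps)
      finally show "(L2_norm (\<lambda>x. h m x - h n x))\<^sup>2 \<le> e\<^sup>2" .
    qed (use \<open>e > 0\<close> in simp)
    then show "\<exists>M. \<forall>m\<ge>M. \<forall>n\<ge>M. L2_norm (\<lambda>x. h m x - h n x) \<le> e" by blast
  qed
  have h0H: "h0 \<in> H_space" by (rule H_space_closed[OF hH h0])
  define r where "r = (\<lambda>x. g x - h0 x)"
  have r: "r \<in> L2_per" unfolding r_def by (rule L2_per_diff[OF g h0(1)])
  have "(\<lambda>n. L2_norm (\<lambda>x. g x - h n x)) \<longlonglongrightarrow> L2_norm r"
    unfolding r_def
    by (rule L2_norm_tendsto) (use g hL h0 L2_norm_minus_commute[of h0] in \<open>auto intro!: L2_per_diff\<close>)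
  then have "(\<lambda>n. q (h n)) \<longlonglongrightarrow> (L2_norm r)\<^sup>2" unfolding q_def by (rule tendsto_power)
  moreover have "(\<lambda>n. D + 1 / real (Suc n)) \<longlonglongrightarrow> D + 0"
    using LIMSEQ_inverse_real_of_nat by (intro tendsto_add tendsto_const) (simp add: inverse_eq_divide)
  ultimately have rD: "(L2_norm r)\<^sup>2 \<le> D"
    using hq by (intro LIMSEQ_le[of "\<lambda>n. q (h n)" _ "\<lambda>n. D + 1 / real (Suc n)"]) (auto intro: less_imp_le)
  have "L2_inner r k = 0" if k: "k \<in> H_space" for k
  proof (rule ccontr)
    define b c where "b = L2_inner r k" and "c = (L2_norm k)\<^sup>2"
    assume "L2_inner r k \<noteq> 0"
    then have b: "b \<noteq> 0" by (simp add: b_def)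
    have ineq: "2 * t * b \<le> t\<^sup>2 * c" for t
    proof -
      let ?tk = "\<lambda>x. t *\<^sub>R k x"
      have tk: "?tk \<in> L2_per" using k by (intro L2_per_scaleR H_space_L2_per)
      have "D \<le> q (\<lambda>x. h0 x + ?tk x)" by (intro D_le H_space_add h0H H_space_scaleR k)
      also have "\<dots> = (L2_norm (\<lambda>x. r x - ?tk x))\<^sup>2" by (simp add: q_def r_def algebra_simps)
      also have "\<dots> = (L2_norm r)\<^sup>2 - 2 * t * b + t\<^sup>2 * c"
        using r tk L2_per_diff[OF r tk] H_space_L2_per[OF k] unfolding L2_norm_power2 b_def c_def
        by (simp add: L2_inner_diff_left L2_inner_diff_right L2_inner_scaleR_left L2_inner_scaleR_right
            L2_inner_commute[of k r] power2_eq_square algebra_simps)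
      finally show ?thesis using rD by simp
    qed
    have c0: "c \<ge> 0" by (simp add: c_def)
    \<comment> \<open>The summand 1 covers \<open>c = 0\<close>. With this t the inequality becomes
      t^2 (c + 2) \<le> 0.\<close>
    define t where "t = b / (c + 1)"
    have bt: "b = t * (c + 1)" and "t \<noteq> 0" using b c0 by (auto simp: t_def)
    have "2 * t * b \<le> t\<^sup>2 * c" by (rule ineq)
    then have "t\<^sup>2 * (c + 2) \<le> 0" unfolding bt by (simp add: algebra_simps power2_eq_square)
    moreover have "t\<^sup>2 * (c + 2) > 0" using \<open>t \<noteq> 0\<close> c0 by (intro mult_pos_pos) auto
    ultimately show False by simp
  qed
  then show ?thesis using h0H unfolding r_def fun_diff_def by blast
qed

lemma leray_in_H: "g \<in> L2_per \<Longrightarrow> leray g \<in> H_space"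
  and leray_orth: "g \<in> L2_per \<Longrightarrow> k \<in> H_space \<Longrightarrow> L2_inner (leray g) k = L2_inner g k"
proof -
  assume g: "g \<in> L2_per"
  have *: "leray g \<in> H_space \<and> (\<forall>k\<in>H_space. L2_inner (g - leray g) k = 0)"
    unfolding leray_def using someI_ex[OF Leray_projection_exists[OF g]] .
  then show H: "leray g \<in> H_space" by blast
  show "L2_inner (leray g) k = L2_inner g k" if "k \<in> H_space"
    using * that g H_space_L2_per[OF H] H_space_L2_per[OF that] by (auto simp: fun_diff_def L2_inner_diff_left)
qed

lemma leray_of_H:
  assumes "h \<in> H_space"
  shows "AE x in torus. leray h x = h x"
proof -
  note L = H_space_L2_per[OF assms]
  note l = leray_in_H[OF L]
  let ?d = "\<lambda>x. leray h x - h x"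
  have d: "?d \<in> H_space" by (intro H_space_diff l assms)
  have "L2_inner ?d ?d = 0"
    using leray_orth[OF L d] L H_space_L2_per[OF l] H_space_L2_per[OF d] by (simp add: L2_inner_diff_left)
  then have "L2_norm ?d = 0" by (simp add: L2_norm_def)
  then have "AE x in torus. ?d x = 0" using L2_norm_eq_0_iff[OF H_space_L2_per[OF d]] by simp
  then show ?thesis by eventually_elim simp
qed

section \<open>Sobolev spaces and the Stokes operator in terms of coefficients\<close>

lemma Hk_per_L2_per: "u \<in> Hk_per n \<Longrightarrow> u \<in> L2_per"
  by (cases n) auto

lemma Hk_per_1: "u \<in> Hk_per 1 \<longleftrightarrow> u \<in> L2_per \<and> (\<forall>j. \<exists>g\<in>L2_per. has_weak_partial j u g)"
  by simp

lemma weak_partial_spec: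
  assumes "g \<in> L2_per" "has_weak_partial j u g"
  shows "weak_partial j u \<in> L2_per \<and> has_weak_partial j u (weak_partial j u)"
  unfolding weak_partial_def by (rule someI[of _ g]) (use assms in blast)

lemma weak_partial_Hk_1:
  assumes "u \<in> Hk_per 1"
  shows "weak_partial j u \<in> L2_per" "has_weak_partial j u (weak_partial j u)"
  using assms weak_partial_spec unfolding Hk_per_1 by blast+

lemma fcoeff_weak_partial_Hk_1:
  assumes "u \<in> Hk_per 1"
  shows "fcoeff (weak_partial j u) i k = \<i> * of_int (k $ j) * fcoeff u i k"
  using fcoeff_weak_partial weak_partial_Hk_1[OF assms] Hk_per_L2_per[OF assms] by blast

lemma integrable_scaleR_L2_per:
  fixes \<phi> :: "real^2 \<Rightarrow> real" and u :: field2
  assumes "\<phi> \<in> L2_per" "u \<in> L2_per"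
  shows "integrable torus (\<lambda>x. \<phi> x *\<^sub>R u x)"
  by (rule Bochner_Integration.integrable_bound[OF L2_per_integrable_norm_mult[OF assms]])
     (use assms[THEN L2_per_measurable] in \<open>auto intro!: borel_measurable_scaleR\<close>)

lemma Hk_per_diff:
  fixes u v :: field2
  shows "u \<in> Hk_per n \<Longrightarrow> v \<in> Hk_per n \<Longrightarrow> (\<lambda>x. u x - v x) \<in> Hk_per n"
proof (induction n arbitrary: u v)
  case 0
  then show ?case by (simp add: L2_per_diff)
next
  case (Suc n)
  have "\<exists>g\<in>Hk_per n. has_weak_partial j (\<lambda>x. u x - v x) g" for j
  proof -
    obtain g h where g: "g \<in> Hk_per n" "has_weak_partial j u g" and h: "h \<in> Hk_per n" "has_weak_partial j v h"
      using Suc.prems by fastforce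
    have "has_weak_partial j (\<lambda>x. u x - v x) (\<lambda>x. g x - h x)"
      using g h Suc.prems[THEN Hk_per_L2_per] g(1)[THEN Hk_per_L2_per] h(1)[THEN Hk_per_L2_per]
      by (auto simp: has_weak_partial_def scaleR_diff_right integrable_scaleR_L2_per smooth_periodic_L2_per)
    then show ?thesis using Suc.IH[OF g(1) h(1)] by blast
  qed
  then show ?case using Suc.prems by (auto intro: L2_per_diff)
qed

lemma Hk_1_cong_AE:
  fixes u v :: field2
  assumes u: "u \<in> Hk_per 1" and v: "v \<in> L2_per" and eq: "AE x in torus. u x = v x"
  shows "v \<in> Hk_per 1"
  unfolding Hk_per_1
proof (intro conjI allI v bexI)
  fix j
  show "weak_partial j u \<in> L2_per" by (rule weak_partial_Hk_1[OF u])
  show "has_weak_partial j v (weak_partial j u)"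
    unfolding has_weak_partial_def
  proof (intro allI impI)
    fix \<phi> assume \<phi>: "smooth \<phi> \<and> periodic \<phi>"
    have "(\<integral>x. partial j \<phi> x *\<^sub>R v x \<partial>torus) = (\<integral>x. partial j \<phi> x *\<^sub>R u x \<partial>torus)"
      using \<phi> eq u[THEN Hk_per_L2_per] v
      by (intro integral_cong_AE) (auto intro!: borel_measurable_integrable integrable_scaleR_L2_per smooth_periodic_L2_per)
    then show "(\<integral>x. partial j \<phi> x *\<^sub>R v x \<partial>torus) = - (\<integral>x. \<phi> x *\<^sub>R weak_partial j u x \<partial>torus)"
      using weak_partial_Hk_1(2)[OF u, of j] \<phi> by (simp add: has_weak_partial_def)
  qed
qed

lemma Hk_2_Hk_1: "u \<in> Hk_per 2 \<Longrightarrow> u \<in> Hk_per 1"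
  by (fastforce simp: eval_nat_numeral)

text \<open>The representative chosen by \<open>weak_partial\<close> may differ from the derivative
  whose regularity \<open>Hk_per\<close> provides. Both have the same coefficients, hence agree
  almost everywhere, and membership in H^1 is insensitive to null sets.\<close>

lemma weak_partial_Hk_2:
  fixes u :: field2
  assumes "u \<in> Hk_per 2"
  shows "weak_partial j u \<in> Hk_per 1"
proof -
  note u1 = Hk_2_Hk_1[OF assms]
  obtain g where g: "g \<in> Hk_per 1" "has_weak_partial j u g"
    using assms unfolding numeral_2_eq_2 One_nat_def[symmetric] Hk_per.simps(2) by blast
  have "AE x in torus. g x = weak_partial j u x"
    using g(1)[THEN Hk_per_L2_per] weak_partial_Hk_1[OF u1] fcoeff_weak_partial[OF Hk_per_L2_per[OF u1] _ g(2)]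
    by (intro field_eq_AE) (auto simp: fcoeff_weak_partial_Hk_1[OF u1])
  then show ?thesis using Hk_1_cong_AE[OF g(1)] weak_partial_Hk_1[OF u1] by blast
qed

lemma laplacian_L2_per:
  assumes "u \<in> Hk_per 2"
  shows "laplacian u \<in> L2_per"
  unfolding laplacian_def by (intro L2_per_sum weak_partial_Hk_1 weak_partial_Hk_2 assms)

lemma fcoeff_laplacian:
  assumes "u \<in> Hk_per 2"
  shows "fcoeff (laplacian u) i k = - freq2 k * fcoeff u i k"
proof -
  note p = weak_partial_Hk_2[OF assms]
  have "fcoeff (laplacian u) i k = (\<Sum>j\<in>UNIV. fcoeff (weak_partial j (weak_partial j u)) i k)"
    unfolding laplacian_def by (intro fcoeff_sum weak_partial_Hk_1 p)
  also have "\<dots> = (\<Sum>j\<in>UNIV. - (of_int (k $ j))\<^sup>2 * fcoeff u i k)"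
  proof (rule sum.cong[OF refl])
    fix j
    have "\<i> * a * (\<i> * a * c) = - a\<^sup>2 * c" for a c :: complex
    proof -
      have "\<i> * a * (\<i> * a * c) = (\<i> * \<i>) * (a * a * c)" by (simp only: mult_ac)
      then show ?thesis by (simp add: power2_eq_square)
    qed
    then show "fcoeff (weak_partial j (weak_partial j u)) i k = - (of_int (k $ j))\<^sup>2 * fcoeff u i k"
      unfolding fcoeff_weak_partial_Hk_1[OF p] fcoeff_weak_partial_Hk_1[OF Hk_2_Hk_1[OF assms]] .
  qed
  finally show ?thesis by (simp add: freq2_def sum_distrib_right sum_negf)
qed

lemma stokes_domainD:
  assumes "u \<in> stokes_domain"
  shows "u \<in> Hk_per 2" "u \<in> Hk_per 1" "u \<in> V_space" "u \<in> H_space" "u \<in> L2_per"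
  using assms Hk_2_Hk_1 Hk_per_L2_per by (auto simp: stokes_domain_def V_space_def H_space_def)

lemma V_spaceD:
  assumes "u \<in> V_space"
  shows "u \<in> Hk_per 1" "u \<in> H_space" "u \<in> L2_per"
  using assms Hk_per_L2_per[of u 1] by (auto simp: V_space_def H_space_def)

lemma V_space_diff:
  assumes u: "u \<in> V_space" and v: "v \<in> V_space"
  shows "(\<lambda>x. u x - v x) \<in> V_space"
  using Hk_per_diff[OF V_spaceD(1)[OF u] V_spaceD(1)[OF v]] H_space_diff[OF V_spaceD(2)[OF u] V_spaceD(2)[OF v]]
  by (simp add: V_space_def H_space_def)

lemma stokes_domain_diff:
  assumes u: "u \<in> stokes_domain" and v: "v \<in> stokes_domain"
  shows "(\<lambda>x. u x - v x) \<in> stokes_domain"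
  using Hk_per_diff[OF stokes_domainD(1)[OF u] stokes_domainD(1)[OF v]] V_space_diff[of u v] u v
  by (simp add: stokes_domain_def)

text \<open>The Laplacian multiplies all components at k by the same number, which preserves the
  divergence and mean conditions. On the torus the projection in \<open>stokes\<close> therefore
  changes nothing almost everywhere.\<close>

lemma laplacian_in_H:
  assumes u: "u \<in> stokes_domain"
  shows "laplacian u \<in> H_space"
  unfolding H_space_iff
  using stokes_domainD(4)[OF u, unfolded H_space_iff] laplacian_L2_per[OF stokes_domainD(1)[OF u]]
  by (simp add: fcoeff_laplacian stokes_domainD[OF u] mult.left_commute sum_distrib_left[symmetric] sum_negf)

lemma stokes_AE:
  assumes u: "u \<in> stokes_domain"
  shows "AE x in torus. stokes u x = - laplacian u x"
  using leray_of_H[OF laplacian_in_H[OF u]] by eventually_elim (simp add: stokes_def)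

lemma stokes_in_H:
  assumes u: "u \<in> stokes_domain"
  shows "stokes u \<in> H_space"
  using H_space_uminus[OF leray_in_H[OF laplacian_L2_per[OF stokes_domainD(1)[OF u]]]]
  by (simp add: stokes_def fun_Compl_def)

lemma stokes_L2_per: "u \<in> stokes_domain \<Longrightarrow> stokes u \<in> L2_per"
  by (intro H_space_L2_per stokes_in_H)

lemma fcoeff_stokes:
  assumes u: "u \<in> stokes_domain"
  shows "fcoeff (stokes u) i k = freq2 k * fcoeff u i k"
proof -
  note L = laplacian_L2_per[OF stokes_domainD(1)[OF u]]
  have "fcoeff (stokes u) i k = fcoeff (\<lambda>x. - laplacian u x) i k"
    by (rule fcoeff_cong_AE[OF stokes_L2_per[OF u] L2_per_uminus[OF L] stokes_AE[OF u]])
  then show ?thesis by (simp add: fcoeff_uminus fcoeff_laplacian[OF stokes_domainD(1)[OF u]])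
qed

lemma stokes_diff_AE:
  assumes u: "u \<in> stokes_domain" and v: "v \<in> stokes_domain"
  shows "AE x in torus. stokes (\<lambda>x. u x - v x) x = stokes u x - stokes v x"
  using u v stokes_domain_diff[OF u v]
  by (intro field_eq_AE L2_per_diff stokes_L2_per)
     (auto simp: fcoeff_diff stokes_L2_per fcoeff_stokes stokes_domainD algebra_simps)

subsection \<open>The enstrophy norm\<close>

lemma V_norm_power2:
  assumes u: "u \<in> Hk_per 1"
  shows "(V_norm u)\<^sup>2 = (\<Sum>j\<in>UNIV. (L2_norm (weak_partial j u))\<^sup>2)"
proof -
  have *: "V_inner u u = (\<Sum>j\<in>UNIV. (L2_norm (weak_partial j u))\<^sup>2)"
  proof -
    have i: "integrable torus (\<lambda>x. weak_partial j u x $ i * weak_partial j u x $ i)" for i j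
      using L2_per_integrable_inner[OF L2_per_component L2_per_component, OF weak_partial_Hk_1(1)[OF u] weak_partial_Hk_1(1)[OF u], of j i j i]
      by simp
    show ?thesis unfolding V_inner_def L2_norm_power2 L2_inner_def inner_vec_def
      using i by (subst sum.swap) simp
  qed
  moreover have "0 \<le> V_inner u u" unfolding * by (intro sum_nonneg) auto
  ultimately show ?thesis by (simp add: V_norm_def)
qed

lemma V_norm_ge0: "u \<in> Hk_per 1 \<Longrightarrow> 0 \<le> V_norm u"
  unfolding V_norm_def V_inner_def by (intro real_sqrt_ge_zero sum_nonneg integral_nonneg_AE) auto

lemma V_norm_Parseval:
  assumes u: "u \<in> Hk_per 1"
  shows "(\<lambda>N. \<Sum>k\<in>fbox N. freq2 k * (\<Sum>i\<in>UNIV. (norm (fcoeff u i k))\<^sup>2)) \<longlonglongrightarrow> (V_norm u)\<^sup>2"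
proof -
  have "(\<lambda>N. \<Sum>j\<in>UNIV. \<Sum>k\<in>fbox N. \<Sum>i\<in>UNIV. (norm (fcoeff (weak_partial j u) i k))\<^sup>2) \<longlonglongrightarrow> (V_norm u)\<^sup>2"
    unfolding V_norm_power2[OF u] by (intro tendsto_sum field_norm_Parseval weak_partial_Hk_1 u)
  moreover have "(\<Sum>j\<in>UNIV. \<Sum>i\<in>UNIV. (norm (fcoeff (weak_partial j u) i k))\<^sup>2) = freq2 k * (\<Sum>i\<in>UNIV. (norm (fcoeff u i k))\<^sup>2)" for k
    by (simp add: fcoeff_weak_partial_Hk_1[OF u] norm_mult power_mult_distrib freq2_def sum_distrib_right sum_distrib_left)
       (rule sum.swap)
  ultimately show ?thesis by (subst (asm) sum.swap) simp
qed

lemma V_norm_cong: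
  assumes "u \<in> Hk_per 1" "v \<in> Hk_per 1" "\<And>i k. fcoeff u i k = fcoeff v i k"
  shows "V_norm u = V_norm v"
proof -
  have "(V_norm u)\<^sup>2 = (V_norm v)\<^sup>2"
    using V_norm_Parseval[OF assms(1)] V_norm_Parseval[OF assms(2)] unfolding assms(3) by (rule LIMSEQ_unique)
  then show ?thesis using assms V_norm_ge0 by (simp add: power2_eq_iff_nonneg)
qed

text \<open>Minkowski's inequality in the plane, applied to the pair of L^2 norms of the partial
  derivatives.\<close>

lemma V_norm_triangle_diff:
  assumes u: "u \<in> Hk_per 1" and v: "v \<in> Hk_per 1"
  shows "V_norm (\<lambda>x. u x - v x) \<le> V_norm u + V_norm v"
proof -
  have d: "(\<lambda>x. u x - v x) \<in> Hk_per 1" by (rule Hk_per_diff[OF u v])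
  have V: "V_norm w = L2_set (\<lambda>j. L2_norm (weak_partial j w)) UNIV" if "w \<in> Hk_per 1" for w
    using V_norm_power2[OF that] V_norm_ge0[OF that] by (metis L2_set_def real_sqrt_unique)
  have "L2_norm (weak_partial j (\<lambda>x. u x - v x)) \<le> L2_norm (weak_partial j u) + L2_norm (weak_partial j v)" for j
  proof -
    note p = weak_partial_Hk_1(1)[OF u, of j] weak_partial_Hk_1(1)[OF v, of j] weak_partial_Hk_1(1)[OF d, of j]
    have "AE x in torus. weak_partial j (\<lambda>x. u x - v x) x = weak_partial j u x - weak_partial j v x"
      using u v d p
      by (intro field_eq_AE L2_per_diff)
         (auto simp: fcoeff_diff fcoeff_weak_partial_Hk_1 Hk_per_L2_per[OF u] Hk_per_L2_per[OF v] right_diff_distrib simp del: Hk_per.simps)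
    from L2_norm_cong_AE[OF p(3) L2_per_diff[OF p(1,2)] this] L2_norm_triangle_diff[OF p(1,2)]
    show ?thesis by simp
  qed
  then have "V_norm (\<lambda>x. u x - v x) \<le> L2_set (\<lambda>j. L2_norm (weak_partial j u) + L2_norm (weak_partial j v)) UNIV"
    unfolding V[OF d] by (intro L2_set_mono) (auto simp: L2_norm_ge0)
  also have "\<dots> \<le> V_norm u + V_norm v" unfolding V[OF u] V[OF v] by (rule L2_set_triangle_ineq)
  finally show ?thesis .
qed

lemma freq2_ge_1:
  assumes "k \<noteq> 0" shows "1 \<le> freq2 k"
proof -
  obtain j where "k $ j \<noteq> 0" using assms by (auto simp: vec_eq_iff)
  then have "1 \<le> (k $ j)\<^sup>2" by (simp add: int_one_le_iff_zero_less)
  then have "(1::real) \<le> (of_int (k $ j))\<^sup>2" by (metis of_int_1_le_iff of_int_power)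
  also have "\<dots> \<le> freq2 k" unfolding freq2_def by (rule member_le_sum) auto
  finally show ?thesis .
qed

lemma freq2_ge_0: "0 \<le> freq2 k"
  by (auto simp: freq2_def intro: sum_nonneg)

text \<open>Mean zero removes k = 0, and integer frequencies have |k|^2 \<ge> 1 otherwise. The
  constant 1 is what makes the Dirichlet quotient at least 1.\<close>

lemma Poincare:
  assumes u: "u \<in> V_space"
  shows "L2_norm u \<le> V_norm u"
proof (rule power2_le_imp_le[OF _ V_norm_ge0[OF V_spaceD(1)[OF u]]])
  show "(L2_norm u)\<^sup>2 \<le> (V_norm u)\<^sup>2"
  proof (rule LIMSEQ_le[OF field_norm_Parseval[OF V_spaceD(3)[OF u]] V_norm_Parseval[OF V_spaceD(1)[OF u]]], intro exI allI impI sum_mono)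
    fix k
    show "(\<Sum>i\<in>UNIV. (norm (fcoeff u i k))\<^sup>2) \<le> freq2 k * (\<Sum>i\<in>UNIV. (norm (fcoeff u i k))\<^sup>2)"
    proof (cases "k = 0")
      case True
      then show ?thesis using V_spaceD(2)[OF u] by (simp add: H_space_iff)
    next
      case False
      then show ?thesis using mult_right_mono[OF freq2_ge_1[OF False], of "\<Sum>i\<in>UNIV. (norm (fcoeff u i k))\<^sup>2"]
        by (simp add: sum_nonneg)
    qed
  qed
qed

lemma V_norm_eq_stokes:
  assumes u: "u \<in> stokes_domain"
  shows "L2_inner u (stokes u) = (V_norm u)\<^sup>2"
proof -
  have "(\<lambda>N. \<Sum>k\<in>fbox N. \<Sum>i\<in>UNIV. Re (fcoeff u i k * cnj (fcoeff (stokes u) i k))) \<longlonglongrightarrow> L2_inner u (stokes u)"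
    by (rule field_Parseval[OF stokes_domainD(5)[OF u] stokes_L2_per[OF u]])
  moreover have "(\<Sum>i\<in>UNIV. Re (fcoeff u i k * cnj (fcoeff (stokes u) i k))) = freq2 k * (\<Sum>i\<in>UNIV. (norm (fcoeff u i k))\<^sup>2)" for k
    by (simp add: fcoeff_stokes[OF u] sum_distrib_left)
       (intro sum.cong refl, simp add: cmod_power2, simp add: algebra_simps power2_eq_square)
  ultimately show ?thesis using V_norm_Parseval[OF stokes_domainD(2)[OF u]] by (intro LIMSEQ_unique) auto
qed

section \<open>Sobolev estimates\<close>

text \<open>The value 0 at the origin matches the mean-zero condition: the coefficients that are
  weighted in this way vanish there.\<close>

definition inv_freq :: "int^2 \<Rightarrow> real" where
  "inv_freq k = (if k = 0 then 0 else 1 / freq2 k)"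

lemma inv_freq_ge_0: "0 \<le> inv_freq k"
  by (simp add: inv_freq_def freq2_ge_0)

text \<open>For m \<ge> 1 the term 1 / (1 + m^2) is at most the telescoping difference 2 / m - 2 /
  (m + 1). The subtracted remainder is what carries the induction.\<close>

lemma sum_inverse_square_bound: "(\<Sum>n\<le>N. 1 / (1 + (real n)\<^sup>2)) \<le> 3 - 2 / (real N + 1)"
proof (induction N)
  case (Suc N)
  define m where "m = real N + 1"
  have m: "m \<ge> 1" by (simp add: m_def)
  have "1 / (1 + m\<^sup>2) \<le> 2 / (m * (m + 1))"
  proof -
    have "m * 1 \<le> m * m" using m by (intro mult_left_mono) auto
    then have "m * (m + 1) \<le> 2 * (1 + m\<^sup>2)" by (simp add: power2_eq_square algebra_simps)
    moreover have "0 < m * (m + 1)" "0 < 1 + m\<^sup>2" using m by (auto intro: add_pos_nonneg)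
    ultimately show ?thesis by (subst frac_le_eq) (auto simp: divide_le_0_iff)
  qed
  also have "\<dots> = 2 / m - 2 / (m + 1)" using m by (simp add: field_simps)
  finally have "1 / (1 + m\<^sup>2) \<le> 2 / m - 2 / (m + 1)" .
  then show ?case using Suc by (simp add: m_def add.commute)
qed simp

text \<open>In dimension two |k|^-4 is dominated by a product of summable one-dimensional terms.
  With a, b the squared components, (1 + a)(1 + b) = 1 + (a + b) + a b, and for a + b \<ge> 1 this
  is at most (1 + 1 + 1/4)(a + b)^2, whence the factor 9/4.\<close>

lemma sum_inv_freq:
  obtains C where "0 < C" "\<And>S. finite S \<Longrightarrow> (\<Sum>k\<in>S. (inv_freq k)\<^sup>2) \<le> C"
proof -
  define h where "h n = 1 / (1 + (real_of_int n)\<^sup>2)" for n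
  have h0: "0 \<le> h n" for n by (simp add: h_def)
  have bound: "(inv_freq k)\<^sup>2 \<le> 9/4 * (h (k $ 1) * h (k $ 2))" for k
  proof (cases "k = 0")
    case False
    define a b where "a = (real_of_int (k $ 1))\<^sup>2" and "b = (real_of_int (k $ 2))\<^sup>2"
    have f: "freq2 k = a + b" by (simp add: freq2_def UNIV_2 a_def b_def)
    have s: "a + b \<ge> 1" using freq2_ge_1[OF False] f by simp
    have ab: "a \<ge> 0" "b \<ge> 0" by (auto simp: a_def b_def)
    have "4 * (a * b) \<le> (a + b)\<^sup>2" using zero_le_power2[of "a - b"] by (simp add: power2_eq_square algebra_simps)
    moreover have "a + b \<le> (a + b)\<^sup>2" using s by (simp add: power2_eq_square)
    moreover have "1 \<le> (a + b)\<^sup>2" using s by (simp add: one_le_power)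
    ultimately have *: "(1 + a) * (1 + b) \<le> 9/4 * (a + b)\<^sup>2" by (simp add: algebra_simps)
    have "0 < (1 + a) * (1 + b)" "0 < (a + b)\<^sup>2" using ab s by (auto intro!: mult_pos_pos)
    then have "1 / (a + b)\<^sup>2 \<le> 9/4 * (1 / ((1 + a) * (1 + b)))"
      using * by (simp add: divide_simps mult.commute)
    then show ?thesis using False by (simp add: inv_freq_def f h_def a_def b_def power_divide)
  qed (use h0 in \<open>simp add: inv_freq_def\<close>)
  have hsum: "(\<Sum>n\<in>{-int N..int N}. h n) \<le> 6" for N
  proof -
    have "{-int N..int N} \<subseteq> int ` {..N} \<union> (\<lambda>n. - int n) ` {..N}"
    proof
      fix n assume "n \<in> {-int N..int N}"
      then show "n \<in> int ` {..N} \<union> (\<lambda>n. - int n) ` {..N}"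
        by (cases n rule: int_cases2) auto
    qed
    then have "(\<Sum>n\<in>{-int N..int N}. h n) \<le> (\<Sum>n\<in>int ` {..N} \<union> (\<lambda>n. - int n) ` {..N}. h n)"
      by (intro sum_mono2) (auto simp: h0)
    also have "\<dots> \<le> (\<Sum>n\<in>int ` {..N}. h n) + (\<Sum>n\<in>(\<lambda>n. - int n) ` {..N}. h n)"
      by (subst sum.union_inter[symmetric]) (auto intro!: sum_nonneg h0)
    also have "\<dots> = (\<Sum>n\<le>N. 1 / (1 + (real n)\<^sup>2)) + (\<Sum>n\<le>N. 1 / (1 + (real n)\<^sup>2))"
      by (simp add: sum.reindex inj_on_def h_def)
    also have "\<dots> \<le> 6"
    proof -
      have "0 \<le> 2 / (real N + 1)" by simp
      then show ?thesis using sum_inverse_square_bound[of N] by linarith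
    qed
    finally show ?thesis .
  qed
  show thesis
  proof
    \<comment> \<open>81 is 9/4 times 6 times 6, where 6 bounds each one-dimensional sum: 3 for each
      sign.\<close>
    show "0 < (81::real)" by simp
    fix S :: "(int^2) set" assume "finite S"
    then obtain N where N: "S \<subseteq> fbox N" by (rule finite_subset_fbox)
    define \<pi> where "\<pi> k = (k $ 1, k $ 2)" for k :: "int^2"
    have inj: "inj_on \<pi> (fbox N)" by (auto simp: inj_on_def \<pi>_def vec_eq_iff forall_2)
    have prod_sum: "(\<Sum>p\<in>T \<times> T. h (fst p) * h (snd p)) = (\<Sum>n\<in>T. h n) * (\<Sum>n\<in>T. h n)" for T
      by (simp add: sum_product sum.cartesian_product case_prod_unfold)
    have "(\<Sum>k\<in>S. (inv_freq k)\<^sup>2) \<le> (\<Sum>k\<in>fbox N. (inv_freq k)\<^sup>2)"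
      by (rule sum_mono2[OF _ N]) auto
    also have "\<dots> \<le> (\<Sum>k\<in>fbox N. 9/4 * (h (fst (\<pi> k)) * h (snd (\<pi> k))))"
      by (intro sum_mono) (simp only: \<pi>_def fst_conv snd_conv bound)
    also have "\<dots> = (\<Sum>p\<in>\<pi> ` fbox N. 9/4 * (h (fst p) * h (snd p)))"
      by (simp add: sum.reindex[OF inj])
    also have "\<dots> \<le> (\<Sum>p\<in>{-int N..int N} \<times> {-int N..int N}. 9/4 * (h (fst p) * h (snd p)))"
      by (intro sum_mono2) (auto simp: h0 \<pi>_def fbox_def abs_le_iff minus_le_iff)
    also have "\<dots> = 9/4 * ((\<Sum>n\<in>{-int N..int N}. h n) * (\<Sum>n\<in>{-int N..int N}. h n))"
      by (simp only: sum_distrib_left[symmetric] prod_sum)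
    also have "\<dots> \<le> 9/4 * (6 * 6)"
      using hsum[of N] h0 by (intro mult_left_mono mult_mono) (auto intro: sum_nonneg)
    finally show "(\<Sum>k\<in>S. (inv_freq k)\<^sup>2) \<le> 81" by simp
  qed
qed

text \<open>A bound for the l^2 norm of \<open>inv_freq\<close> over finite sets, hence the square
  in the condition. It is a pure number and may enter the final constants.\<close>

definition sobolev_const :: real where
  "sobolev_const = (SOME C. 0 < C \<and> (\<forall>S. finite S \<longrightarrow> (\<Sum>k\<in>S. (inv_freq k)\<^sup>2) \<le> C\<^sup>2))"

lemma sobolev_const: "0 < sobolev_const" "finite S \<Longrightarrow> (\<Sum>k\<in>S. (inv_freq k)\<^sup>2) \<le> sobolev_const\<^sup>2"
proof -
  obtain C where C: "0 < C" "\<And>S. finite S \<Longrightarrow> (\<Sum>k\<in>S. (inv_freq k)\<^sup>2) \<le> C"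
    using sum_inv_freq by blast
  then have "0 < sqrt C \<and> (\<forall>S. finite S \<longrightarrow> (\<Sum>k\<in>S. (inv_freq k)\<^sup>2) \<le> (sqrt C)\<^sup>2)" by simp
  then have "0 < sobolev_const \<and> (\<forall>S. finite S \<longrightarrow> (\<Sum>k\<in>S. (inv_freq k)\<^sup>2) \<le> sobolev_const\<^sup>2)"
    unfolding sobolev_const_def by (rule someI)
  then show "0 < sobolev_const" "finite S \<Longrightarrow> (\<Sum>k\<in>S. (inv_freq k)\<^sup>2) \<le> sobolev_const\<^sup>2" by auto
qed

text \<open>The embedding of H^2 into the bounded functions: Cauchy-Schwarz with the weights |k|^2
  and |k|^-2. The factor 1 / (2 \<pi>) is estimated by 1.\<close>

lemma trig_sum_sup_bound:
  assumes S: "finite S" and a0: "a 0 = 0" and A: "(\<Sum>k\<in>S. (freq2 k * norm (a k))\<^sup>2) \<le> A\<^sup>2" "0 \<le> A"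
  shows "norm (trig_sum S a x) \<le> sobolev_const * A"
proof -
  have "norm (trig_sum S a x) \<le> (\<Sum>k\<in>S. \<bar>freq2 k * norm (a k)\<bar> * \<bar>inv_freq k\<bar>)"
    unfolding trig_sum_def
  proof (rule sum_norm_le)
    fix k
    have "norm (a k * (wave k x / (2 * pi))) \<le> norm (a k)"
      using pi_ge_two by (simp add: norm_mult norm_divide divide_le_eq mult_le_cancel_left1)
    also have "\<dots> = \<bar>freq2 k * norm (a k)\<bar> * \<bar>inv_freq k\<bar>"
      using a0 freq2_ge_1[of k] by (auto simp: inv_freq_def)
    finally show "norm (a k * (wave k x / (2 * pi))) \<le> \<bar>freq2 k * norm (a k)\<bar> * \<bar>inv_freq k\<bar>" .
  qed
  also have "\<dots> \<le> L2_set (\<lambda>k. freq2 k * norm (a k)) S * L2_set inv_freq S"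
    by (rule L2_set_mult_ineq)
  also have "\<dots> \<le> A * sobolev_const"
    unfolding L2_set_def
    using A sobolev_const S by (intro mult_mono real_le_lsqrt) (simp_all add: sum_nonneg less_imp_le)
  finally show ?thesis by (simp add: mult.commute)
qed

text \<open>The product of two trigonometric polynomials is a convolution on the Fourier side.  By
  Cauchy--Schwarz with the weight \<open>|k|\<^sup>2 |m - k|\<^sup>2\<close> its \<open>\<ell>\<^sup>2\<close> norm is bounded by the \<open>H\<^sup>1\<close> norms of the
  factors, since \<open>\<Sum>\<^sub>k |k|\<^sup>-\<^sup>2 |m - k|\<^sup>-\<^sup>2\<close> is at most \<open>\<Sum>\<^sub>k |k|\<^sup>-\<^sup>4\<close> for every \<open>m\<close>.\<close>

lemma trig_sum_mult_bound:
  assumes S: "finite S" and a0: "a 0 = 0" and b0: "b 0 = 0"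
    and A: "(\<Sum>k\<in>S. freq2 k * (norm (a k))\<^sup>2) \<le> A\<^sup>2" "0 \<le> A"
    and B: "(\<Sum>k\<in>S. freq2 k * (norm (b k))\<^sup>2) \<le> B\<^sup>2" "0 \<le> B"
  shows "L2_norm (\<lambda>x. trig_sum S a x * trig_sum S b x) \<le> sobolev_const * A * B"
proof -
  define M where "M = (\<lambda>p. fst p + snd p) ` (S \<times> S)"
  define P where "P m = {p \<in> S \<times> S. fst p + snd p = m}" for m
  define c where "c m = (\<Sum>p\<in>P m. a (fst p) * b (snd p)) / (2 * pi)" for m
  have finM: "finite M" and finP: "finite (P m)" for m using S by (auto simp: M_def P_def)
  have eq: "trig_sum S a x * trig_sum S b x = trig_sum M c x" for x
  proof -
    have "trig_sum S a x * trig_sum S b x =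
        (\<Sum>p\<in>S \<times> S. (a (fst p) * b (snd p)) * (wave (fst p + snd p) x / (2 * pi)) / (2 * pi))"
      by (simp add: trig_sum_def sum_product sum.cartesian_product case_prod_unfold wave_add mult_ac)
    also have "\<dots> = (\<Sum>m\<in>M. \<Sum>p\<in>P m. (a (fst p) * b (snd p)) * (wave (fst p + snd p) x / (2 * pi)) / (2 * pi))"
      unfolding P_def using S finM by (intro sum.group[symmetric]) (auto simp: M_def)
    also have "\<dots> = trig_sum M c x"
      unfolding trig_sum_def
    proof (rule sum.cong[OF refl])
      fix m
      define w where "w = wave m x / (2 * pi)"
      have "(\<Sum>p\<in>P m. (a (fst p) * b (snd p)) * (wave (fst p + snd p) x / (2 * pi)) / (2 * pi)) = (\<Sum>p\<in>P m. (a (fst p) * b (snd p)) * w / (2 * pi))"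
        by (rule sum.cong[OF refl]) (auto simp: P_def w_def)
      also have "\<dots> = c m * w" by (simp add: c_def sum_distrib_right sum_divide_distrib)
      finally show "(\<Sum>p\<in>P m. (a (fst p) * b (snd p)) * (wave (fst p + snd p) x / (2 * pi)) / (2 * pi)) = c m * (wave m x / (2 * pi))"
        by (simp only: w_def)
    qed
    finally show ?thesis .
  qed
  let ?u = "\<lambda>p. sqrt (freq2 (fst p) * freq2 (snd p)) * (norm (a (fst p)) * norm (b (snd p)))"
  let ?v = "\<lambda>p. sqrt (inv_freq (fst p) * inv_freq (snd p))"
  have v: "(\<Sum>p\<in>P m. (?v p)\<^sup>2) \<le> sobolev_const\<^sup>2" for m
  proof -
    have "(\<Sum>p\<in>P m. (?v p)\<^sup>2) \<le> (\<Sum>p\<in>P m. ((inv_freq (fst p))\<^sup>2 + (inv_freq (snd p))\<^sup>2) / 2)"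
    proof (rule sum_mono)
      fix p
      have "(?v p)\<^sup>2 = inv_freq (fst p) * inv_freq (snd p)" by (simp add: inv_freq_ge_0)
      also have "\<dots> \<le> ((inv_freq (fst p))\<^sup>2 + (inv_freq (snd p))\<^sup>2) / 2"
        using sum_squares_bound[of "inv_freq (fst p)" "inv_freq (snd p)"] by (simp add: field_simps)
      finally show "(?v p)\<^sup>2 \<le> ((inv_freq (fst p))\<^sup>2 + (inv_freq (snd p))\<^sup>2) / 2" .
    qed
    also have "\<dots> = ((\<Sum>p\<in>P m. (inv_freq (fst p))\<^sup>2) + (\<Sum>p\<in>P m. (inv_freq (snd p))\<^sup>2)) / 2"
      by (simp add: sum.distrib sum_divide_distrib[symmetric])
    \<comment> \<open>On \<open>P m\<close> either component of a pair determines the other, so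
      every frequency occurs at most once and the sum over the fibre is a part of the sum of
      |k|^-4.\<close>
    also have "(\<Sum>p\<in>P m. (inv_freq (fst p))\<^sup>2) = (\<Sum>k\<in>fst ` P m. (inv_freq k)\<^sup>2)"
      by (subst sum.reindex) (auto simp: inj_on_def P_def)
    also have "(\<Sum>p\<in>P m. (inv_freq (snd p))\<^sup>2) = (\<Sum>k\<in>snd ` P m. (inv_freq k)\<^sup>2)"
      by (subst sum.reindex) (auto simp: inj_on_def P_def)
    also have "((\<Sum>k\<in>fst ` P m. (inv_freq k)\<^sup>2) + (\<Sum>k\<in>snd ` P m. (inv_freq k)\<^sup>2)) / 2 \<le> (sobolev_const\<^sup>2 + sobolev_const\<^sup>2) / 2"
      using finP by (intro divide_right_mono add_mono sobolev_const) auto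
    finally show ?thesis by simp
  qed
  have c: "(norm (c m))\<^sup>2 \<le> sobolev_const\<^sup>2 * (\<Sum>p\<in>P m. (?u p)\<^sup>2)" for m
  proof -
    have "norm (c m) \<le> norm (\<Sum>p\<in>P m. a (fst p) * b (snd p))"
      using pi_ge_two by (simp add: c_def norm_divide divide_le_eq mult_le_cancel_left1)
    also have "\<dots> \<le> (\<Sum>p\<in>P m. \<bar>?u p\<bar> * \<bar>?v p\<bar>)"
    proof (rule sum_norm_le)
      fix p
      show "norm (a (fst p) * b (snd p)) \<le> \<bar>?u p\<bar> * \<bar>?v p\<bar>"
      proof (cases "fst p = 0 \<or> snd p = 0")
        case True
        then show ?thesis using a0 b0 by (auto simp: inv_freq_def)
      next
        case False
        then have "freq2 (fst p) > 0" "freq2 (snd p) > 0"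
          using freq2_ge_1[of "fst p"] freq2_ge_1[of "snd p"] by auto
        then have one: "sqrt (freq2 (fst p) * freq2 (snd p)) * ?v p = 1"
          using False by (simp add: inv_freq_def real_sqrt_mult[symmetric])
        have "?u p * ?v p = (sqrt (freq2 (fst p) * freq2 (snd p)) * ?v p) * (norm (a (fst p)) * norm (b (snd p)))"
          by (simp only: mult_ac)
        then have "?u p * ?v p = norm (a (fst p)) * norm (b (snd p))" unfolding one by simp
        moreover have "0 \<le> ?u p" "0 \<le> ?v p" by (auto simp: freq2_ge_0 inv_freq_ge_0)
        ultimately show ?thesis by (simp only: norm_mult abs_of_nonneg order_refl)
      qed
    qed
    also have "\<dots> \<le> L2_set ?u (P m) * L2_set ?v (P m)" by (rule L2_set_mult_ineq)
    finally have "(norm (c m))\<^sup>2 \<le> (L2_set ?u (P m) * L2_set ?v (P m))\<^sup>2" by (intro power_mono) auto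
    also have "\<dots> = (\<Sum>p\<in>P m. (?u p)\<^sup>2) * (\<Sum>p\<in>P m. (?v p)\<^sup>2)"
      by (simp add: power_mult_distrib L2_set_def sum_nonneg)
    also have "\<dots> \<le> (\<Sum>p\<in>P m. (?u p)\<^sup>2) * sobolev_const\<^sup>2"
      by (intro mult_left_mono v sum_nonneg) auto
    finally show ?thesis by (simp add: mult.commute)
  qed
  have "(L2_norm (\<lambda>x. trig_sum S a x * trig_sum S b x))\<^sup>2 = (\<Sum>m\<in>M. (norm (c m))\<^sup>2)"
    using L2_norm_trig_sum[OF finM, of c] by (simp add: eq)
  also have "\<dots> \<le> (\<Sum>m\<in>M. sobolev_const\<^sup>2 * (\<Sum>p\<in>P m. (?u p)\<^sup>2))" by (intro sum_mono c)
  also have "\<dots> = sobolev_const\<^sup>2 * (\<Sum>m\<in>M. \<Sum>p\<in>P m. (?u p)\<^sup>2)" by (simp add: sum_distrib_left)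
  \<comment> \<open>The fibres exhaust S \<times> S, and over the full product set the double sum
    factors into the two H^1 sums.\<close>
  also have "(\<Sum>m\<in>M. \<Sum>p\<in>P m. (?u p)\<^sup>2) = (\<Sum>p\<in>S \<times> S. (?u p)\<^sup>2)"
    unfolding P_def using S finM by (intro sum.group) (auto simp: M_def)
  also have "\<dots> = (\<Sum>k\<in>S. freq2 k * (norm (a k))\<^sup>2) * (\<Sum>k\<in>S. freq2 k * (norm (b k))\<^sup>2)"
    by (simp add: sum_product sum.cartesian_product case_prod_unfold power_mult_distrib freq2_ge_0 mult_ac)
  also have "sobolev_const\<^sup>2 * \<dots> \<le> sobolev_const\<^sup>2 * (A\<^sup>2 * B\<^sup>2)"
    using A B by (intro mult_left_mono mult_mono) (auto intro!: sum_nonneg mult_nonneg_nonneg freq2_ge_0)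
  also have "\<dots> = (sobolev_const * A * B)\<^sup>2" by (simp add: power_mult_distrib)
  finally show ?thesis
    by (rule power2_le_imp_le) (use A B sobolev_const(1) in auto)
qed

text \<open>Partial sums converge almost everywhere along a common subsequence, and Fatou's lemma
  gives both membership and estimate for the product. This stands in for the embedding of H^1 into
  L^4.\<close>

lemma L2_mult_bound:
  assumes f: "f \<in> L2_per" and g: "g \<in> L2_per" and f0: "fourier f 0 = 0" and g0: "fourier g 0 = 0"
    and A: "\<And>N. (\<Sum>k\<in>fbox N. freq2 k * (norm (fourier f k))\<^sup>2) \<le> A\<^sup>2" "0 \<le> A"
    and B: "\<And>N. (\<Sum>k\<in>fbox N. freq2 k * (norm (fourier g k))\<^sup>2) \<le> B\<^sup>2" "0 \<le> B"
  shows "(\<lambda>x. f x * g x) \<in> L2_per \<and> L2_norm (\<lambda>x. f x * g x) \<le> sobolev_const * A * B"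
proof -
  obtain r where r: "strict_mono r"
    "AE x in torus. (\<lambda>n. fpart (r n) f x) \<longlonglongrightarrow> f x \<and> (\<lambda>n. fpart (r n) g x) \<longlonglongrightarrow> g x"
    using L2_converge_subseq_AE[OF trig_sum_L2_per f fpart_tendsto[OF f] trig_sum_L2_per g fpart_tendsto[OF g]] by blast
  show ?thesis
  proof (rule L2_norm_limit_bound[where f="\<lambda>n x. fpart (r n) f x * fpart (r n) g x"])
    show "(\<lambda>x. fpart (r n) f x * fpart (r n) g x) \<in> L2_per" for n
      using trig_L2_per[OF trig_mult[OF trig_trig_sum trig_trig_sum]] by blast
    show "(\<lambda>x. f x * g x) \<in> borel_measurable torus"
      using L2_per_integrable_mult[OF f g] by auto
    show "periodic (\<lambda>x. f x * g x)" using f g by (simp add: L2_per_def periodic_def)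
    show "AE x in torus. (\<lambda>n. fpart (r n) f x * fpart (r n) g x) \<longlonglongrightarrow> f x * g x"
      using r(2) by eventually_elim (auto intro: tendsto_mult)
    show "eventually (\<lambda>n. L2_norm (\<lambda>x. fpart (r n) f x * fpart (r n) g x) \<le> sobolev_const * A * B) sequentially"
      by (intro always_eventually allI trig_sum_mult_bound A B finite_fbox f0 g0)
  qed
qed

text \<open>\<open>L\<close> plays the role of the Laplacian of f or of the Stokes operator applied
  to it; prescribing only the moduli of its coefficients covers both signs.\<close>

lemma sup_bound:
  assumes f: "f \<in> L2_per" and L: "L \<in> L2_per" and f0: "fourier f 0 = 0"
    and Lf: "\<And>k. norm (fourier L k) = freq2 k * norm (fourier f k)"
  shows "AE x in torus. norm (f x) \<le> sobolev_const * L2_norm L"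
proof -
  obtain r where r: "strict_mono r"
    "AE x in torus. (\<lambda>n. fpart (r n) f x) \<longlonglongrightarrow> f x \<and> (\<lambda>n. fpart (r n) f x) \<longlonglongrightarrow> f x"
    using L2_converge_subseq_AE[OF trig_sum_L2_per f fpart_tendsto[OF f] trig_sum_L2_per f fpart_tendsto[OF f]] by blast
  have "norm (fpart N f x) \<le> sobolev_const * L2_norm L" for N x
    using Bessel[OF L finite_fbox[of N]] unfolding Lf
    by (intro trig_sum_sup_bound f0 finite_fbox L2_norm_ge0)
  then show ?thesis using r(2)
    by (auto elim!: eventually_mono intro!: LIMSEQ_le_const2[OF tendsto_norm])
qed

lemma L2_norm_mono_AE:
  fixes w :: "real^2 \<Rightarrow> 'a::euclidean_space" and g :: "real^2 \<Rightarrow> 'b::euclidean_space"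
  assumes w: "w \<in> L2_per" and g: "g \<in> L2_per" and le: "AE x in torus. norm (w x) \<le> c * norm (g x)" and c: "0 \<le> c"
  shows "L2_norm w \<le> c * L2_norm g"
proof (rule power2_le_imp_le)
  have "(L2_norm w)\<^sup>2 \<le> (\<integral>x. c\<^sup>2 * (norm (g x))\<^sup>2 \<partial>torus)"
    unfolding L2_norm_power2_integral
  proof (rule integral_mono_AE)
    show "AE x in torus. (norm (w x))\<^sup>2 \<le> c\<^sup>2 * (norm (g x))\<^sup>2"
      using le by eventually_elim (metis norm_ge_zero power_mono power_mult_distrib)
  qed (use w g in \<open>auto intro: L2_per_integrable_norm2\<close>)
  also have "\<dots> = (c * L2_norm g)\<^sup>2" by (simp add: power_mult_distrib L2_norm_power2_integral)
  finally show "(L2_norm w)\<^sup>2 \<le> (c * L2_norm g)\<^sup>2" .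
qed (use c in \<open>simp add: L2_norm_ge0\<close>)

lemma L2_mult_sup_bound:
  fixes f g :: "real^2 \<Rightarrow> complex"
  assumes f: "f \<in> L2_per" and g: "g \<in> L2_per" and le: "AE x in torus. norm (f x) \<le> c" and c: "0 \<le> c"
  shows "(\<lambda>x. f x * g x) \<in> L2_per \<and> L2_norm (\<lambda>x. f x * g x) \<le> c * L2_norm g"
proof -
  have ae: "AE x in torus. norm (f x * g x) \<le> c * norm (g x)"
    using le by eventually_elim (simp add: norm_mult mult_right_mono)
  have "(\<lambda>x. f x * g x) \<in> L2_per"
    using f g L2_per_integrable_mult[OF f g]
    by (intro L2_perI_bound[OF _ _ g ae]) (auto simp: L2_per_def periodic_def)
  then show ?thesis using L2_norm_mono_AE[OF _ g ae c] by simp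
qed

subsection \<open>The convective term\<close>

lemma field_L2_norm_components:
  fixes u :: field2
  assumes u: "\<And>j. (\<lambda>x. complex_of_real (u x $ j)) \<in> L2_per"
    and D: "\<And>j. L2_norm (\<lambda>x. complex_of_real (u x $ j)) \<le> D"
  shows "u \<in> L2_per \<and> L2_norm u \<le> 2 * D"
proof -
  have c: "(\<lambda>x. u x $ j) \<in> L2_per" for j
  proof -
    have "(\<lambda>x. Re (complex_of_real (u x $ j))) \<in> borel_measurable torus"
      using L2_per_measurable[OF u[of j]] by measurable
    then have m: "(\<lambda>x. u x $ j) \<in> borel_measurable torus" by simp
    have "periodic (\<lambda>x. u x $ j)" using L2_per_periodic[OF u[of j]] by (simp add: periodic_def)
    then show ?thesis using L2_perI_bound[OF _ m u[of j], of 1] by simp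
  qed
  have axL: "(\<lambda>x. u x $ j *\<^sub>R axis j (1::real)) \<in> (L2_per :: field2 set)" for j
    by (rule L2_perI_bound[OF _ _ c[of j], of _ 1])
       (use c[of j] in \<open>auto simp: L2_per_def periodic_def intro!: borel_measurable_scaleR\<close>)
  have eq: "u = (\<lambda>x. \<Sum>j\<in>UNIV. u x $ j *\<^sub>R axis j 1)"
    by (auto simp: fun_eq_iff vec_eq_iff axis_def if_distrib[of "\<lambda>x. _ * x"] cong: if_cong)
  have uL: "u \<in> L2_per" by (subst eq) (intro L2_per_sum axL)
  have D0: "0 \<le> D" using D[of 1] L2_norm_ge0 order_trans by blast
  have "(L2_norm u)\<^sup>2 = (\<Sum>j\<in>UNIV. (L2_norm (\<lambda>x. complex_of_real (u x $ j)))\<^sup>2)"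
    by (simp add: L2_norm_power2 L2_inner_components[OF uL uL])
  also have "\<dots> \<le> (\<Sum>j\<in>(UNIV::2 set). D\<^sup>2)" by (intro sum_mono power_mono D L2_norm_ge0)
  also have "\<dots> \<le> (2 * D)\<^sup>2" by simp
  finally show ?thesis using uL D0 by (auto intro: power2_le_imp_le)
qed

lemma convection_bound:
  assumes L: "\<And>i j. (\<lambda>x. complex_of_real (u x $ i) * complex_of_real (weak_partial i v x $ j)) \<in> L2_per"
    and D: "\<And>i j. L2_norm (\<lambda>x. complex_of_real (u x $ i) * complex_of_real (weak_partial i v x $ j)) \<le> D"
  shows "convection u v \<in> L2_per \<and> L2_norm (convection u v) \<le> 4 * D"
proof -
  have eq: "complex_of_real (convection u v x $ j) =
      complex_of_real (u x $ 1) * complex_of_real (weak_partial 1 v x $ j) + complex_of_real (u x $ 2) * complex_of_real (weak_partial 2 v x $ j)" for x j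
    by (simp add: convection_def UNIV_2)
  have "convection u v \<in> L2_per \<and> L2_norm (convection u v) \<le> 2 * (D + D)"
  proof (rule field_L2_norm_components; unfold eq)
    fix j
    show "(\<lambda>x. complex_of_real (u x $ 1) * complex_of_real (weak_partial 1 v x $ j)
        + complex_of_real (u x $ 2) * complex_of_real (weak_partial 2 v x $ j)) \<in> L2_per"
      by (intro L2_per_add L)
    show "L2_norm (\<lambda>x. complex_of_real (u x $ 1) * complex_of_real (weak_partial 1 v x $ j)
        + complex_of_real (u x $ 2) * complex_of_real (weak_partial 2 v x $ j)) \<le> D + D"
      by (rule order_trans[OF L2_norm_triangle[OF L L] add_mono[OF D D]])
  qed
  then show ?thesis by simp
qed

lemma component_L2_norm_le:
  fixes u :: field2
  assumes "u \<in> L2_per"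
  shows "L2_norm (\<lambda>x. complex_of_real (u x $ j)) \<le> L2_norm u"
  using L2_norm_mono_AE[OF L2_per_component_of_real[OF assms, of j] assms, of 1]
  by (simp add: component_le_norm_cart)

lemma weak_partial_norm_le:
  assumes "u \<in> Hk_per 1"
  shows "L2_norm (weak_partial j u) \<le> V_norm u"
proof (rule power2_le_imp_le[OF _ V_norm_ge0[OF assms]])
  show "(L2_norm (weak_partial j u))\<^sup>2 \<le> (V_norm u)\<^sup>2"
    unfolding V_norm_power2[OF assms] by (rule member_le_sum) auto
qed

lemma component_enstrophy_le:
  assumes u: "u \<in> Hk_per 1"
  shows "(\<Sum>k\<in>fbox N. freq2 k * (norm (fcoeff u i k))\<^sup>2) \<le> (V_norm u)\<^sup>2"
proof -
  have "(\<Sum>k\<in>fbox N. freq2 k * (norm (fcoeff u i k))\<^sup>2) \<le> (\<Sum>k\<in>fbox N. freq2 k * (\<Sum>i\<in>UNIV. (norm (fcoeff u i k))\<^sup>2))"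
    by (intro sum_mono mult_left_mono freq2_ge_0) (rule member_le_sum, auto)
  also have "\<dots> \<le> (V_norm u)\<^sup>2"
  proof (rule incseq_le[OF _ V_norm_Parseval[OF u]])
    show "incseq (\<lambda>N. \<Sum>k\<in>fbox N. freq2 k * (\<Sum>i\<in>UNIV. (norm (fcoeff u i k))\<^sup>2))"
      using fbox_mono by (intro monoI sum_mono2) (auto intro!: mult_nonneg_nonneg freq2_ge_0 sum_nonneg)
  qed
  finally show ?thesis .
qed

lemma component_sup_bound:
  assumes u: "u \<in> stokes_domain"
  shows "AE x in torus. norm (complex_of_real (u x $ i)) \<le> sobolev_const * L2_norm (stokes u)"
proof -
  have "AE x in torus. norm (complex_of_real (u x $ i)) \<le> sobolev_const * L2_norm (\<lambda>x. complex_of_real (stokes u x $ i))"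
    using stokes_domainD(4)[OF u] stokes_domainD(5)[OF u] stokes_L2_per[OF u]
    by (intro sup_bound L2_per_component_of_real)
       (auto simp: fcoeff_def[symmetric] H_space_iff fcoeff_stokes[OF u] norm_mult freq2_ge_0)
  moreover have "sobolev_const * L2_norm (\<lambda>x. complex_of_real (stokes u x $ i)) \<le> sobolev_const * L2_norm (stokes u)"
    using sobolev_const(1) by (intro mult_left_mono component_L2_norm_le stokes_L2_per u) simp
  ultimately show ?thesis by (auto elim!: eventually_mono)
qed

text \<open>The transporting field has two derivatives and is bounded, so a square integrable
  gradient of v suffices.\<close>

lemma convection_bound_stokes_V:
  assumes u: "u \<in> stokes_domain" and v: "v \<in> Hk_per 1"
  shows "convection u v \<in> L2_per \<and> L2_norm (convection u v) \<le> 4 * (sobolev_const * L2_norm (stokes u) * V_norm v)"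
proof -
  note p = weak_partial_Hk_1(1)[OF v]
  let ?M = "sobolev_const * L2_norm (stokes u)"
  have M: "0 \<le> ?M" using sobolev_const(1) by (simp add: L2_norm_ge0)
  have *: "(\<lambda>x. complex_of_real (u x $ i) * complex_of_real (weak_partial i v x $ j)) \<in> L2_per \<and>
     L2_norm (\<lambda>x. complex_of_real (u x $ i) * complex_of_real (weak_partial i v x $ j)) \<le> ?M * L2_norm (\<lambda>x. complex_of_real (weak_partial i v x $ j))" for i j
    by (intro L2_mult_sup_bound L2_per_component_of_real p component_sup_bound M stokes_domainD(5) u)
  have "?M * L2_norm (\<lambda>x. complex_of_real (weak_partial i v x $ j)) \<le> ?M * V_norm v" for i j
    by (intro mult_left_mono M order_trans[OF component_L2_norm_le[OF p] weak_partial_norm_le[OF v]])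
  then show ?thesis using * by (intro convection_bound) (meson order_trans)+
qed

text \<open>The transporting field is only in H^1, but the gradient of v is in H^1 as well, so the
  product estimate applies. Together with \<open>convection_bound_stokes_V\<close>, the difference
  of two solutions can stand in either slot and be measured in V only.\<close>

lemma convection_bound_V_stokes:
  assumes u: "u \<in> V_space" and v: "v \<in> stokes_domain"
  shows "convection u v \<in> L2_per \<and> L2_norm (convection u v) \<le> 4 * (sobolev_const * V_norm u * L2_norm (stokes v))"
proof -
  note v1 = stokes_domainD(2)[OF v]
  note p = weak_partial_Hk_1(1)[OF v1]
  have *: "(\<lambda>x. complex_of_real (u x $ i) * complex_of_real (weak_partial i v x $ j)) \<in> L2_per \<and>
     L2_norm (\<lambda>x. complex_of_real (u x $ i) * complex_of_real (weak_partial i v x $ j)) \<le> sobolev_const * V_norm u * L2_norm (stokes v)" for i j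
  proof (rule L2_mult_bound)
    show "fourier (\<lambda>x. complex_of_real (u x $ i)) 0 = 0"
      using V_spaceD(2)[OF u] by (simp add: H_space_iff fcoeff_def)
    show "fourier (\<lambda>x. complex_of_real (weak_partial i v x $ j)) 0 = 0"
      using fcoeff_weak_partial_Hk_1[OF v1, of i j 0] by (simp add: fcoeff_def)
    show "(\<Sum>k\<in>fbox N. freq2 k * (norm (fourier (\<lambda>x. complex_of_real (u x $ i)) k))\<^sup>2) \<le> (V_norm u)\<^sup>2" for N
      using component_enstrophy_le[OF V_spaceD(1)[OF u]] by (simp add: fcoeff_def)
    show "(\<Sum>k\<in>fbox N. freq2 k * (norm (fourier (\<lambda>x. complex_of_real (weak_partial i v x $ j)) k))\<^sup>2) \<le> (L2_norm (stokes v))\<^sup>2" for N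
    proof -
      have "(\<Sum>k\<in>fbox N. freq2 k * (norm (fcoeff (weak_partial i v) j k))\<^sup>2) \<le> (\<Sum>k\<in>fbox N. (norm (fcoeff (stokes v) j k))\<^sup>2)"
      proof (rule sum_mono)
        fix k
        \<comment> \<open>The gradient measured in H^1 has the weight |k|^2 times the square of
          \<open>k $ i\<close>, which is at most the weight |k|^4 of the Stokes operator.\<close>
        have "(of_int (k $ i))\<^sup>2 \<le> freq2 k" unfolding freq2_def by (rule member_le_sum) auto
        then have "freq2 k * ((of_int (k $ i))\<^sup>2 * (norm (fcoeff v j k))\<^sup>2) \<le> freq2 k * (freq2 k * (norm (fcoeff v j k))\<^sup>2)"
          by (intro mult_left_mono mult_right_mono freq2_ge_0) auto
        then show "freq2 k * (norm (fcoeff (weak_partial i v) j k))\<^sup>2 \<le> (norm (fcoeff (stokes v) j k))\<^sup>2"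
          by (simp add: fcoeff_weak_partial_Hk_1[OF v1] fcoeff_stokes[OF v] norm_mult power_mult_distrib power2_eq_square[of "freq2 k"] mult.assoc)
      qed
      also have "\<dots> \<le> (L2_norm (\<lambda>x. complex_of_real (stokes v x $ j)))\<^sup>2"
        unfolding fcoeff_def by (intro Bessel L2_per_component_of_real stokes_L2_per v finite_fbox)
      also have "\<dots> \<le> (L2_norm (stokes v))\<^sup>2"
        by (intro power_mono component_L2_norm_le stokes_L2_per v L2_norm_ge0)
      finally show ?thesis by (simp add: fcoeff_def)
    qed
  qed (intro L2_per_component_of_real V_spaceD u p V_norm_ge0 L2_norm_ge0)+
  then show ?thesis by (intro convection_bound) blast+
qed

subsection \<open>Orthogonality of the convective term and the Stokes operator\<close>

text \<open>For a divergence-free \<open>p\<close> with vorticity \<open>\<omega> = \<partial>\<^sub>1p\<^sub>2 - \<partial>\<^sub>2p\<^sub>1\<close> one has \<open>\<Delta>p = (-\<partial>\<^sub>2\<omega>, \<partial>\<^sub>1\<omega>)\<close> and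
  \<open>curl ((p \<cdot> \<nabla>)p) = p \<cdot> \<nabla>\<omega>\<close>, so that \<open>(p \<cdot> \<nabla>)p \<cdot> \<Delta>p\<close> is the divergence of the field \<open>(X, Y)\<close> with
  \<open>X = \<omega>((p \<cdot> \<nabla>)p)\<^sub>2 - p\<^sub>1\<omega>\<^sup>2/2\<close> and \<open>Y = -\<omega>((p \<cdot> \<nabla>)p)\<^sub>1 - p\<^sub>2\<omega>\<^sup>2/2\<close>.\<close>

lemma trig_enstrophy_identity:
  assumes p1: "trig p1 d1" and p2: "trig p2 d2"
    and e11: "trig (d1 1) e11" and e12: "trig (d1 2) e12" and e21: "trig (d2 1) e21" and e22: "trig (d2 2) e22"
    and div: "\<And>x. d2 2 x = - d1 1 x" "\<And>j x. e22 j x = - e11 j x"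
    and symm: "\<And>x. e12 1 x = e11 2 x" "\<And>x. e22 1 x = e21 2 x"
  shows "(\<integral>x. (p1 x * d1 1 x + p2 x * d1 2 x) * (e11 1 x + e12 2 x)
            + (p1 x * d2 1 x + p2 x * d2 2 x) * (e21 1 x + e22 2 x) \<partial>torus) = 0"
proof -
  let ?m = "\<lambda>x. -1 * d1 2 x"
  have w: "trig (\<lambda>x. d2 1 x + ?m x) (\<lambda>j x. e21 j x + -1 * e12 j x)"
    by (intro trig_add trig_cmult e21 e12)
  \<comment> \<open>X and Y are assembled from the closure rules of \<open>trig\<close>, so that
    \<open>?X\<close> and \<open>?Y\<close> are literally the formal derivatives of X in direction 1
    and of Y in direction 2.\<close>
  note X = trig_add[OF trig_mult[OF w trig_add[OF trig_mult[OF p1 e21] trig_mult[OF p2 e22]]]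
      trig_cmult[OF trig_mult[OF p1 trig_mult[OF w w]], of "-1/2"]]
  note Y = trig_add[OF trig_cmult[OF trig_mult[OF w trig_add[OF trig_mult[OF p1 e11] trig_mult[OF p2 e12]]], of "-1"]
      trig_cmult[OF trig_mult[OF p2 trig_mult[OF w w]], of "-1/2"]]
  let ?X = "\<lambda>x. (e21 1 x + - 1 * e12 1 x) * (p1 x * d2 1 x + p2 x * d2 2 x) +
    (d2 1 x + - 1 * d1 2 x) * (d1 1 x * d2 1 x + p1 x * e21 1 x + (d2 1 x * d2 2 x + p2 x * e22 1 x)) +
    - 1 / 2 * (d1 1 x * ((d2 1 x + - 1 * d1 2 x) * (d2 1 x + - 1 * d1 2 x)) +
       p1 x * ((e21 1 x + - 1 * e12 1 x) * (d2 1 x + - 1 * d1 2 x) + (d2 1 x + - 1 * d1 2 x) * (e21 1 x + - 1 * e12 1 x)))"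
  let ?Y = "\<lambda>x. - 1 * ((e21 2 x + - 1 * e12 2 x) * (p1 x * d1 1 x + p2 x * d1 2 x) +
    (d2 1 x + - 1 * d1 2 x) * (d1 2 x * d1 1 x + p1 x * e11 2 x + (d2 2 x * d1 2 x + p2 x * e12 2 x))) +
    - 1 / 2 * (d2 2 x * ((d2 1 x + - 1 * d1 2 x) * (d2 1 x + - 1 * d1 2 x)) +
       p2 x * ((e21 2 x + - 1 * e12 2 x) * (d2 1 x + - 1 * d1 2 x) + (d2 1 x + - 1 * d1 2 x) * (e21 2 x + - 1 * e12 2 x)))"
  have X0: "integrable torus ?X" "(\<integral>x. ?X x \<partial>torus) = 0"
    using trig_L2_per[OF X, of 1] trig_integral_partial[OF X, of 1] by (simp_all only: L2_per_integrable)
  have Y0: "integrable torus ?Y" "(\<integral>x. ?Y x \<partial>torus) = 0"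
    using trig_L2_per[OF Y, of 2] trig_integral_partial[OF Y, of 2] by (simp_all only: L2_per_integrable)
  have "(p1 x * d1 1 x + p2 x * d1 2 x) * (e11 1 x + e12 2 x)
            + (p1 x * d2 1 x + p2 x * d2 2 x) * (e21 1 x + e22 2 x) = ?X x + ?Y x" for x
  proof -
    \<comment> \<open>Incompressibility and the symmetry of second derivatives eliminate all
      dependent derivatives; what remains is a polynomial identity.\<close>
    have r: "d2 2 x = - d1 1 x" "e22 1 x = - e11 1 x" "e22 2 x = - e11 2 x" "e12 1 x = e11 2 x" "e21 2 x = - e11 1 x"
      using div(1)[of x] div(2)[of 1 x] div(2)[of 2 x] symm[of x] by simp_all
    show ?thesis unfolding r by (simp add: field_simps)
  qed
  then show ?thesis using X0 Y0 by simp
qed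

lemma L2_inner_tendsto2:
  assumes f: "\<And>n. f n \<in> L2_per" "f0 \<in> L2_per" "(\<lambda>n. L2_norm (\<lambda>x. f n x - f0 x)) \<longlonglongrightarrow> 0"
    and g: "\<And>n. g n \<in> L2_per" "g0 \<in> L2_per" "(\<lambda>n. L2_norm (\<lambda>x. g n x - g0 x)) \<longlonglongrightarrow> 0"
  shows "(\<lambda>n. L2_inner (f n) (g n)) \<longlonglongrightarrow> L2_inner f0 g0"
proof -
  have "(\<lambda>n. L2_inner (f n) (\<lambda>x. g n x - g0 x)) \<longlonglongrightarrow> 0"
  proof (rule Lim_null_comparison[OF always_eventually], rule allI)
    fix n
    show "norm (L2_inner (f n) (\<lambda>x. g n x - g0 x)) \<le> L2_norm (f n) * L2_norm (\<lambda>x. g n x - g0 x)"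
      using L2_inner_Cauchy_Schwarz[OF f(1)[of n] L2_per_diff[OF g(1)[of n] g(2)]] by simp
    show "(\<lambda>n. L2_norm (f n) * L2_norm (\<lambda>x. g n x - g0 x)) \<longlonglongrightarrow> 0"
      using tendsto_mult[OF L2_norm_tendsto[OF f] g(3)] by simp
  qed
  from tendsto_add[OF this L2_inner_tendsto[OF f g(2)]] show ?thesis
    using f g by (simp add: L2_inner_diff_right)
qed

text \<open>Split as (f_n - f0) d_n + f0 (d_n - d0): uniform convergence of one factor to a bounded
  limit makes L^2 convergence of the other sufficient.\<close>

lemma L2_mult_tendsto:
  fixes f d :: "nat \<Rightarrow> real^2 \<Rightarrow> complex"
  assumes f: "\<And>n. f n \<in> L2_per" "f0 \<in> L2_per"
    and fn: "\<And>n. AE x in torus. norm (f n x - f0 x) \<le> \<epsilon> n" "\<epsilon> \<longlonglongrightarrow> 0" and f0: "AE x in torus. norm (f0 x) \<le> M"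
    and d: "\<And>n. d n \<in> L2_per" "d0 \<in> L2_per" "(\<lambda>n. L2_norm (\<lambda>x. d n x - d0 x)) \<longlonglongrightarrow> 0"
    and \<epsilon>: "\<And>n. 0 \<le> \<epsilon> n" and M: "0 \<le> M" and fd: "\<And>n. (\<lambda>x. f n x * d n x) \<in> L2_per"
  shows "(\<lambda>n. L2_norm (\<lambda>x. f n x * d n x - f0 x * d0 x)) \<longlonglongrightarrow> 0"
proof (rule tendsto_sandwich[OF always_eventually always_eventually tendsto_const])
  show "\<forall>n. L2_norm (\<lambda>x. f n x * d n x - f0 x * d0 x) \<le> \<epsilon> n * L2_norm (d n) + M * L2_norm (\<lambda>x. d n x - d0 x)"
  proof
    fix n
    have 1: "(\<lambda>x. (f n x - f0 x) * d n x) \<in> L2_per \<and> L2_norm (\<lambda>x. (f n x - f0 x) * d n x) \<le> \<epsilon> n * L2_norm (d n)"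
      by (intro L2_mult_sup_bound L2_per_diff f d fn \<epsilon>)
    have 2: "(\<lambda>x. f0 x * (d n x - d0 x)) \<in> L2_per \<and> L2_norm (\<lambda>x. f0 x * (d n x - d0 x)) \<le> M * L2_norm (\<lambda>x. d n x - d0 x)"
      by (intro L2_mult_sup_bound L2_per_diff f d f0 M)
    have "(\<lambda>x. f n x * d n x - f0 x * d0 x) = (\<lambda>x. (f n x - f0 x) * d n x + f0 x * (d n x - d0 x))"
      by (simp add: fun_eq_iff algebra_simps)
    then show "L2_norm (\<lambda>x. f n x * d n x - f0 x * d0 x) \<le> \<epsilon> n * L2_norm (d n) + M * L2_norm (\<lambda>x. d n x - d0 x)"
      using L2_norm_triangle[OF conjunct1[OF 1] conjunct1[OF 2]] 1 2 by auto
  qed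
  have "(\<lambda>n. \<epsilon> n * L2_norm (d n) + M * L2_norm (\<lambda>x. d n x - d0 x)) \<longlonglongrightarrow> 0 * L2_norm d0 + M * 0"
    by (intro tendsto_intros fn d L2_norm_tendsto)
  then show "(\<lambda>n. \<epsilon> n * L2_norm (d n) + M * L2_norm (\<lambda>x. d n x - d0 x)) \<longlonglongrightarrow> 0" by simp
qed (simp add: L2_norm_ge0)

text \<open>The identity is exact for every partial sum, because truncation in frequency commutes
  with derivatives and preserves incompressibility. In the limit the velocities converge uniformly,
  their supremum being controlled by the Laplacian, while gradients and Laplacians converge in
  L^2.\<close>

lemma convection_stokes_orth:
  assumes u: "u \<in> stokes_domain"
  shows "L2_inner (convection u u) (laplacian u) = 0"
proof -
  note u1 = stokes_domainD(2)[OF u] and u2 = stokes_domainD(1)[OF u] and uL = stokes_domainD(5)[OF u]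
  note lapL = laplacian_L2_per[OF u2] and wp = weak_partial_Hk_1(1)[OF u1]
  define U where "U i x = complex_of_real (u x $ i)" for i x
  define D where "D i j x = complex_of_real (weak_partial j u x $ i)" for i j x
  define L where "L i x = complex_of_real (laplacian u x $ i)" for i x
  define a where "a i k = fcoeff u i k" for i k
  have UL: "U i \<in> L2_per" for i unfolding U_def by (rule L2_per_component_of_real[OF uL])
  have DL: "D i j \<in> L2_per" for i j unfolding D_def by (rule L2_per_component_of_real[OF wp])
  have LL: "L i \<in> L2_per" for i unfolding L_def by (rule L2_per_component_of_real[OF lapL])
  have fU: "fourier (U i) = a i" for i by (simp add: fun_eq_iff U_def[abs_def] a_def fcoeff_def)
  have fD: "fourier (D i j) = (\<lambda>k. \<i> * of_int (k $ j) * a i k)" for i j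
    using fcoeff_weak_partial_Hk_1[OF u1] by (simp add: fun_eq_iff D_def[abs_def] a_def fcoeff_def)
  have fL: "fourier (L i) = (\<lambda>k. - freq2 k * a i k)" for i
    using fcoeff_laplacian[OF u2] by (simp add: fun_eq_iff L_def[abs_def] a_def fcoeff_def)
  have a0: "a i 0 = 0" for i using stokes_domainD(4)[OF u] by (simp add: H_space_iff a_def)
  have adiv: "of_int (k $ 2) * a 2 k = - (of_int (k $ 1) * a 1 k)" for k
    using stokes_domainD(4)[OF u] by (simp add: H_space_iff a_def UNIV_2 eq_neg_iff_add_eq_0 add.commute)
  define e where "e N i j l = trig_sum (fbox N) (\<lambda>k. \<i> * of_int (k $ l) * (\<i> * of_int (k $ j) * a i k))" for N i j l
  have tU: "trig (fpart N (U i)) (\<lambda>j. fpart N (D i j))" for N i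
    unfolding fU fD by (rule trig_trig_sum)
  have tD: "trig (fpart N (D i j)) (e N i j)" for N i j
    unfolding fD e_def by (rule trig_trig_sum)
  have div1: "fpart N (D 2 2) x = - fpart N (D 1 1) x" for N x
    unfolding fD trig_sum_def by (simp add: mult.assoc adiv sum_negf)
  have div2: "e N 2 2 j x = - e N 1 1 j x" for N j x
    unfolding e_def trig_sum_def by (simp add: mult.assoc adiv sum_negf)
  have symm: "e N i j l x = e N i l j x" for N i j l x
    unfolding e_def trig_sum_def by (simp add: mult_ac)
  have eL: "e N i 1 1 x + e N i 2 2 x = fpart N (L i) x" for N i x
    unfolding e_def trig_sum_def fL sum.distrib[symmetric]
  proof (rule sum.cong[OF refl])
    fix k
    have "\<i> * b * (\<i> * b * c) = - (b * b * c)" for b c :: complex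
    proof -
      have "\<i> * b * (\<i> * b * c) = (\<i> * \<i>) * (b * b * c)" by (simp only: mult_ac)
      then show ?thesis by simp
    qed
    then show "\<i> * of_int (k $ 1) * (\<i> * of_int (k $ 1) * a i k) * (wave k x / (2 * pi)) +
        \<i> * of_int (k $ 2) * (\<i> * of_int (k $ 2) * a i k) * (wave k x / (2 * pi)) = - freq2 k * a i k * (wave k x / (2 * pi))"
      by (simp add: freq2_def UNIV_2 power2_eq_square algebra_simps add_divide_distrib)
  qed
  define c where "c N i x = fpart N (U 1) x * fpart N (D i 1) x + fpart N (U 2) x * fpart N (D i 2) x" for N i x
  have cL: "c N i \<in> L2_per" for N i
    unfolding c_def using trig_L2_per[OF trig_mult[OF tU tD]] by (intro L2_per_add) blast+
  have id: "(\<integral>x. c N 1 x * fpart N (L 1) x + c N 2 x * fpart N (L 2) x \<partial>torus) = 0" for N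
    unfolding c_def eL[symmetric]
    by (rule trig_enstrophy_identity[OF tU tU tD tD tD tD]; rule div1 div2 symm)
  \<comment> \<open>The integral identity involves the bilinear product of complex functions, the
    inner product the Hermitian one; conjugating the second factor reconciles them.\<close>
  have re: "L2_inner (c N 1) (\<lambda>x. cnj (fpart N (L 1) x)) + L2_inner (c N 2) (\<lambda>x. cnj (fpart N (L 2) x)) = 0" for N
  proof -
    have i: "integrable torus (\<lambda>x. c N i x * fpart N (L i) x)" for i
      by (rule L2_per_integrable_mult[OF cL trig_sum_L2_per])
    have "L2_inner (c N i) (\<lambda>x. cnj (fpart N (L i) x)) = Re (\<integral>x. c N i x * fpart N (L i) x \<partial>torus)" for i
      unfolding L2_inner_def inner_complex_Re using integral_Re[OF i] by simp
    then show ?thesis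
      using arg_cong[OF id[of N], of Re] Bochner_Integration.integral_add[OF i[of 1] i[of 2]] by (simp del: integral_Re)
  qed
  define c0 where "c0 i x = U 1 x * D i 1 x + U 2 x * D i 2 x" for i x
  have sup: "AE x in torus. norm (U i x) \<le> sobolev_const * L2_norm (L i)" for i
    by (rule sup_bound[OF UL LL]) (simp_all add: fU fL a0 norm_mult freq2_ge_0)
  have supN: "AE x in torus. norm (fpart N (U i) x - U i x) \<le> sobolev_const * L2_norm (\<lambda>x. fpart N (L i) x - L i x)" for N i
    by (rule sup_bound[OF L2_per_diff[OF trig_sum_L2_per UL] L2_per_diff[OF trig_sum_L2_per LL]])
       (simp_all add: fourier_diff trig_sum_L2_per UL LL fourier_trig_sum fU fL a0 norm_mult freq2_ge_0)
  have prodL: "(\<lambda>x. U j x * D i j x) \<in> L2_per" for i j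
    using L2_mult_sup_bound[OF UL DL sup] sobolev_const(1) by (simp add: L2_norm_ge0)
  have lim1: "(\<lambda>N. L2_norm (\<lambda>x. fpart N (U j) x * fpart N (D i j) x - U j x * D i j x)) \<longlonglongrightarrow> 0" for i j
  proof (rule L2_mult_tendsto[OF trig_sum_L2_per UL supN _ sup trig_sum_L2_per DL fpart_tendsto[OF DL]])
    show "(\<lambda>N. sobolev_const * L2_norm (\<lambda>x. fpart N (L j) x - L j x)) \<longlonglongrightarrow> 0"
      using tendsto_mult_left[OF fpart_tendsto[OF LL], of sobolev_const] by simp
    show "(\<lambda>x. fpart n (U j) x * fpart n (D i j) x) \<in> L2_per" for n
      using trig_L2_per[OF trig_mult[OF tU tD]] by blast
  qed (use sobolev_const(1) in \<open>auto simp: L2_norm_ge0\<close>)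
  have c0L: "c0 i \<in> L2_per" for i unfolding c0_def by (intro L2_per_add prodL)
  have limc: "(\<lambda>N. L2_norm (\<lambda>x. c N i x - c0 i x)) \<longlonglongrightarrow> 0" for i
  proof (rule tendsto_sandwich[OF always_eventually always_eventually tendsto_const])
    let ?b = "\<lambda>N. L2_norm (\<lambda>x. fpart N (U 1) x * fpart N (D i 1) x - U 1 x * D i 1 x) +
        L2_norm (\<lambda>x. fpart N (U 2) x * fpart N (D i 2) x - U 2 x * D i 2 x)"
    show "\<forall>N. L2_norm (\<lambda>x. c N i x - c0 i x) \<le> ?b N"
    proof
      fix N
      have q: "(\<lambda>x. fpart N (U j) x * fpart N (D i j) x - U j x * D i j x) \<in> L2_per" for j
        using trig_L2_per[OF trig_mult[OF tU tD]] by (intro L2_per_diff prodL) blast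
      have "(\<lambda>x. c N i x - c0 i x) = (\<lambda>x. (fpart N (U 1) x * fpart N (D i 1) x - U 1 x * D i 1 x) +
          (fpart N (U 2) x * fpart N (D i 2) x - U 2 x * D i 2 x))"
        by (simp add: fun_eq_iff c_def c0_def)
      then show "L2_norm (\<lambda>x. c N i x - c0 i x) \<le> ?b N" using L2_norm_triangle[OF q q] by simp
    qed
    show "?b \<longlonglongrightarrow> 0" using tendsto_add[OF lim1 lim1] by simp
  qed (simp add: L2_norm_ge0)
  have limL: "(\<lambda>N. L2_norm (\<lambda>x. cnj (fpart N (L i) x) - cnj (L i x))) \<longlonglongrightarrow> 0" for i
  proof -
    have "L2_norm (\<lambda>x. cnj (fpart N (L i) x) - cnj (L i x)) = L2_norm (\<lambda>x. fpart N (L i) x - L i x)" for N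
      by (simp add: L2_norm_def L2_inner_def dot_square_norm complex_cnj_diff[symmetric] del: complex_cnj_diff)
    then show ?thesis using fpart_tendsto[OF LL] by simp
  qed
  have "(\<lambda>N. L2_inner (c N 1) (\<lambda>x. cnj (fpart N (L 1) x)) + L2_inner (c N 2) (\<lambda>x. cnj (fpart N (L 2) x)))
      \<longlonglongrightarrow> L2_inner (c0 1) (\<lambda>x. cnj (L 1 x)) + L2_inner (c0 2) (\<lambda>x. cnj (L 2 x))"
    by (intro tendsto_add L2_inner_tendsto2[OF cL c0L limc _ _ limL] L2_per_cnj trig_sum_L2_per LL)
  then have "L2_inner (c0 1) (\<lambda>x. cnj (L 1 x)) + L2_inner (c0 2) (\<lambda>x. cnj (L 2 x)) = 0"
    unfolding re by (simp add: LIMSEQ_const_iff)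
  moreover have "c0 i x = complex_of_real (convection u u x $ i)" for i x
    by (simp add: c0_def U_def D_def convection_def UNIV_2)
  then have c0: "c0 i = (\<lambda>x. complex_of_real (convection u u x $ i))" for i by auto
  have "L2_inner (convection u u) (laplacian u) = (\<Sum>i\<in>UNIV. L2_inner (c0 i) (\<lambda>x. cnj (L i x)))"
    using convection_bound_stokes_V[OF u u1]
    by (subst L2_inner_components) (auto simp: c0 L_def lapL)
  ultimately show ?thesis by (simp add: UNIV_2)
qed

section \<open>The bilinear form\<close>

lemma NS_bilinear_in_H:
  assumes "u \<in> stokes_domain" "v \<in> stokes_domain"
  shows "NS_bilinear u v \<in> H_space"
  unfolding NS_bilinear_def
  using convection_bound_stokes_V[OF assms(1) stokes_domainD(2)[OF assms(2)]] by (intro leray_in_H) simp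

lemma NS_bilinear_orth_stokes:
  assumes u: "u \<in> stokes_domain"
  shows "L2_inner (NS_bilinear u u) (stokes u) = 0"
proof -
  have cL: "convection u u \<in> L2_per" using convection_bound_stokes_V[OF u stokes_domainD(2)[OF u]] by simp
  note lap = laplacian_L2_per[OF stokes_domainD(1)[OF u]]
  have "L2_inner (NS_bilinear u u) (stokes u) = L2_inner (convection u u) (stokes u)"
    unfolding NS_bilinear_def by (rule leray_orth[OF cL stokes_in_H[OF u]])
  also have "\<dots> = L2_inner (convection u u) (\<lambda>x. - laplacian u x)"
    by (rule L2_inner_cong_AE[OF cL cL stokes_L2_per[OF u] L2_per_uminus[OF lap] _ stokes_AE[OF u]]) simp
  also have "\<dots> = - L2_inner (convection u u) (laplacian u)"
    by (simp add: L2_inner_def)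
  finally show ?thesis using convection_stokes_orth[OF u] by simp
qed

text \<open>The difference of the nonlinear terms is \<open>B(u, u - v) + B(u - v, v)\<close>.\<close>

lemma NS_bilinear_diff_bound:
  assumes u: "u \<in> stokes_domain" and v: "v \<in> stokes_domain"
  shows "L2_norm (\<lambda>x. NS_bilinear u u x - NS_bilinear v v x) \<le>
    4 * sobolev_const * (L2_norm (stokes u) + L2_norm (stokes v)) * V_norm (\<lambda>x. u x - v x)"
proof -
  let ?z = "\<lambda>x. u x - v x"
  note uH = stokes_domainD(2)[OF u] and vH = stokes_domainD(2)[OF v]
  have z: "?z \<in> stokes_domain" by (rule stokes_domain_diff[OF u v])
  note zH = stokes_domainD(2)[OF z]
  have 1: "convection u ?z \<in> L2_per \<and> L2_norm (convection u ?z) \<le> 4 * (sobolev_const * L2_norm (stokes u) * V_norm ?z)"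
    by (rule convection_bound_stokes_V[OF u zH])
  have 2: "convection ?z v \<in> L2_per \<and> L2_norm (convection ?z v) \<le> 4 * (sobolev_const * V_norm ?z * L2_norm (stokes v))"
    by (rule convection_bound_V_stokes[OF stokes_domainD(3)[OF z] v])
  have uu: "convection u u \<in> L2_per" and vv: "convection v v \<in> L2_per"
    using convection_bound_stokes_V[OF u uH] convection_bound_stokes_V[OF v vH] by auto
  let ?g = "\<lambda>x. convection u u x - convection v v x"
  have g: "?g \<in> L2_per" by (rule L2_per_diff[OF uu vv])
  note B = NS_bilinear_in_H[OF u u] NS_bilinear_in_H[OF v v]
  let ?h = "\<lambda>x. NS_bilinear u u x - NS_bilinear v v x"
  have h: "?h \<in> H_space" by (rule H_space_diff[OF B])
  \<comment> \<open>The projection is orthogonal and \<open>?h\<close> already lies in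
    \<open>H_space\<close>. Hence the projected difference is no larger than the unprojected
    one.\<close>
  have "(L2_norm ?h)\<^sup>2 = L2_inner ?g ?h"
    using leray_orth[OF uu h] leray_orth[OF vv h] B[THEN H_space_L2_per] uu vv H_space_L2_per[OF h]
    unfolding L2_norm_power2 NS_bilinear_def by (simp add: L2_inner_diff_left)
  also have "\<dots> \<le> L2_norm ?g * L2_norm ?h"
    using L2_inner_Cauchy_Schwarz[OF g H_space_L2_per[OF h]] by linarith
  finally have "L2_norm ?h \<le> L2_norm ?g"
    using L2_norm_ge0[of ?h] L2_norm_ge0[of ?g]
    by (cases "L2_norm ?h = 0") (auto simp: power2_eq_square mult_le_cancel_right)
  also have "L2_norm ?g = L2_norm (\<lambda>x. convection u ?z x + convection ?z v x)"
  proof (rule L2_norm_cong_AE[OF g])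
    show "(\<lambda>x. convection u ?z x + convection ?z v x) \<in> L2_per" using 1 2 by (intro L2_per_add) auto
    \<comment> \<open>Weak derivatives are chosen representatives, so their linearity holds only
      almost everywhere.\<close>
    have wd: "AE x in torus. weak_partial j ?z x = weak_partial j u x - weak_partial j v x" for j
      using weak_partial_Hk_1(1)[OF uH] weak_partial_Hk_1(1)[OF vH] weak_partial_Hk_1(1)[OF zH]
      by (intro field_eq_AE L2_per_diff)
         (auto simp: fcoeff_diff fcoeff_weak_partial_Hk_1[OF uH] fcoeff_weak_partial_Hk_1[OF vH] fcoeff_weak_partial_Hk_1[OF zH]
           Hk_per_L2_per[OF uH] Hk_per_L2_per[OF vH] right_diff_distrib)
    show "AE x in torus. ?g x = convection u ?z x + convection ?z v x"
      using wd[of 1] wd[of 2]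
    proof eventually_elim
      case (elim x)
      show ?case by (simp add: convection_def UNIV_2, simp only: elim, simp add: algebra_simps)
    qed
  qed
  also have "\<dots> \<le> L2_norm (convection u ?z) + L2_norm (convection ?z v)"
    using 1 2 by (intro L2_norm_triangle) auto
  also have "\<dots> \<le> 4 * sobolev_const * (L2_norm (stokes u) + L2_norm (stokes v)) * V_norm ?z"
    using 1 2 by (auto simp: algebra_simps)
  finally show ?thesis .
qed

section \<open>Primitives of integrable functions of time\<close>

text \<open>Absolute continuity on [0, T] with derivative x', expressed through increments, so that
  no pointwise differentiability enters. Lebesgue integrability of x' makes dominated convergence
  available.\<close>

definition primitive_on :: "real \<Rightarrow> (real \<Rightarrow> real) \<Rightarrow> (real \<Rightarrow> real) \<Rightarrow> bool" where
  "primitive_on T x x' \<longleftrightarrow> integrable (lebesgue_on {0..T}) x' \<and>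
     (\<forall>s t. 0 \<le> s \<and> s \<le> t \<and> t \<le> T \<longrightarrow> x t - x s = integral {s..t} x')"

lemma lebesgue_on_integrable_iff:
  fixes f :: "real \<Rightarrow> real"
  shows "integrable (lebesgue_on {a..b}) f \<longleftrightarrow> f absolutely_integrable_on {a..b}"
  by (subst integrable_restrict_space) (simp_all add: set_integrable_def)

lemma lebesgue_on_subinterval:
  fixes f :: "real \<Rightarrow> real"
  assumes "integrable (lebesgue_on {0..T}) f" "0 \<le> s" "t \<le> T"
  shows "integrable (lebesgue_on {s..t}) f" "f integrable_on {s..t}" "(\<lambda>x. \<bar>f x\<bar>) integrable_on {s..t}"
    "integral\<^sup>L (lebesgue_on {s..t}) f = integral {s..t} f"
proof -
  have a: "f absolutely_integrable_on {s..t}"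
    using assms(1) unfolding lebesgue_on_integrable_iff by (rule absolutely_integrable_on_subinterval[where S="{0..T}"]) (use assms in auto)
  then show i: "integrable (lebesgue_on {s..t}) f" "f integrable_on {s..t}" "(\<lambda>x. \<bar>f x\<bar>) integrable_on {s..t}"
    by (auto simp: lebesgue_on_integrable_iff absolutely_integrable_on_def)
  show "integral\<^sup>L (lebesgue_on {s..t}) f = integral {s..t} f"
    using i by (intro lebesgue_integral_eq_integral) auto
qed

lemma primitive_onD:
  assumes "primitive_on T x x'" "0 \<le> s" "s \<le> t" "t \<le> T"
  shows "x t - x s = integral {s..t} x'"
  using assms by (auto simp: primitive_on_def)

lemma primitive_on_continuous:
  assumes "primitive_on T x x'"
  shows "continuous_on {0..T} x"
proof (cases "0 \<le> T")
  case True
  have "continuous_on {0..T} (\<lambda>t. x 0 + integral {0..t} x')"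
    using assms True
    by (intro continuous_intros indefinite_integral_continuous_1 lebesgue_on_subinterval(2)[of T x' 0 T])
       (auto simp: primitive_on_def)
  then show ?thesis
  proof (rule continuous_on_eq)
    fix t assume "t \<in> {0..T}"
    then have "x t - x 0 = integral {0..t} x'" using primitive_onD[OF assms, of 0 t] by simp
    then show "x 0 + integral {0..t} x' = x t" by simp
  qed
qed simp

lemma primitive_on_add: "primitive_on T x x' \<Longrightarrow> primitive_on T y y' \<Longrightarrow> primitive_on T (\<lambda>t. x t + y t) (\<lambda>t. x' t + y' t)"
  unfolding primitive_on_def
  by (auto simp: Henstock_Kurzweil_Integration.integral_add lebesgue_on_subinterval(2)[where T=T] algebra_simps)

lemma primitive_on_cmult: "primitive_on T x x' \<Longrightarrow> primitive_on T (\<lambda>t. c * x t) (\<lambda>t. c * x' t)"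
  unfolding primitive_on_def by (auto simp: right_diff_distrib[symmetric])

lemma primitive_on_zero: "primitive_on T (\<lambda>t. 0) (\<lambda>t. 0)"
  by (simp add: primitive_on_def)

lemma primitive_on_diff: "primitive_on T x x' \<Longrightarrow> primitive_on T y y' \<Longrightarrow> primitive_on T (\<lambda>t. x t - y t) (\<lambda>t. x' t - y' t)"
  using primitive_on_add[OF _ primitive_on_cmult[of T y y' "-1"], of x x'] by simp

lemma primitive_on_sum:
  "(\<And>i. i \<in> I \<Longrightarrow> primitive_on T (x i) (x' i)) \<Longrightarrow> primitive_on T (\<lambda>t. \<Sum>i\<in>I. x i t) (\<lambda>t. \<Sum>i\<in>I. x' i t)"
  by (induction I rule: infinite_finite_induct) (auto intro: primitive_on_zero primitive_on_add)

lemma primitive_on_mono: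
  assumes "primitive_on T x x'" "S \<le> T"
  shows "primitive_on S x x'"
  using assms lebesgue_on_subinterval(1)[of T x' 0 S] by (auto simp: primitive_on_def)

text \<open>Over a fine partition of \<open>{a..b}\<close> the local errors add up to at most \<open>\<epsilon>\<integral>k\<close>.\<close>

lemma increment_eq_integral:
  fixes F m k :: "real \<Rightarrow> real"
  assumes ab: "a \<le> b" and m: "m integrable_on {a..b}" and k: "k integrable_on {a..b}"
    and loc: "\<And>\<epsilon>. \<epsilon> > 0 \<Longrightarrow> \<exists>\<delta>>0. \<forall>s t. a \<le> s \<longrightarrow> s \<le> t \<longrightarrow> t \<le> b \<longrightarrow> t - s < \<delta> \<longrightarrow>
       \<bar>F t - F s - integral {s..t} m\<bar> \<le> \<epsilon> * integral {s..t} k"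
  shows "F b - F a = integral {a..b} m"
proof -
  have bd: "\<bar>F b - F a - integral {a..b} m\<bar> \<le> \<epsilon> * integral {a..b} k" if eps: "\<epsilon> > 0" for \<epsilon>
  proof -
    obtain \<delta> where "\<delta> > 0" and \<delta>: "\<And>s t. a \<le> s \<Longrightarrow> s \<le> t \<Longrightarrow> t \<le> b \<Longrightarrow> t - s < \<delta> \<Longrightarrow>
       \<bar>F t - F s - integral {s..t} m\<bar> \<le> \<epsilon> * integral {s..t} k"
      using loc[OF eps] by blast
    obtain n :: nat where n: "(b - a) / \<delta> < real n" using reals_Archimedean2 by blast
    have n0: "0 < real n" using n ab \<open>\<delta> > 0\<close> by (meson divide_nonneg_pos diff_ge_0_iff_ge le_less_trans)
    define h where "h = (b - a) / real n"
    have h: "0 \<le> h" "h < \<delta>" "real n * h = b - a" using n n0 ab \<open>\<delta> > 0\<close> by (auto simp: h_def field_simps)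
    have "\<bar>F (a + real i * h) - F a - integral {a..a + real i * h} m\<bar> \<le> \<epsilon> * integral {a..a + real i * h} k" if "i \<le> n" for i
      using that
    proof (induction i)
      case (Suc i)
      define s t where "s = a + real i * h" and "t = a + real (Suc i) * h"
      have "real (Suc i) * h \<le> real n * h" using Suc.prems h by (intro mult_right_mono) auto
      then have st: "a \<le> s" "s \<le> t" "t \<le> b" "t - s < \<delta>" using h by (auto simp: s_def t_def algebra_simps)
      have i: "m integrable_on {a..t}" "k integrable_on {a..t}"
        using m k st by (auto intro: integrable_subinterval_real)
      have "integral {a..s} m + integral {s..t} m = integral {a..t} m"
        "integral {a..s} k + integral {s..t} k = integral {a..t} k"
        using st i by (auto intro!: Henstock_Kurzweil_Integration.integral_combine)
      moreover have "\<bar>F s - F a - integral {a..s} m\<bar> \<le> \<epsilon> * integral {a..s} k"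
        using Suc by (simp add: s_def)
      moreover have "\<bar>F t - F s - integral {s..t} m\<bar> \<le> \<epsilon> * integral {s..t} k" by (rule \<delta>[OF st])
      ultimately have "\<bar>F t - F a - integral {a..t} m\<bar> \<le> \<epsilon> * integral {a..s} k + \<epsilon> * integral {s..t} k" by linarith
      also have "\<dots> = \<epsilon> * integral {a..t} k"
        using \<open>integral {a..s} k + integral {s..t} k = integral {a..t} k\<close> by (simp add: distrib_left[symmetric])
      finally show ?case by (simp add: t_def)
    qed simp
    from this[of n] h show ?thesis by simp
  qed
  have "\<bar>F b - F a - integral {a..b} m\<bar> \<le> 0 + e" if "e > 0" for e
  proof -
    define K where "K = \<bar>integral {a..b} k\<bar>"
    have K: "0 \<le> K" "integral {a..b} k \<le> K" by (auto simp: K_def)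
    have e: "0 < e / (K + 1)" using that K by simp
    have "\<bar>F b - F a - integral {a..b} m\<bar> \<le> e / (K + 1) * integral {a..b} k" by (rule bd[OF e])
    also have "\<dots> \<le> e / (K + 1) * (K + 1)" using e K by (intro mult_left_mono) auto
    finally show ?thesis using K by simp
  qed
  then have "\<bar>F b - F a - integral {a..b} m\<bar> \<le> 0" by (rule field_le_epsilon)
  then show ?thesis by simp
qed

text \<open>Over a short interval the mean value theorem gives \<phi>' at one intermediate value
  times the integral of x'. Uniform continuity of \<phi>' and x bounds the error by \<epsilon> times
  the integral of |x'|, which is the local condition of
  \<open>increment_eq_integral\<close>.\<close>

lemma primitive_on_chain:
  fixes x x' \<phi> \<phi>' :: "real \<Rightarrow> real"
  assumes x: "primitive_on T x x'"
    and im: "\<And>t. 0 \<le> t \<Longrightarrow> t \<le> T \<Longrightarrow> x t \<in> {lo..hi}"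
    and der: "\<And>y. y \<in> {lo..hi} \<Longrightarrow> (\<phi> has_real_derivative \<phi>' y) (at y)"
    and cont: "continuous_on {lo..hi} \<phi>'"
  shows "primitive_on T (\<lambda>t. \<phi> (x t)) (\<lambda>t. \<phi>' (x t) * x' t)"
proof -
  have xc: "continuous_on {0..T} x" by (rule primitive_on_continuous[OF x])
  have px: "continuous_on {0..T} (\<lambda>t. \<phi>' (x t))"
    by (rule continuous_on_compose2[OF cont xc]) (use im in auto)
  have xi: "integrable (lebesgue_on {0..T}) x'" using x by (simp add: primitive_on_def)
  have int: "integrable (lebesgue_on {0..T}) (\<lambda>t. \<phi>' (x t) * x' t)"
    unfolding lebesgue_on_integrable_iff
    by (rule absolutely_integrable_bounded_measurable_product_real)
       (use px xi in \<open>auto simp: lebesgue_on_integrable_iff intro!: continuous_imp_measurable_on_sets_lebesgue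
         compact_imp_bounded compact_continuous_image\<close>)
  have "\<phi> (x b) - \<phi> (x a) = integral {a..b} (\<lambda>t. \<phi>' (x t) * x' t)" if ab: "0 \<le> a" "a \<le> b" "b \<le> T" for a b
  proof (rule increment_eq_integral[where k="\<lambda>t. \<bar>x' t\<bar>"])
    show "(\<lambda>t. \<phi>' (x t) * x' t) integrable_on {a..b}" "(\<lambda>t. \<bar>x' t\<bar>) integrable_on {a..b}"
      using ab lebesgue_on_subinterval[OF int] lebesgue_on_subinterval[OF xi] by auto
    fix \<epsilon> :: real assume "\<epsilon> > 0"
    have "uniformly_continuous_on {lo..hi} \<phi>'" using cont by (intro compact_uniformly_continuous) auto
    then obtain \<eta> where "\<eta> > 0" and \<eta>: "\<And>y z. y \<in> {lo..hi} \<Longrightarrow> z \<in> {lo..hi} \<Longrightarrow> \<bar>z - y\<bar> < \<eta> \<Longrightarrow> \<bar>\<phi>' z - \<phi>' y\<bar> < \<epsilon>"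
      using \<open>\<epsilon> > 0\<close> unfolding uniformly_continuous_on_def dist_real_def by metis
    have "uniformly_continuous_on {0..T} x" using xc by (intro compact_uniformly_continuous) auto
    \<comment> \<open>Half of \<eta>, because \<xi> and x r are compared with each other through x
      s.\<close>
    then obtain \<delta> where "\<delta> > 0" and \<delta>: "\<And>s t. s \<in> {0..T} \<Longrightarrow> t \<in> {0..T} \<Longrightarrow> \<bar>t - s\<bar> < \<delta> \<Longrightarrow> \<bar>x t - x s\<bar> < \<eta> / 2"
      using \<open>\<eta> > 0\<close> unfolding uniformly_continuous_on_def dist_real_def by (metis half_gt_zero)
    show "\<exists>\<delta>>0. \<forall>s t. a \<le> s \<longrightarrow> s \<le> t \<longrightarrow> t \<le> b \<longrightarrow> t - s < \<delta> \<longrightarrow>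
       \<bar>\<phi> (x t) - \<phi> (x s) - integral {s..t} (\<lambda>t. \<phi>' (x t) * x' t)\<bar> \<le> \<epsilon> * integral {s..t} (\<lambda>t. \<bar>x' t\<bar>)"
    proof (intro exI conjI allI impI)
      show "\<delta> > 0" by fact
      fix s t assume st: "a \<le> s" "s \<le> t" "t \<le> b" "t - s < \<delta>"
      have st0: "0 \<le> s" "t \<le> T" using st ab by auto
      have near: "\<bar>x r - x s\<bar> < \<eta> / 2" if "r \<in> {s..t}" for r using \<delta>[of s r] that st st0 by auto
      have xs: "x s \<in> {lo..hi}" "x t \<in> {lo..hi}" using im st st0 by auto
      obtain \<xi> where \<xi>: "\<xi> \<in> {lo..hi}" "\<bar>\<xi> - x s\<bar> < \<eta> / 2" "\<phi> (x t) - \<phi> (x s) = \<phi>' \<xi> * (x t - x s)"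
      proof (cases "x s" "x t" rule: linorder_cases)
        case less
        then obtain z where "x s < z" "z < x t" "\<phi> (x t) - \<phi> (x s) = (x t - x s) * \<phi>' z"
          using MVT2[of "x s" "x t" \<phi> \<phi>'] der xs by auto
        then show ?thesis using that[of z] xs near[of t] st by (auto simp: mult.commute)
      next
        case equal
        then show ?thesis using that[of "x s"] xs \<open>\<eta> > 0\<close> by auto
      next
        case greater
        then obtain z where "x t < z" "z < x s" "\<phi> (x s) - \<phi> (x t) = (x s - x t) * \<phi>' z"
          using MVT2[of "x t" "x s" \<phi> \<phi>'] der xs by auto
        then show ?thesis using that[of z] xs near[of t] st by (auto simp: algebra_simps)
      qed
      note i = lebesgue_on_subinterval[OF xi st0] lebesgue_on_subinterval[OF int st0]
      have "\<phi> (x t) - \<phi> (x s) - integral {s..t} (\<lambda>t. \<phi>' (x t) * x' t) = integral {s..t} (\<lambda>r. \<phi>' \<xi> * x' r - \<phi>' (x r) * x' r)"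
        using i primitive_onD[OF x st0(1) st(2) st0(2)] \<xi>(3) by (subst Henstock_Kurzweil_Integration.integral_diff) (auto intro!: integrable_on_mult_right)
      also have "norm \<dots> \<le> integral {s..t} (\<lambda>r. \<epsilon> * \<bar>x' r\<bar>)"
      proof (rule Henstock_Kurzweil_Integration.integral_norm_bound_integral)
        show "(\<lambda>r. \<phi>' \<xi> * x' r - \<phi>' (x r) * x' r) integrable_on {s..t}" "(\<lambda>r. \<epsilon> * \<bar>x' r\<bar>) integrable_on {s..t}"
          using i by (auto intro!: Henstock_Kurzweil_Integration.integrable_diff integrable_on_mult_right)
        fix r assume r: "r \<in> {s..t}"
        have "x r \<in> {lo..hi}" using im r st0 by auto
        moreover have "\<bar>\<xi> - x r\<bar> < \<eta>" using near[OF r] \<xi>(2) by linarith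
        ultimately have "\<bar>\<phi>' \<xi> - \<phi>' (x r)\<bar> < \<epsilon>" using \<eta> \<xi>(1) by blast
        then have "\<bar>\<phi>' \<xi> - \<phi>' (x r)\<bar> * \<bar>x' r\<bar> \<le> \<epsilon> * \<bar>x' r\<bar>" by (intro mult_right_mono) auto
        then show "norm (\<phi>' \<xi> * x' r - \<phi>' (x r) * x' r) \<le> \<epsilon> * \<bar>x' r\<bar>"
          by (simp add: left_diff_distrib[symmetric] abs_mult)
      qed
      finally show "\<bar>\<phi> (x t) - \<phi> (x s) - integral {s..t} (\<lambda>t. \<phi>' (x t) * x' t)\<bar> \<le> \<epsilon> * integral {s..t} (\<lambda>t. \<bar>x' t\<bar>)"
        by simp
    qed
  qed (use ab in auto)
  then show ?thesis using int by (simp add: primitive_on_def)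
qed

lemma primitive_on_power2:
  assumes x: "primitive_on T x x'"
  shows "primitive_on T (\<lambda>t. (x t)\<^sup>2) (\<lambda>t. 2 * x t * x' t)"
proof -
  have "compact (x ` {0..T})" using primitive_on_continuous[OF x] by (intro compact_continuous_image) auto
  then have "\<exists>B. \<forall>t\<in>{0..T}. \<bar>x t\<bar> \<le> B"
    by (auto dest!: compact_imp_bounded simp: bounded_iff)
  then obtain B where B: "\<And>t. t \<in> {0..T} \<Longrightarrow> \<bar>x t\<bar> \<le> B" by blast
  show ?thesis
    by (rule primitive_on_chain[OF x, where \<phi>'="\<lambda>y. 2 * y" and lo="-B" and hi=B])
       (use B in \<open>auto simp: abs_le_iff minus_le_iff intro!: derivative_eq_intros continuous_intros\<close>)
qed

text \<open>A positive continuous function on a compact interval stays away from zero, so the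
  logarithm is continuously differentiable on its range.\<close>

lemma primitive_on_ln:
  assumes x: "primitive_on T x x'" and pos: "\<And>t. 0 \<le> t \<Longrightarrow> t \<le> T \<Longrightarrow> 0 < x t" and T: "0 \<le> T"
  shows "primitive_on T (\<lambda>t. ln (x t)) (\<lambda>t. x' t / x t)"
proof -
  have c: "continuous_on {0..T} x" by (rule primitive_on_continuous[OF x])
  obtain s where s: "s \<in> {0..T}" "\<And>t. t \<in> {0..T} \<Longrightarrow> x s \<le> x t"
    using continuous_attains_inf[OF _ _ c] T by auto
  obtain r where r: "r \<in> {0..T}" "\<And>t. t \<in> {0..T} \<Longrightarrow> x t \<le> x r"
    using continuous_attains_sup[OF _ _ c] T by auto
  have "primitive_on T (\<lambda>t. ln (x t)) (\<lambda>t. 1 / x t * x' t)"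
  proof (rule primitive_on_chain[OF x, where lo="x s" and hi="x r"])
    show "continuous_on {x s..x r} (\<lambda>y. 1 / y)"
      using pos[of s] s by (intro continuous_intros) auto
    show "(ln has_real_derivative 1 / y) (at y)" if "y \<in> {x s..x r}" for y
      using that pos[of s] s(1) by (intro DERIV_ln_divide) auto
  qed (use s r in auto)
  then show ?thesis by simp
qed

text \<open>Lebesgue measure is complete, so the values of the limit on the exceptional null set do
  not affect measurability.\<close>

lemma measurable_AE_limit:
  fixes f :: "nat \<Rightarrow> real \<Rightarrow> real" and g :: "real \<Rightarrow> real"
  assumes f: "\<And>n. f n \<in> borel_measurable (lebesgue_on S)" and S: "S \<in> sets lebesgue"
    and lim: "AE t in lebesgue_on S. (\<lambda>n. f n t) \<longlonglongrightarrow> g t"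
  shows "g \<in> borel_measurable (lebesgue_on S)"
proof -
  have S': "S \<inter> space lebesgue \<in> sets lebesgue" using S by simp
  define l where "l t = lim (\<lambda>n. f n t)" for t
  have l: "l \<in> borel_measurable (lebesgue_on S)" unfolding l_def using f by measurable
  have ae: "AE t in lebesgue_on S. l t = g t"
    using lim by eventually_elim (simp add: l_def limI)
  have "(\<lambda>t. indicator S t *\<^sub>R l t) \<in> borel_measurable lebesgue"
    using l borel_measurable_restrict_space_iff[OF S', of l] by simp
  moreover have "AE t in lebesgue. indicator S t *\<^sub>R l t = indicator S t *\<^sub>R g t"
    using ae unfolding AE_restrict_space_iff[OF S'] by eventually_elim (auto simp: indicator_def)
  ultimately have "(\<lambda>t. indicator S t *\<^sub>R g t) \<in> borel_measurable lebesgue"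
    by (rule borel_measurable_AE)
  then show ?thesis using borel_measurable_restrict_space_iff[OF S', of g] by simp
qed

lemma AE_lebesgue_on_subset:
  assumes "AE t in lebesgue_on S. P t" "R \<subseteq> S" "S \<in> sets lebesgue" "R \<in> sets lebesgue"
  shows "AE t in lebesgue_on R. P t"
proof -
  have "AE t in lebesgue. t \<in> S \<longrightarrow> P t" using assms by (subst (asm) AE_restrict_space_iff) auto
  then show ?thesis using assms by (subst AE_restrict_space_iff) (auto elim: eventually_mono)
qed

text \<open>Dominated convergence on every subinterval. Applied to a constant sequence it also
  allows the derivative to be changed on a null set.\<close>

lemma primitive_on_limit:
  assumes x: "\<And>n. primitive_on T (x n) (x' n)"
    and lim: "\<And>t. 0 \<le> t \<Longrightarrow> t \<le> T \<Longrightarrow> (\<lambda>n. x n t) \<longlonglongrightarrow> y t"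
    and lim': "AE t in lebesgue_on {0..T}. (\<lambda>n. x' n t) \<longlonglongrightarrow> y' t"
    and g: "integrable (lebesgue_on {0..T}) g" and bd: "\<And>n. AE t in lebesgue_on {0..T}. \<bar>x' n t\<bar> \<le> g t"
  shows "primitive_on T y y'"
proof -
  have xi: "integrable (lebesgue_on {0..T}) (x' n)" for n using x by (simp add: primitive_on_def)
  have ym: "y' \<in> borel_measurable (lebesgue_on {0..T})"
    by (rule measurable_AE_limit[OF _ _ lim']) (use xi in auto)
  have yi: "integrable (lebesgue_on {0..T}) y'"
    by (rule integrable_dominated_convergence[OF ym _ g lim']) (use xi bd in auto)
  have "y t - y s = integral {s..t} y'" if st: "0 \<le> s" "s \<le> t" "t \<le> T" for s t
  proof -
    have sub: "{s..t} \<subseteq> {0..T}" using st by auto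
    note i = lebesgue_on_subinterval[OF xi st(1,3)] lebesgue_on_subinterval[OF yi st(1,3)] lebesgue_on_subinterval[OF g st(1,3)]
    have "(\<lambda>n. integral\<^sup>L (lebesgue_on {s..t}) (x' n)) \<longlonglongrightarrow> integral\<^sup>L (lebesgue_on {s..t}) y'"
    proof (rule integral_dominated_convergence[where w=g])
      show "AE r in lebesgue_on {s..t}. (\<lambda>n. x' n r) \<longlonglongrightarrow> y' r"
        by (rule AE_lebesgue_on_subset[OF lim' sub]) auto
      show "AE r in lebesgue_on {s..t}. norm (x' n r) \<le> g r" for n
        using AE_lebesgue_on_subset[OF bd sub] by simp
    qed (use i in auto)
    then have "(\<lambda>n. integral {s..t} (x' n)) \<longlonglongrightarrow> integral {s..t} y'" using i by simp
    moreover have "integral {s..t} (x' n) = x n t - x n s" for n using primitive_onD[OF x st] by simp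
    ultimately have "(\<lambda>n. x n t - x n s) \<longlonglongrightarrow> integral {s..t} y'" by simp
    moreover have "(\<lambda>n. x n t - x n s) \<longlonglongrightarrow> y t - y s" using st by (intro tendsto_diff lim) auto
    ultimately show ?thesis by (rule LIMSEQ_unique[symmetric])
  qed
  then show ?thesis using yi by (simp add: primitive_on_def)
qed

lemma primitive_on_mono_bound:
  assumes x: "primitive_on T x x'" and g: "integrable (lebesgue_on {0..T}) g"
    and le: "AE t in lebesgue_on {0..T}. x' t \<le> g t" and st: "0 \<le> s" "s \<le> t" "t \<le> T"
  shows "x t - x s \<le> integral {s..t} g"
proof -
  have sub: "{s..t} \<subseteq> {0..T}" using st by auto
  have xi: "integrable (lebesgue_on {0..T}) x'" using x by (simp add: primitive_on_def)
  note i = lebesgue_on_subinterval[OF xi st(1,3)] lebesgue_on_subinterval[OF g st(1,3)]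
  have "integral\<^sup>L (lebesgue_on {s..t}) x' \<le> integral\<^sup>L (lebesgue_on {s..t}) g"
    using i AE_lebesgue_on_subset[OF le sub] by (intro integral_mono_AE) auto
  then show ?thesis using i primitive_onD[OF x st] by simp
qed

section \<open>Evolution of the Fourier coefficients\<close>

lemma AE_lebesgue_on_Ioc:
  assumes "AE t in lebesgue_on {0<..T::real}. P t"
  shows "AE t in lebesgue_on {0..T}. P t"
proof -
  have "AE t in lebesgue. t \<noteq> (0::real)" by (intro AE_completion AE_lborel_singleton)
  moreover have "AE t in lebesgue. t \<in> {0<..T} \<longrightarrow> P t" using assms by (subst (asm) AE_restrict_space_iff) auto
  ultimately have "AE t in lebesgue. t \<in> {0..T} \<longrightarrow> P t" by eventually_elim auto
  then show ?thesis by (subst AE_restrict_space_iff) auto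
qed

lemma integrable_lebesgue_on_Ioc:
  fixes f :: "real \<Rightarrow> real"
  assumes "integrable (lebesgue_on {0<..T}) f"
  shows "integrable (lebesgue_on {0..T}) f"
proof -
  have "f absolutely_integrable_on {0<..T}"
    using assms by (subst (asm) integrable_restrict_space) (simp_all add: set_integrable_def)
  then have "f absolutely_integrable_on {0..T}"
    by (rule absolutely_integrable_spike_set) (auto intro: negligible_subset[of "{0}"])
  then show ?thesis by (simp add: lebesgue_on_integrable_iff)
qed

text \<open>Real functionals of norm at most 1 on representatives. The instances are the real and
  imaginary parts of Fourier coefficients, which the abstraction treats alike.\<close>

definition L2_functional :: "(field2 \<Rightarrow> real) \<Rightarrow> bool" where
  "L2_functional c \<longleftrightarrow>
     (\<forall>u\<in>L2_per. \<forall>v\<in>L2_per. c (\<lambda>x. u x + v x) = c u + c v) \<and>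
     (\<forall>u\<in>L2_per. \<forall>r. c (\<lambda>x. r *\<^sub>R u x) = r * c u) \<and>
     (\<forall>u\<in>L2_per. \<bar>c u\<bar> \<le> L2_norm u)"

lemma L2_functional_add: "L2_functional c \<Longrightarrow> u \<in> L2_per \<Longrightarrow> v \<in> L2_per \<Longrightarrow> c (\<lambda>x. u x + v x) = c u + c v"
  and L2_functional_scaleR: "L2_functional c \<Longrightarrow> u \<in> L2_per \<Longrightarrow> c (\<lambda>x. r *\<^sub>R u x) = r * c u"
  and L2_functional_le: "L2_functional c \<Longrightarrow> u \<in> L2_per \<Longrightarrow> \<bar>c u\<bar> \<le> L2_norm u"
  by (auto simp: L2_functional_def)

lemma L2_functional_diff:
  assumes c: "L2_functional c" and u: "u \<in> L2_per" and v: "v \<in> L2_per"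
  shows "c (\<lambda>x. u x - v x) = c u - c v"
  using L2_functional_add[OF c u L2_per_scaleR[OF v, of "-1"]] L2_functional_scaleR[OF c v, of "-1"] by simp

lemma L2_functional_sum:
  assumes c: "L2_functional c"
  shows "finite I \<Longrightarrow> (\<And>i. i \<in> I \<Longrightarrow> u i \<in> L2_per) \<Longrightarrow> c (\<lambda>x. \<Sum>i\<in>I. m i *\<^sub>R u i x) = (\<Sum>i\<in>I. m i * c (u i))"
proof (induction I rule: finite_induct)
  case empty
  then show ?case using L2_functional_scaleR[OF c L2_per_const[of 0], of 0] by simp
next
  case (insert i I)
  then show ?case
    using L2_functional_add[OF c L2_per_scaleR L2_per_sum[of I "\<lambda>i x. m i *\<^sub>R u i x"]] L2_functional_scaleR[OF c]
    by (simp add: L2_per_scaleR)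
qed

lemma L2_functional_coeff:
  "L2_functional (\<lambda>u. Re (fcoeff u i k))" "L2_functional (\<lambda>u. Im (fcoeff u i k))"
  unfolding L2_functional_def
  by (auto simp: fcoeff_add fcoeff_scaleR
      intro: order_trans[OF abs_Re_le_cmod fcoeff_norm_le] order_trans[OF abs_Im_le_cmod fcoeff_norm_le])

lemma simple_field_fun_functional:
  assumes s: "simple_field_fun X I s" and X: "X \<subseteq> L2_per" and c: "L2_functional c" and I: "I \<in> sets lebesgue"
  shows "integrable (lebesgue_on I) (\<lambda>t. c (s t))"
    "(\<integral>t. c (s t) \<partial>lebesgue_on I) = c (simple_field_integral I s)"
    "simple_field_integral I s \<in> L2_per"
proof -
  have fin: "finite (s ` I)" and sX: "s ` I \<subseteq> L2_per" and lm: "\<And>y. {t \<in> I. s t = y} \<in> lmeasurable"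
    using s X by (auto simp: simple_field_fun_def)
  have eq: "c (s t) = (\<Sum>y\<in>s ` I. indicator {t \<in> I. s t = y} t * c y)" if "t \<in> I" for t
  proof -
    have "(\<Sum>y\<in>s ` I. indicator {t \<in> I. s t = y} t * c y) = (\<Sum>y\<in>s ` I. if s t = y then c y else 0)"
      using that by (intro sum.cong) (auto simp: indicator_def)
    then show ?thesis using fin that by simp
  qed
  have sets: "{t \<in> I. s t = y} \<in> sets (lebesgue_on I)" for y
    using lm[of y] I by (auto simp: sets_restrict_space_iff fmeasurable_def)
  have em: "emeasure (lebesgue_on I) {t \<in> I. s t = y} = emeasure lebesgue {t \<in> I. s t = y}" for y
    using I by (subst emeasure_restrict_space) auto
  have fm: "emeasure (lebesgue_on I) {t \<in> I. s t = y} < \<infinity>" for y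
    unfolding em using lm[of y] by (auto simp: fmeasurable_def)
  have i: "integrable (lebesgue_on I) (indicator {t \<in> I. s t = y} :: real \<Rightarrow> real)" for y
    using sets fm by (intro integrable_real_indicator)
  have cong: "integrable (lebesgue_on I) (\<lambda>t. c (s t)) \<longleftrightarrow> integrable (lebesgue_on I) (\<lambda>t. \<Sum>y\<in>s ` I. indicator {t \<in> I. s t = y} t * c y)"
    by (intro Bochner_Integration.integrable_cong refl) (simp add: eq)
  show "integrable (lebesgue_on I) (\<lambda>t. c (s t))" unfolding cong using i by auto
  have "(\<integral>t. c (s t) \<partial>lebesgue_on I) = (\<integral>t. (\<Sum>y\<in>s ` I. indicator {t \<in> I. s t = y} t * c y) \<partial>lebesgue_on I)"
    by (intro Bochner_Integration.integral_cong refl) (simp add: eq)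
  also have "\<dots> = (\<Sum>y\<in>s ` I. (\<integral>t. indicator {t \<in> I. s t = y} t \<partial>lebesgue_on I) * c y)"
    using i by (subst Bochner_Integration.integral_sum) auto
  also have "\<dots> = (\<Sum>y\<in>s ` I. measure lebesgue {t \<in> I. s t = y} * c y)"
  proof (rule sum.cong[OF refl])
    fix y
    have "(\<integral>t. indicator {t \<in> I. s t = y} t \<partial>lebesgue_on I) = measure (lebesgue_on I) ({t \<in> I. s t = y} \<inter> space (lebesgue_on I))"
      by (rule Bochner_Integration.integral_indicator)
    also have "{t \<in> I. s t = y} \<inter> space (lebesgue_on I) = {t \<in> I. s t = y}" by auto
    finally have "(\<integral>t. indicator {t \<in> I. s t = y} t \<partial>lebesgue_on I) = measure (lebesgue_on I) {t \<in> I. s t = y}" .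
    then show "(\<integral>t. indicator {t \<in> I. s t = y} t \<partial>lebesgue_on I) * c y = measure lebesgue {t \<in> I. s t = y} * c y"
      by (simp add: measure_def em)
  qed
  also have "\<dots> = c (simple_field_integral I s)"
    unfolding simple_field_integral_def using fin sX by (subst L2_functional_sum[OF c]) auto
  finally show "(\<integral>t. c (s t) \<partial>lebesgue_on I) = c (simple_field_integral I s)" .
  show "simple_field_integral I s \<in> L2_per"
    unfolding simple_field_integral_def using sX by (intro L2_per_sum L2_per_scaleR) auto
qed

text \<open>A bounded functional commutes with the Bochner integral: both sides are limits of its
  values on the integrals of the same simple functions.\<close>

lemma bochner_integral_functional:
  assumes b: "has_bochner_integral_in H_space L2_norm I w y" and y: "y \<in> L2_per"
    and w: "AE t in lebesgue_on I. w t \<in> H_space" and c: "L2_functional c" and I: "I \<in> sets lebesgue"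
    and int: "integrable (lebesgue_on I) (\<lambda>t. c (w t))"
  shows "c y = (\<integral>t. c (w t) \<partial>lebesgue_on I)"
proof -
  have HL: "H_space \<subseteq> L2_per" by (auto simp: H_space_L2_per)
  obtain s where s: "\<And>n. simple_field_fun H_space I (s n)"
    and si: "\<And>n. integrable (lebesgue_on I) (\<lambda>t. L2_norm (s n t - w t))"
    and s0: "(\<lambda>n. \<integral>t. L2_norm (s n t - w t) \<partial>lebesgue_on I) \<longlonglongrightarrow> 0"
    and sy: "(\<lambda>n. L2_norm (simple_field_integral I (s n) - y)) \<longlonglongrightarrow> 0"
    using b unfolding has_bochner_integral_in_def by blast
  note S = simple_field_fun_functional[OF s HL c I]
  have "(\<lambda>n. c (simple_field_integral I (s n))) \<longlonglongrightarrow> c y"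
  proof (rule Lim_null_comparison[THEN LIM_zero_cancel, OF always_eventually sy], rule allI)
    fix n
    show "norm (c (simple_field_integral I (s n)) - c y) \<le> L2_norm (simple_field_integral I (s n) - y)"
      using L2_functional_le[OF c L2_per_diff[OF S(3) y]] L2_functional_diff[OF c S(3) y] by (simp add: fun_diff_def)
  qed
  moreover have "(\<lambda>n. c (simple_field_integral I (s n))) \<longlonglongrightarrow> (\<integral>t. c (w t) \<partial>lebesgue_on I)"
  proof (rule Lim_null_comparison[THEN LIM_zero_cancel, OF always_eventually s0], rule allI)
    fix n
    have "norm ((\<integral>t. c (s n t) \<partial>lebesgue_on I) - (\<integral>t. c (w t) \<partial>lebesgue_on I)) = norm (\<integral>t. c (s n t) - c (w t) \<partial>lebesgue_on I)"
      using S int by simp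
    also have "\<dots> \<le> (\<integral>t. norm (c (s n t) - c (w t)) \<partial>lebesgue_on I)" by (rule Bochner_Integration.integral_norm_bound)
    also have "\<dots> \<le> (\<integral>t. L2_norm (s n t - w t) \<partial>lebesgue_on I)"
    proof (rule integral_mono_AE)
      have "AE t in lebesgue_on I. t \<in> I" using AE_space[of "lebesgue_on I"] by simp
      then show "AE t in lebesgue_on I. norm (c (s n t) - c (w t)) \<le> L2_norm (s n t - w t)"
        using w
      proof eventually_elim
        case (elim t)
        then have L: "s n t \<in> L2_per" "w t \<in> L2_per"
          using s[of n] HL by (auto simp: simple_field_fun_def)
        show ?case using L2_functional_le[OF c L2_per_diff[OF L]] L2_functional_diff[OF c L] by (simp add: fun_diff_def)
      qed
    qed (use S int si in auto)
    finally show "norm (c (simple_field_integral I (s n)) - (\<integral>t. c (w t) \<partial>lebesgue_on I)) \<le> (\<integral>t. L2_norm (s n t - w t) \<partial>lebesgue_on I)"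
      by (simp add: S)
  qed
  ultimately show ?thesis by (rule LIMSEQ_unique)
qed

text \<open>Measurability is inherited from the simple approximations, and integrability follows
  from |c(w)| \<le> 1 + |w|^2 on an interval of finite length.\<close>

lemma L2_time_functional_integrable:
  assumes w: "w \<in> L2_time H_space L2_norm {0<..T}" and c: "L2_functional c"
  shows "integrable (lebesgue_on {0..T}) (\<lambda>t. c (w t))"
proof -
  have HL: "H_space \<subseteq> L2_per" by (auto simp: H_space_L2_per)
  have wH: "AE t in lebesgue_on {0<..T}. w t \<in> H_space" and bm: "bochner_measurable H_space L2_norm {0<..T} w"
    and wi: "integrable (lebesgue_on {0<..T}) (\<lambda>t. (L2_norm (w t))\<^sup>2)" using w by (auto simp: L2_time_def)
  obtain s where s: "\<And>n. simple_field_fun H_space {0<..T} (s n)"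
    and s0: "AE t in lebesgue_on {0<..T}. (\<lambda>n. L2_norm (s n t - w t)) \<longlonglongrightarrow> 0"
    using bm unfolding bochner_measurable_def by blast
  have "AE t in lebesgue_on {0<..T}. t \<in> {0<..T}" using AE_space[of "lebesgue_on {0<..T}"] by simp
  then have lim: "AE t in lebesgue_on {0<..T}. (\<lambda>n. c (s n t)) \<longlonglongrightarrow> c (w t)"
    using wH s0
  proof eventually_elim
    case (elim t)
    have L: "s n t \<in> L2_per" "w t \<in> L2_per" for n
      using s[of n] HL elim(1,2) by (auto simp: simple_field_fun_def image_subset_iff)
    show ?case
    proof (rule Lim_null_comparison[THEN LIM_zero_cancel, OF always_eventually elim(3)], rule allI)
      fix n
      show "norm (c (s n t) - c (w t)) \<le> L2_norm (s n t - w t)"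
        using L2_functional_le[OF c L2_per_diff[OF L]] L2_functional_diff[OF c L] by (simp add: fun_diff_def)
    qed
  qed
  have m: "(\<lambda>t. c (w t)) \<in> borel_measurable (lebesgue_on {0<..T})"
  proof (rule measurable_AE_limit[OF _ _ lim])
    show "(\<lambda>t. c (s n t)) \<in> borel_measurable (lebesgue_on {0<..T})" for n
      using simple_field_fun_functional(1)[OF s HL c] by auto
  qed simp
  have fin: "finite_measure (lebesgue_on {0<..T})"
    by (rule finite_measure_lebesgue_on) (auto intro: bounded_set_imp_lmeasurable)
  have "integrable (lebesgue_on {0<..T}) (\<lambda>t. c (w t))"
  proof (rule Bochner_Integration.integrable_bound[OF _ m])
    show "integrable (lebesgue_on {0<..T}) (\<lambda>t. 1 + (L2_norm (w t))\<^sup>2)"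
      using wi fin by (intro Bochner_Integration.integrable_add finite_measure.integrable_const)
    show "AE t in lebesgue_on {0<..T}. norm (c (w t)) \<le> norm (1 + (L2_norm (w t))\<^sup>2)"
      using wH
    proof eventually_elim
      case (elim t)
      have "\<bar>c (w t)\<bar> \<le> L2_norm (w t)" using elim c by (intro L2_functional_le H_space_L2_per)
      also have "\<dots> \<le> 1 + (L2_norm (w t))\<^sup>2" using sum_squares_bound[of 1 "L2_norm (w t)"] L2_norm_ge0[of "w t"] by simp
      finally show ?case by simp
    qed
  qed
  then show ?thesis by (rule integrable_lebesgue_on_Ioc)
qed

text \<open>What the energy identities use of a solution. Asking for an integrable majorant g makes
  the notion stable under differences, without the measurability in time of the norms of a
  difference.\<close>

definition evolves :: "real \<Rightarrow> (real \<Rightarrow> field2) \<Rightarrow> (real \<Rightarrow> field2) \<Rightarrow> bool" where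
  "evolves T u w \<longleftrightarrow>
    (\<forall>t\<in>{0..T}. u t \<in> V_space) \<and>
    (AE t in lebesgue_on {0..T}. u t \<in> stokes_domain \<and> w t \<in> H_space) \<and>
    (\<exists>g. integrable (lebesgue_on {0..T}) g \<and>
       (AE t in lebesgue_on {0..T}. (L2_norm (stokes (u t)))\<^sup>2 + (L2_norm (w t))\<^sup>2 \<le> g t)) \<and>
    (\<forall>i k. primitive_on T (\<lambda>t. Re (fcoeff (u t) i k)) (\<lambda>t. Re (fcoeff (w t) i k)) \<and>
           primitive_on T (\<lambda>t. Im (fcoeff (u t) i k)) (\<lambda>t. Im (fcoeff (w t) i k)))"

lemma strong_solution_evolves:
  assumes sol: "strong_solution \<nu> f T \<theta> u"
  obtains w where "evolves T u w"
    "AE t in lebesgue_on {0..T}. AE x in torus. w t x + \<nu> *\<^sub>R stokes (u t) x + NS_bilinear (u t) (u t) x = f x"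
    "integrable (lebesgue_on {0..T}) (\<lambda>t. (L2_norm (stokes (u t)))\<^sup>2)"
proof -
  have uV: "\<And>t. t \<in> {0..T} \<Longrightarrow> u t \<in> V_space"
    using sol unfolding strong_solution_def continuous_in_def by blast
  have uD: "u \<in> L2_time stokes_domain (\<lambda>w. L2_norm (stokes w)) {0<..T}"
    using sol unfolding strong_solution_def by blast
  obtain w where w: "w \<in> L2_time H_space L2_norm {0<..T}" and td: "has_time_derivative T u w"
    and eq: "AE t in lebesgue_on {0<..T}. AE x in torus. w t x + \<nu> *\<^sub>R stokes (u t) x + NS_bilinear (u t) (u t) x = f x"
    using sol unfolding strong_solution_def by blast
  have wH: "AE t in lebesgue_on {0..T}. w t \<in> H_space"
    using w by (intro AE_lebesgue_on_Ioc) (auto simp: L2_time_def)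
  have uS: "AE t in lebesgue_on {0..T}. u t \<in> stokes_domain"
    using uD by (intro AE_lebesgue_on_Ioc) (auto simp: L2_time_def)
  have si: "integrable (lebesgue_on {0..T}) (\<lambda>t. (L2_norm (stokes (u t)))\<^sup>2)"
    using uD by (intro integrable_lebesgue_on_Ioc) (auto simp: L2_time_def)
  have wi: "integrable (lebesgue_on {0..T}) (\<lambda>t. (L2_norm (w t))\<^sup>2)"
    using w by (intro integrable_lebesgue_on_Ioc) (auto simp: L2_time_def)
  have prim: "primitive_on T (\<lambda>t. c (u t)) (\<lambda>t. c (w t))" if c: "L2_functional c" for c
  proof -
    note int = L2_time_functional_integrable[OF w c]
    have "c (u t) - c (u s) = integral {s..t} (\<lambda>t. c (w t))" if st: "0 \<le> s" "s \<le> t" "t \<le> T" for s t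
    proof -
      have L: "u s \<in> L2_per" "u t \<in> L2_per" using uV st by (auto intro!: V_spaceD(3))
      have "has_bochner_integral_in H_space L2_norm {s..t} w (u t - u s)"
        using td st by (auto simp: has_time_derivative_def)
      moreover have "AE r in lebesgue_on {s..t}. w r \<in> H_space"
        using st by (intro AE_lebesgue_on_subset[OF wH]) auto
      ultimately have "c (u t - u s) = (\<integral>t. c (w t) \<partial>lebesgue_on {s..t})"
        using L c lebesgue_on_subinterval(1)[OF int st(1,3)]
        by (intro bochner_integral_functional[where y="u t - u s" and w=w and c=c]) (auto intro: L2_per_diff')
      then show ?thesis
        using lebesgue_on_subinterval(4)[OF int st(1,3)] L2_functional_diff[OF c L(2,1)] by (simp add: fun_diff_def)
    qed
    then show ?thesis using int by (simp add: primitive_on_def)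
  qed
  have "evolves T u w"
    unfolding evolves_def
  proof (intro conjI allI ballI uV)
    show "AE t in lebesgue_on {0..T}. u t \<in> stokes_domain \<and> w t \<in> H_space" using uS wH by eventually_elim simp
    show "\<exists>g. integrable (lebesgue_on {0..T}) g \<and>
       (AE t in lebesgue_on {0..T}. (L2_norm (stokes (u t)))\<^sup>2 + (L2_norm (w t))\<^sup>2 \<le> g t)"
      using Bochner_Integration.integrable_add[OF si wi] by (intro exI conjI) auto
  qed (auto intro: prim[OF L2_functional_coeff(1)] prim[OF L2_functional_coeff(2)])
  then show thesis using that AE_lebesgue_on_Ioc[OF eq] si by blast
qed

lemma evolves_diff:
  assumes u: "evolves T u w" and v: "evolves T v w'"
  shows "evolves T (\<lambda>t x. u t x - v t x) (\<lambda>t x. w t x - w' t x)"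
proof -
  have uV: "\<And>t. t \<in> {0..T} \<Longrightarrow> u t \<in> V_space" and vV: "\<And>t. t \<in> {0..T} \<Longrightarrow> v t \<in> V_space"
    and uS: "AE t in lebesgue_on {0..T}. u t \<in> stokes_domain \<and> w t \<in> H_space"
    and vS: "AE t in lebesgue_on {0..T}. v t \<in> stokes_domain \<and> w' t \<in> H_space"
    using u v by (auto simp: evolves_def)
  obtain g h where g: "integrable (lebesgue_on {0..T}) g" "AE t in lebesgue_on {0..T}. (L2_norm (stokes (u t)))\<^sup>2 + (L2_norm (w t))\<^sup>2 \<le> g t"
    and h: "integrable (lebesgue_on {0..T}) h" "AE t in lebesgue_on {0..T}. (L2_norm (stokes (v t)))\<^sup>2 + (L2_norm (w' t))\<^sup>2 \<le> h t"
    using u v by (auto simp: evolves_def)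
  have sq: "(L2_norm (\<lambda>x. a x - b x))\<^sup>2 \<le> 2 * (L2_norm a)\<^sup>2 + 2 * (L2_norm b)\<^sup>2" if "a \<in> L2_per" "b \<in> L2_per" for a b :: field2
    using L2_parallelogram[OF that] zero_le_power2[of "L2_norm (\<lambda>x. a x + b x)"] by linarith
  have prim: "primitive_on T (\<lambda>t. c (\<lambda>x. u t x - v t x)) (\<lambda>t. c (\<lambda>x. w t x - w' t x))"
    if c: "L2_functional c" and pu: "primitive_on T (\<lambda>t. c (u t)) (\<lambda>t. c (w t))" and pv: "primitive_on T (\<lambda>t. c (v t)) (\<lambda>t. c (w' t))" for c
  proof -
    have d: "primitive_on T (\<lambda>t. c (u t) - c (v t)) (\<lambda>t. c (w t) - c (w' t))" by (rule primitive_on_diff[OF pu pv])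
    \<comment> \<open>Linearity of c is available only where both derivatives lie in
      \<open>H_space\<close>. The limit of a constant sequence replaces the derivative outside a
      null set.\<close>
    show ?thesis
    proof (rule primitive_on_limit[where x="\<lambda>n t. c (u t) - c (v t)" and x'="\<lambda>n t. c (w t) - c (w' t)"])
      show "(\<lambda>n. c (u t) - c (v t)) \<longlonglongrightarrow> c (\<lambda>x. u t x - v t x)" if "0 \<le> t" "t \<le> T" for t
        using that uV vV V_spaceD(3) by (simp add: L2_functional_diff[OF c])
      show "AE t in lebesgue_on {0..T}. (\<lambda>n. c (w t) - c (w' t)) \<longlonglongrightarrow> c (\<lambda>x. w t x - w' t x)"
        using uS vS by eventually_elim (simp add: L2_functional_diff[OF c] H_space_L2_per)
      show "integrable (lebesgue_on {0..T}) (\<lambda>t. \<bar>c (w t) - c (w' t)\<bar>)"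
        using d by (simp add: primitive_on_def)
    qed (use d in auto)
  qed
  show ?thesis
    unfolding evolves_def
  proof (intro conjI allI ballI)
    show "(\<lambda>x. u t x - v t x) \<in> V_space" if "t \<in> {0..T}" for t using uV[OF that] vV[OF that] by (rule V_space_diff)
    show "AE t in lebesgue_on {0..T}. (\<lambda>x. u t x - v t x) \<in> stokes_domain \<and> (\<lambda>x. w t x - w' t x) \<in> H_space"
      using uS vS by eventually_elim (auto intro: stokes_domain_diff H_space_diff)
    show "\<exists>g. integrable (lebesgue_on {0..T}) g \<and> (AE t in lebesgue_on {0..T}.
        (L2_norm (stokes (\<lambda>x. u t x - v t x)))\<^sup>2 + (L2_norm (\<lambda>x. w t x - w' t x))\<^sup>2 \<le> g t)"
    proof (intro exI conjI)
      show "integrable (lebesgue_on {0..T}) (\<lambda>t. 2 * g t + 2 * h t)" using g h by simp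
      show "AE t in lebesgue_on {0..T}. (L2_norm (stokes (\<lambda>x. u t x - v t x)))\<^sup>2 + (L2_norm (\<lambda>x. w t x - w' t x))\<^sup>2 \<le> 2 * g t + 2 * h t"
        using uS vS g(2) h(2)
      proof eventually_elim
        case (elim t)
        then have S: "u t \<in> stokes_domain" "v t \<in> stokes_domain" and W: "w t \<in> L2_per" "w' t \<in> L2_per" by (auto simp: H_space_L2_per)
        have "L2_norm (stokes (\<lambda>x. u t x - v t x)) = L2_norm (\<lambda>x. stokes (u t) x - stokes (v t) x)"
          by (intro L2_norm_cong_AE stokes_diff_AE stokes_L2_per stokes_domain_diff L2_per_diff S)
        then show ?case
          using sq[OF stokes_L2_per[OF S(1)] stokes_L2_per[OF S(2)]] sq[OF W] elim by simp
      qed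
    qed
    fix i k
    have pu: "primitive_on T (\<lambda>t. Re (fcoeff (u t) i k)) (\<lambda>t. Re (fcoeff (w t) i k))"
        "primitive_on T (\<lambda>t. Im (fcoeff (u t) i k)) (\<lambda>t. Im (fcoeff (w t) i k))"
      and pv: "primitive_on T (\<lambda>t. Re (fcoeff (v t) i k)) (\<lambda>t. Re (fcoeff (w' t) i k))"
        "primitive_on T (\<lambda>t. Im (fcoeff (v t) i k)) (\<lambda>t. Im (fcoeff (w' t) i k))"
      using u v by (auto simp: evolves_def)
    show "primitive_on T (\<lambda>t. Re (fcoeff (\<lambda>x. u t x - v t x) i k)) (\<lambda>t. Re (fcoeff (\<lambda>x. w t x - w' t x) i k))"
      by (rule prim[OF L2_functional_coeff(1) pu(1) pv(1)])
    show "primitive_on T (\<lambda>t. Im (fcoeff (\<lambda>x. u t x - v t x) i k)) (\<lambda>t. Im (fcoeff (\<lambda>x. w t x - w' t x) i k))"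
      by (rule prim[OF L2_functional_coeff(2) pu(2) pv(2)])
  qed
qed

section \<open>Energy identities by summation over frequencies\<close>

lemma fbox_sum_le_norm:
  assumes u: "u \<in> L2_per"
  shows "(\<Sum>k\<in>fbox N. \<Sum>i\<in>UNIV. (norm (fcoeff u i k))\<^sup>2) \<le> (L2_norm u)\<^sup>2"
proof (rule incseq_le[OF _ field_norm_Parseval[OF u]])
  show "incseq (\<lambda>N. \<Sum>k\<in>fbox N. \<Sum>i\<in>UNIV. (norm (fcoeff u i k))\<^sup>2)"
    using fbox_mono by (intro monoI sum_mono2) (auto intro!: sum_nonneg)
qed

text \<open>A bound uniform in N, from which the integrable majorant of the truncated energy
  identities is obtained.\<close>

lemma fbox_inner_le_norm:
  assumes u: "u \<in> L2_per" and v: "v \<in> L2_per"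
  shows "\<bar>\<Sum>k\<in>fbox N. \<Sum>i\<in>UNIV. 2 * Re (fcoeff u i k * cnj (fcoeff v i k))\<bar> \<le> (L2_norm u)\<^sup>2 + (L2_norm v)\<^sup>2"
proof -
  have "\<bar>\<Sum>k\<in>fbox N. \<Sum>i\<in>UNIV. 2 * Re (fcoeff u i k * cnj (fcoeff v i k))\<bar>
      \<le> (\<Sum>k\<in>fbox N. \<Sum>i\<in>UNIV. (norm (fcoeff u i k))\<^sup>2 + (norm (fcoeff v i k))\<^sup>2)"
  proof (intro order_trans[OF sum_abs] sum_mono order_trans[OF sum_abs])
    fix k :: "int^2" and i :: 2
    have "\<bar>2 * Re (fcoeff u i k * cnj (fcoeff v i k))\<bar> \<le> 2 * norm (fcoeff u i k) * norm (fcoeff v i k)"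
      using abs_Re_le_cmod[of "fcoeff u i k * cnj (fcoeff v i k)"] by (simp add: norm_mult abs_mult)
    also have "\<dots> \<le> (norm (fcoeff u i k))\<^sup>2 + (norm (fcoeff v i k))\<^sup>2" by (rule sum_squares_bound)
    finally show "\<bar>2 * Re (fcoeff u i k * cnj (fcoeff v i k))\<bar> \<le> (norm (fcoeff u i k))\<^sup>2 + (norm (fcoeff v i k))\<^sup>2" .
  qed
  also have "\<dots> \<le> (L2_norm u)\<^sup>2 + (L2_norm v)\<^sup>2"
    using fbox_sum_le_norm[OF u] fbox_sum_le_norm[OF v] by (simp only: sum.distrib add_mono)
  finally show ?thesis .
qed

lemma V_norm_le_stokes:
  assumes u: "u \<in> stokes_domain"
  shows "V_norm u \<le> L2_norm (stokes u)"
proof -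
  have "(V_norm u)\<^sup>2 \<le> L2_norm u * L2_norm (stokes u)"
    using L2_inner_Cauchy_Schwarz[OF stokes_domainD(5)[OF u] stokes_L2_per[OF u]] V_norm_eq_stokes[OF u] by linarith
  also have "\<dots> \<le> V_norm u * L2_norm (stokes u)"
    using Poincare[OF stokes_domainD(3)[OF u]] by (intro mult_right_mono L2_norm_ge0)
  finally show ?thesis
    using V_norm_ge0[OF stokes_domainD(2)[OF u]] L2_norm_ge0[of "stokes u"]
    by (cases "V_norm u = 0") (auto simp: power2_eq_square mult_le_cancel_left)
qed

text \<open>On finitely many frequencies this is the product rule for real and imaginary parts. For
  the V norm the weight |k|^2 is moved onto u and produces Au, so |Au|^2 + |w|^2 dominates uniformly
  in the truncation; for the L^2 norm |u| \<le> |Au| leads to the same majorant.\<close>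

lemma evolves_energy:
  assumes ev: "evolves T u w"
  shows "primitive_on T (\<lambda>t. (V_norm (u t))\<^sup>2) (\<lambda>t. 2 * L2_inner (stokes (u t)) (w t))"
    and "primitive_on T (\<lambda>t. (L2_norm (u t))\<^sup>2) (\<lambda>t. 2 * L2_inner (u t) (w t))"
proof -
  have uV: "\<And>t. t \<in> {0..T} \<Longrightarrow> u t \<in> V_space"
    and uS: "AE t in lebesgue_on {0..T}. u t \<in> stokes_domain \<and> w t \<in> H_space"
    using ev by (auto simp: evolves_def)
  obtain g where g: "integrable (lebesgue_on {0..T}) g"
      "AE t in lebesgue_on {0..T}. (L2_norm (stokes (u t)))\<^sup>2 + (L2_norm (w t))\<^sup>2 \<le> g t"
    using ev by (auto simp: evolves_def)
  have prim: "primitive_on T (\<lambda>t. (norm (fcoeff (u t) i k))\<^sup>2) (\<lambda>t. 2 * Re (fcoeff (u t) i k * cnj (fcoeff (w t) i k)))" for i k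
  proof -
    have "primitive_on T (\<lambda>t. (Re (fcoeff (u t) i k))\<^sup>2 + (Im (fcoeff (u t) i k))\<^sup>2)
        (\<lambda>t. 2 * Re (fcoeff (u t) i k) * Re (fcoeff (w t) i k) + 2 * Im (fcoeff (u t) i k) * Im (fcoeff (w t) i k))"
      using ev by (intro primitive_on_add primitive_on_power2) (auto simp: evolves_def)
    then show ?thesis by (simp add: cmod_power2 algebra_simps)
  qed
  show "primitive_on T (\<lambda>t. (V_norm (u t))\<^sup>2) (\<lambda>t. 2 * L2_inner (stokes (u t)) (w t))"
  proof (rule primitive_on_limit[OF _ _ _ g(1)])
    fix N
    show "primitive_on T (\<lambda>t. \<Sum>k\<in>fbox N. freq2 k * (\<Sum>i\<in>UNIV. (norm (fcoeff (u t) i k))\<^sup>2))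
        (\<lambda>t. \<Sum>k\<in>fbox N. freq2 k * (\<Sum>i\<in>UNIV. 2 * Re (fcoeff (u t) i k * cnj (fcoeff (w t) i k))))"
      by (intro primitive_on_sum primitive_on_cmult prim)
    show "AE t in lebesgue_on {0..T}. \<bar>\<Sum>k\<in>fbox N. freq2 k * (\<Sum>i\<in>UNIV. 2 * Re (fcoeff (u t) i k * cnj (fcoeff (w t) i k)))\<bar> \<le> g t"
      using uS g(2)
    proof eventually_elim
      case (elim t)
      then have S: "u t \<in> stokes_domain" and W: "w t \<in> L2_per" by (auto simp: H_space_L2_per)
      have "freq2 k * (\<Sum>i\<in>UNIV. 2 * Re (fcoeff (u t) i k * cnj (fcoeff (w t) i k))) =
         (\<Sum>i\<in>UNIV. 2 * Re (fcoeff (stokes (u t)) i k * cnj (fcoeff (w t) i k)))" for k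
        by (simp add: fcoeff_stokes[OF S] sum_distrib_left algebra_simps)
      then show ?case using fbox_inner_le_norm[OF stokes_L2_per[OF S] W, of N] elim by simp
    qed
  next
    show "(\<lambda>N. \<Sum>k\<in>fbox N. freq2 k * (\<Sum>i\<in>UNIV. (norm (fcoeff (u t) i k))\<^sup>2)) \<longlonglongrightarrow> (V_norm (u t))\<^sup>2" if "0 \<le> t" "t \<le> T" for t
      using uV[of t] that by (intro V_norm_Parseval V_spaceD) auto
    show "AE t in lebesgue_on {0..T}. (\<lambda>N. \<Sum>k\<in>fbox N. freq2 k * (\<Sum>i\<in>UNIV. 2 * Re (fcoeff (u t) i k * cnj (fcoeff (w t) i k))))
        \<longlonglongrightarrow> 2 * L2_inner (stokes (u t)) (w t)"
      using uS
    proof eventually_elim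
      case (elim t)
      then have S: "u t \<in> stokes_domain" and W: "w t \<in> L2_per" by (auto simp: H_space_L2_per)
      have "freq2 k * (\<Sum>i\<in>UNIV. 2 * Re (fcoeff (u t) i k * cnj (fcoeff (w t) i k))) =
         2 * (\<Sum>i\<in>UNIV. Re (fcoeff (stokes (u t)) i k * cnj (fcoeff (w t) i k)))" for k
        by (simp add: fcoeff_stokes[OF S] sum_distrib_left algebra_simps)
      then show ?case using tendsto_mult_left[OF field_Parseval[OF stokes_L2_per[OF S] W], of 2]
        by (simp add: sum_distrib_left)
    qed
  qed
  show "primitive_on T (\<lambda>t. (L2_norm (u t))\<^sup>2) (\<lambda>t. 2 * L2_inner (u t) (w t))"
  proof (rule primitive_on_limit[OF _ _ _ g(1)])
    fix N
    show "primitive_on T (\<lambda>t. \<Sum>k\<in>fbox N. \<Sum>i\<in>UNIV. (norm (fcoeff (u t) i k))\<^sup>2)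
        (\<lambda>t. \<Sum>k\<in>fbox N. \<Sum>i\<in>UNIV. 2 * Re (fcoeff (u t) i k * cnj (fcoeff (w t) i k)))"
      by (intro primitive_on_sum prim)
    show "AE t in lebesgue_on {0..T}. \<bar>\<Sum>k\<in>fbox N. \<Sum>i\<in>UNIV. 2 * Re (fcoeff (u t) i k * cnj (fcoeff (w t) i k))\<bar> \<le> g t"
      using uS g(2)
    proof eventually_elim
      case (elim t)
      then have S: "u t \<in> stokes_domain" and W: "w t \<in> L2_per" by (auto simp: H_space_L2_per)
      have "L2_norm (u t) \<le> L2_norm (stokes (u t))"
        using Poincare[OF stokes_domainD(3)[OF S]] V_norm_le_stokes[OF S] by linarith
      then have "(L2_norm (u t))\<^sup>2 \<le> (L2_norm (stokes (u t)))\<^sup>2" by (intro power_mono L2_norm_ge0)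
      then show ?case using fbox_inner_le_norm[OF stokes_domainD(5)[OF S] W, of N] elim by linarith
    qed
  next
    show "(\<lambda>N. \<Sum>k\<in>fbox N. \<Sum>i\<in>UNIV. (norm (fcoeff (u t) i k))\<^sup>2) \<longlonglongrightarrow> (L2_norm (u t))\<^sup>2" if "0 \<le> t" "t \<le> T" for t
      using uV[of t] that by (intro field_norm_Parseval V_spaceD) auto
    show "AE t in lebesgue_on {0..T}. (\<lambda>N. \<Sum>k\<in>fbox N. \<Sum>i\<in>UNIV. 2 * Re (fcoeff (u t) i k * cnj (fcoeff (w t) i k)))
        \<longlonglongrightarrow> 2 * L2_inner (u t) (w t)"
      using uS
    proof eventually_elim
      case (elim t)
      then have S: "u t \<in> stokes_domain" and W: "w t \<in> L2_per" by (auto simp: H_space_L2_per)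
      show ?case using tendsto_mult_left[OF field_Parseval[OF stokes_domainD(5)[OF S] W], of 2]
        by (simp add: sum_distrib_left)
    qed
  qed
qed

section \<open>Growth of the Dirichlet quotient\<close>

text \<open>n and e stand for |z|^2 and |z|_V^2. The hypothesis \<open>e_le\<close> says that ln (e
  / n) has derivative at most K, so e \<le> (e 0 / n 0) exp \<kappa> n. Inserted into
  \<open>n_ge\<close>, this bounds the derivative of - ln n by an integrable function.\<close>

lemma dirichlet_quotient_bound_pos:
  fixes n e n' e' K :: "real \<Rightarrow> real"
  assumes n: "primitive_on T n n'" and e: "primitive_on T e e'" and T: "0 \<le> T" and c: "0 \<le> c"
    and pos: "\<And>t. 0 \<le> t \<Longrightarrow> t \<le> T \<Longrightarrow> 0 < n t" and ne: "\<And>t. 0 \<le> t \<Longrightarrow> t \<le> T \<Longrightarrow> n t \<le> e t"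
    and K: "integrable (lebesgue_on {0..T}) K" "\<And>t. 0 \<le> K t" and \<kappa>: "integral {0..T} K \<le> \<kappa>"
    and e_le: "AE t in lebesgue_on {0..T}. e' t * n t - n' t * e t \<le> K t * e t * n t"
    and n_ge: "AE t in lebesgue_on {0..T}. - n' t \<le> c * e t + d * K t * n t" and d: "0 \<le> d"
  shows "n 0 \<le> exp ((c * T * exp \<kappa> + d * \<kappa>) * (e 0 / n 0)) * n T"
proof -
  have epos: "0 < e t" if "0 \<le> t" "t \<le> T" for t using pos[OF that] ne[OF that] by linarith
  have ln_n: "primitive_on T (\<lambda>t. ln (n t)) (\<lambda>t. n' t / n t)" by (rule primitive_on_ln[OF n pos T])
  have ln_e: "primitive_on T (\<lambda>t. ln (e t)) (\<lambda>t. e' t / e t)" by (rule primitive_on_ln[OF e epos T])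
  have space: "AE t in lebesgue_on {0..T}. t \<in> {0..T}" using AE_space[of "lebesgue_on {0..T}"] by simp
  have K_int: "integral {0..t} K \<le> \<kappa>" if "0 \<le> t" "t \<le> T" for t
  proof -
    have "integral {0..t} K \<le> integral {0..T} K"
      using that K lebesgue_on_subinterval(2)[OF K(1), of 0] by (intro integral_subset_le) auto
    then show ?thesis using \<kappa> by simp
  qed
  define Q where "Q = e 0 / n 0"
  have Q1: "1 \<le> Q" using pos[of 0] ne[of 0] T by (simp add: Q_def)
  have \<kappa>0: "0 \<le> \<kappa>" using K_int[of 0] T by simp
  have quot: "e t \<le> Q * exp \<kappa> * n t" if t: "0 \<le> t" "t \<le> T" for t
  proof -
    have "AE t in lebesgue_on {0..T}. e' t / e t - n' t / n t \<le> K t"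
      using e_le space
    proof eventually_elim
      case (elim t)
      then have "0 < e t" "0 < n t" using epos pos by auto
      then have "e' t / e t - n' t / n t = (e' t * n t - n' t * e t) / (e t * n t)" by (simp add: field_simps)
      also have "\<dots> \<le> K t" using elim(1) \<open>0 < e t\<close> \<open>0 < n t\<close> by (simp add: divide_le_eq mult.assoc)
      finally show ?case .
    qed
    from primitive_on_mono_bound[OF primitive_on_diff[OF ln_e ln_n] K(1) this order_refl t]
    have "ln (e t) - ln (n t) - (ln (e 0) - ln (n 0)) \<le> \<kappa>" using K_int[OF t] by linarith
    then have "ln (e t) \<le> ln (Q * exp \<kappa> * n t)"
      using pos[of 0] epos[of 0] pos[OF t] T by (simp add: Q_def ln_mult ln_div)
    then show ?thesis using epos[OF t] pos[OF t] Q1 by simp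
  qed
  define m where "m t = c * Q * exp \<kappa> + d * K t" for t
  have mi: "integrable (lebesgue_on {0..T}) m"
    unfolding m_def using K finite_measure.integrable_const[OF finite_measure_lebesgue_on[of "{0..T}"]]
    by (intro Bochner_Integration.integrable_add) auto
  have "AE t in lebesgue_on {0..T}. -1 * (n' t / n t) \<le> m t"
    using n_ge space
  proof eventually_elim
    case (elim t)
    then have nt: "0 < n t" using pos by auto
    have "- n' t \<le> c * (Q * exp \<kappa> * n t) + d * K t * n t"
      using elim(1) mult_left_mono[OF quot[of t] c] elim(2) by auto
    also have "\<dots> = m t * n t" by (simp add: m_def algebra_simps)
    finally show ?case using nt by (simp add: field_simps)
  qed
  from primitive_on_mono_bound[OF primitive_on_cmult[OF ln_n, of "-1"] mi this order_refl T order_refl]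
  have "ln (n 0) - ln (n T) \<le> integral {0..T} m" by simp
  also have "\<dots> = c * Q * exp \<kappa> * T + d * integral {0..T} K"
    unfolding m_def using T lebesgue_on_subinterval(2)[OF K(1), of 0 T]
    by (subst Henstock_Kurzweil_Integration.integral_add) (auto intro!: integrable_on_mult_right)
  \<comment> \<open>Since \<open>Q\<close> is at least 1, the additive term is absorbed and the
    whole exponent is proportional to \<open>Q\<close>.\<close>
  also have "\<dots> \<le> c * Q * exp \<kappa> * T + (d * \<kappa>) * Q"
  proof -
    have "d * integral {0..T} K \<le> d * \<kappa>" using \<kappa> d by (intro mult_left_mono)
    also have "\<dots> \<le> d * \<kappa> * Q" using mult_left_mono[OF Q1, of "d * \<kappa>"] d \<kappa>0 by simp
    finally show ?thesis by simp
  qed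
  also have "\<dots> = (c * T * exp \<kappa> + d * \<kappa>) * Q" by (simp add: algebra_simps)
  finally have "ln (n 0) \<le> ln (exp ((c * T * exp \<kappa> + d * \<kappa>) * Q) * n T)"
    using pos[of T] T by (simp add: ln_mult)
  then show ?thesis using pos[of 0] pos[of T] T by (simp add: Q_def)
qed

text \<open>The bound on a maximal interval \<open>[0, r)\<close> of positivity passes to the limit at \<open>r\<close>, so \<open>n\<close> cannot vanish.\<close>

lemma dirichlet_quotient_bound:
  fixes n e n' e' K :: "real \<Rightarrow> real"
  assumes n: "primitive_on T n n'" and e: "primitive_on T e e'" and c: "0 \<le> c" and d: "0 \<le> d"
    and n_ge0: "\<And>t. 0 \<le> n t" and ne: "\<And>t. 0 \<le> t \<Longrightarrow> t \<le> T \<Longrightarrow> n t \<le> e t"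
    and K: "integrable (lebesgue_on {0..T}) K" "\<And>t. 0 \<le> K t" and \<kappa>: "integral {0..T} K \<le> \<kappa>"
    and e_le: "AE t in lebesgue_on {0..T}. e' t * n t - n' t * e t \<le> K t * e t * n t"
    and n_ge: "AE t in lebesgue_on {0..T}. - n' t \<le> c * e t + d * K t * n t"
    and n0: "0 < n 0" and t: "0 \<le> t" "t \<le> T"
  shows "n 0 \<le> exp ((c * T * exp \<kappa> + d * \<kappa>) * (e 0 / n 0)) * n t"
proof -
  let ?C = "exp ((c * T * exp \<kappa> + d * \<kappa>) * (e 0 / n 0))"
  have bound: "n 0 \<le> ?C * n r" if r: "0 \<le> r" "r \<le> T" and pos: "\<And>s. 0 \<le> s \<Longrightarrow> s \<le> r \<Longrightarrow> 0 < n s" for r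
  proof -
    have sub: "{0..r} \<subseteq> {0..T}" using r by auto
    have "integral {0..r} K \<le> integral {0..T} K"
      using r K lebesgue_on_subinterval(2)[OF K(1), of 0] by (intro integral_subset_le) auto
    then have \<kappa>r: "integral {0..r} K \<le> \<kappa>" using \<kappa> by simp
    have "n 0 \<le> exp ((c * r * exp \<kappa> + d * \<kappa>) * (e 0 / n 0)) * n r"
      using r ne pos K(2)
      by (intro dirichlet_quotient_bound_pos[OF primitive_on_mono[OF n r(2)] primitive_on_mono[OF e r(2)] r(1) c pos _
            lebesgue_on_subinterval(1)[OF K(1) order_refl r(2)] K(2) \<kappa>r
            AE_lebesgue_on_subset[OF e_le sub] AE_lebesgue_on_subset[OF n_ge sub] d]) auto
    \<comment> \<open>Replacing r by T frees the constant from r, so that one bound can be carried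
      to the limit.\<close>
    also have "\<dots> \<le> ?C * n r"
    proof (intro mult_right_mono n_ge0)
      have "c * r * exp \<kappa> \<le> c * T * exp \<kappa>" using r c by (intro mult_right_mono mult_left_mono) auto
      moreover have "0 \<le> e 0 / n 0" using n0 ne[of 0] t by simp
      ultimately have "(c * r * exp \<kappa> + d * \<kappa>) * (e 0 / n 0) \<le> (c * T * exp \<kappa> + d * \<kappa>) * (e 0 / n 0)"
        by (intro mult_right_mono) auto
      then show "exp ((c * r * exp \<kappa> + d * \<kappa>) * (e 0 / n 0)) \<le> ?C"
        by (simp only: exp_le_cancel_iff)
    qed
    finally show ?thesis .
  qed
  have cont: "continuous_on {0..T} n" by (rule primitive_on_continuous[OF n])
  define Z where "Z = {s \<in> {0..T}. n s = 0}"
  have "Z = {}"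
  proof (rule ccontr)
    assume "Z \<noteq> {}"
    have "closed Z" unfolding Z_def using cont by (intro continuous_closed_preimage_constant) auto
    moreover have "bdd_below Z" unfolding Z_def by (rule bdd_belowI[of _ 0]) auto
    ultimately have rZ: "Inf Z \<in> Z" using \<open>Z \<noteq> {}\<close> by (intro closed_contains_Inf)
    define r where "r = Inf Z"
    have r: "0 \<le> r" "r \<le> T" "n r = 0" using rZ by (auto simp: Z_def r_def)
    have "r \<noteq> 0" using n0 r by auto
    then have r0: "0 < r" using r by simp
    have pos: "0 < n s" if "0 \<le> s" "s < r" for s
    proof -
      have "s \<notin> Z" using cInf_lower[OF _ \<open>bdd_below Z\<close>, of s] that by (auto simp: r_def)
      then have "n s \<noteq> 0" using that r by (auto simp: Z_def)
      then show ?thesis using n_ge0[of s] by simp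
    qed
    have ev: "eventually (\<lambda>s. n 0 \<le> ?C * n s) (at_left r)"
      unfolding eventually_at_left_field
    proof (intro exI conjI allI impI)
      show "0 < r" by fact
      fix s assume "0 < s" "s < r"
      then show "n 0 \<le> ?C * n s" using r by (intro bound pos) auto
    qed
    have "(n \<longlongrightarrow> n r) (at r within {0..T})" using cont r(1,2) unfolding continuous_on_def by auto
    then have "(n \<longlongrightarrow> n r) (at r within {0..<r})" by (rule tendsto_within_subset) (use r in auto)
    moreover have "at_left r = at r within {0..<r}"
      by (rule at_within_nhd[of _ "{0<..}"]) (use r0 in auto)
    ultimately have "((\<lambda>s. ?C * n s) \<longlongrightarrow> ?C * n r) (at_left r)" by (intro tendsto_intros) simp
    then have "n 0 \<le> ?C * n r" by (rule tendsto_lowerbound[OF _ ev]) simp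
    then show False using r n0 by simp
  qed
  then have "0 < n s" if "0 \<le> s" "s \<le> T" for s
    using that n_ge0[of s] by (auto simp: Z_def less_le)
  then show ?thesis using t by (intro bound) auto
qed

section \<open>Estimates for strong solutions\<close>

text \<open>The equation is tested with Au: the nonlinear term drops out, and 2 <Au, f> \<le> \<nu>
  |Au|^2 + |f|^2 / \<nu> absorbs half of the dissipation. The other half bounds the time integral of
  |Au|^2, and no Gronwall factor arises.\<close>

lemma enstrophy_bound:
  assumes sol: "strong_solution \<nu> f T \<theta> u" and \<nu>: "\<nu> > 0" and T: "T > 0"
    and f: "f \<in> V_space" and \<theta>: "\<theta> \<in> V_space"
    and t: "0 \<le> t" "t \<le> T"
  shows "(V_norm (u t))\<^sup>2 + \<nu> * integral {0..t} (\<lambda>t. (L2_norm (stokes (u t)))\<^sup>2) \<le> (V_norm \<theta>)\<^sup>2 + T * (L2_norm f)\<^sup>2 / \<nu>"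
proof -
  obtain w where ev: "evolves T u w"
    and eq: "AE t in lebesgue_on {0..T}. AE x in torus. w t x + \<nu> *\<^sub>R stokes (u t) x + NS_bilinear (u t) (u t) x = f x"
    and si: "integrable (lebesgue_on {0..T}) (\<lambda>t. (L2_norm (stokes (u t)))\<^sup>2)"
    using strong_solution_evolves[OF sol] by blast
  have uV: "\<And>t. t \<in> {0..T} \<Longrightarrow> u t \<in> V_space"
    and uS: "AE t in lebesgue_on {0..T}. u t \<in> stokes_domain \<and> w t \<in> H_space"
    using ev by (auto simp: evolves_def)
  note fL = V_spaceD(3)[OF f]
  define F where "F = L2_norm f"
  define g where "g t = F\<^sup>2 / \<nu> - \<nu> * (L2_norm (stokes (u t)))\<^sup>2" for t
  have gi: "integrable (lebesgue_on {0..T}) g"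
    unfolding g_def using si finite_measure.integrable_const[OF finite_measure_lebesgue_on[of "{0..T}"]]
    by (intro Bochner_Integration.integrable_diff) auto
  have "AE t in lebesgue_on {0..T}. 2 * L2_inner (stokes (u t)) (w t) \<le> g t"
    using uS eq
  proof eventually_elim
    case (elim t)
    then have S: "u t \<in> stokes_domain" and W: "w t \<in> L2_per" by (auto simp: H_space_L2_per)
    note sL = stokes_L2_per[OF S] and bL = H_space_L2_per[OF NS_bilinear_in_H[OF S S]]
    define a where "a = L2_norm (stokes (u t))"
    have "AE x in torus. w t x = f x - \<nu> *\<^sub>R stokes (u t) x - NS_bilinear (u t) (u t) x"
      using elim(2) by eventually_elim (simp add: algebra_simps)
    then have "L2_inner (stokes (u t)) (w t) = L2_inner (stokes (u t)) (\<lambda>x. f x - \<nu> *\<^sub>R stokes (u t) x - NS_bilinear (u t) (u t) x)"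
      using sL bL W fL by (intro L2_inner_cong_AE) (auto intro!: L2_per_diff L2_per_scaleR)
    also have "\<dots> = L2_inner (stokes (u t)) f - \<nu> * a\<^sup>2"
      using NS_bilinear_orth_stokes[OF S] sL bL fL L2_per_scaleR[OF sL, of \<nu>] L2_per_diff[OF fL L2_per_scaleR[OF sL, of \<nu>]]
      by (simp add: L2_inner_diff_right L2_inner_scaleR_right L2_inner_commute[of "stokes (u t)" "NS_bilinear _ _"] a_def L2_norm_power2)
    also have "\<dots> \<le> a * F - \<nu> * a\<^sup>2"
      using L2_inner_Cauchy_Schwarz[OF sL fL] by (simp add: a_def F_def)
    also have "2 * \<dots> \<le> g t"
    proof -
      have "0 \<le> (\<nu> * a - F)\<^sup>2 / \<nu>" using \<nu> by simp
      also have "\<dots> = \<nu> * a\<^sup>2 - 2 * a * F + F\<^sup>2 / \<nu>" using \<nu> by (simp add: power2_eq_square field_simps)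
      finally show ?thesis by (simp add: g_def a_def algebra_simps)
    qed
    finally show ?case by simp
  qed
  from primitive_on_mono_bound[OF evolves_energy(1)[OF ev] gi this order_refl t]
  have "(V_norm (u t))\<^sup>2 - (V_norm (u 0))\<^sup>2 \<le> integral {0..t} g" .
  also have "\<dots> = t * (F\<^sup>2 / \<nu>) - \<nu> * integral {0..t} (\<lambda>t. (L2_norm (stokes (u t)))\<^sup>2)"
    unfolding g_def using t lebesgue_on_subinterval(2)[OF si order_refl t(2)]
    by (subst Henstock_Kurzweil_Integration.integral_diff) (auto intro!: integrable_on_mult_right)
  also have "t * (F\<^sup>2 / \<nu>) \<le> T * (F\<^sup>2 / \<nu>)" using t \<nu> by (intro mult_right_mono) auto
  finally have "(V_norm (u t))\<^sup>2 + \<nu> * integral {0..t} (\<lambda>t. (L2_norm (stokes (u t)))\<^sup>2) \<le> (V_norm (u 0))\<^sup>2 + T * F\<^sup>2 / \<nu>" by simp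
  \<comment> \<open>The initial value agrees with \<theta> only almost everywhere, but the norm is
    determined by the coefficients.\<close>
  moreover have "V_norm (u 0) = V_norm \<theta>"
  proof (rule V_norm_cong)
    have u0: "u 0 \<in> V_space" using uV[of 0] T by simp
    show "u 0 \<in> Hk_per 1" "\<theta> \<in> Hk_per 1" using V_spaceD(1) u0 \<theta> by auto
    show "fcoeff (u 0) i k = fcoeff \<theta> i k" for i k
      using sol V_spaceD(3)[OF u0] V_spaceD(3)[OF \<theta>] by (intro fcoeff_cong_AE) (auto simp: strong_solution_def)
  qed
  ultimately show ?thesis by (simp add: F_def)
qed

text \<open>With \<open>z = u - v\<close>, \<open>z' = -\<nu>Az - h\<close> and \<open>Q = \<parallel>z\<parallel>\<^sub>V\<^sup>2 / \<parallel>z\<parallel>\<^sup>2\<close>, the derivative of \<open>Q\<close> is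
  \<open>2\<langle>Az - Qz, z'\<rangle> / \<parallel>z\<parallel>\<^sup>2\<close>, in which \<open>\<langle>Az - Qz, Az\<rangle> = \<parallel>Az - Qz\<parallel>\<^sup>2\<close> absorbs the term with \<open>h\<close>.\<close>

lemma difference_inequalities:
  assumes z: "z \<in> stokes_domain" and h: "h \<in> L2_per" and z': "z' \<in> L2_per" and \<nu>: "\<nu> > 0"
    and eq: "AE x in torus. z' x = - \<nu> *\<^sub>R stokes z x - h x"
    and hK: "(L2_norm h)\<^sup>2 \<le> 2 * \<nu> * K * (V_norm z)\<^sup>2" and K: "0 \<le> K"
  shows "(2 * L2_inner (stokes z) z') * (L2_norm z)\<^sup>2 - (2 * L2_inner z z') * (V_norm z)\<^sup>2 \<le> K * (V_norm z)\<^sup>2 * (L2_norm z)\<^sup>2"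
    and "- (2 * L2_inner z z') \<le> (2 * \<nu> + 1) * (V_norm z)\<^sup>2 + (2 * \<nu>) * K * (L2_norm z)\<^sup>2"
proof -
  note zL = stokes_domainD(5)[OF z] and sL = stokes_L2_per[OF z]
  define n e where "n = (L2_norm z)\<^sup>2" and "e = (V_norm z)\<^sup>2"
  have n0: "0 \<le> n" and e0: "0 \<le> e" by (auto simp: n_def e_def)
  have ip: "L2_inner y z' = - \<nu> * L2_inner y (stokes z) - L2_inner y h" if y: "y \<in> L2_per" for y
  proof -
    have "L2_inner y z' = L2_inner y (\<lambda>x. - \<nu> *\<^sub>R stokes z x - h x)"
      using y z' eq h sL by (intro L2_inner_cong_AE) (auto intro!: L2_per_diff L2_per_uminus L2_per_scaleR)
    then show ?thesis
      using L2_inner_diff_right[OF L2_per_scaleR[OF sL, of "-\<nu>"] h y] L2_inner_scaleR_right[of y "-\<nu>" "stokes z"] by simp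
  qed
  have zz: "L2_inner z (stokes z) = e" by (simp add: e_def V_norm_eq_stokes[OF z])
  show "- (2 * L2_inner z z') \<le> (2 * \<nu> + 1) * (V_norm z)\<^sup>2 + (2 * \<nu>) * K * (L2_norm z)\<^sup>2"
  proof -
    \<comment> \<open>With this r one has |h| \<le> r |z|_V, and Young's inequality gives 2 <z, h>
      \<le> r^2 |z|^2 + |z|_V^2. This is the origin of the coefficients 2 \<nu> K and of the summand
      1 in 2 \<nu> + 1.\<close>
    define r where "r = sqrt (2 * \<nu> * K)"
    have r: "0 \<le> r" "r\<^sup>2 = 2 * \<nu> * K" using \<nu> K by (auto simp: r_def)
    have "L2_norm h \<le> r * V_norm z"
    proof (rule power2_le_imp_le)
      show "(L2_norm h)\<^sup>2 \<le> (r * V_norm z)\<^sup>2" using hK r by (simp add: power_mult_distrib)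
    qed (use r V_norm_ge0[OF stokes_domainD(2)[OF z]] in simp)
    then have "L2_inner z h \<le> L2_norm z * (r * V_norm z)"
      using L2_inner_Cauchy_Schwarz[OF zL h] mult_left_mono[OF _ L2_norm_ge0[of z]] by fastforce
    then have "2 * L2_inner z h \<le> 2 * (r * L2_norm z) * V_norm z" by (simp add: mult_ac)
    also have "\<dots> \<le> (r * L2_norm z)\<^sup>2 + (V_norm z)\<^sup>2" by (rule sum_squares_bound)
    also have "\<dots> = 2 * \<nu> * K * n + e" using r by (simp add: power_mult_distrib n_def e_def)
    finally show ?thesis using ip[OF zL] zz by (simp add: n_def e_def algebra_simps)
  qed
  let ?y = "\<lambda>x. n *\<^sub>R stokes z x - e *\<^sub>R z x"
  have yL: "?y \<in> L2_per" by (intro L2_per_diff L2_per_scaleR sL zL)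
  have y_inner: "L2_inner ?y p = n * L2_inner (stokes z) p - e * L2_inner z p" if "p \<in> L2_per" for p
    using that L2_per_scaleR[OF sL, of n] L2_per_scaleR[OF zL, of e] by (simp add: L2_inner_diff_left L2_inner_scaleR_left)
  have yz: "L2_inner ?y z = 0"
    using y_inner[OF zL] zz L2_inner_commute[of "stokes z" z] by (simp add: n_def L2_norm_power2)
  have yy: "(L2_norm ?y)\<^sup>2 = n * L2_inner ?y (stokes z)"
    using L2_per_scaleR[OF sL, of n] L2_per_scaleR[OF zL, of e] yL yz
    unfolding L2_norm_power2 by (subst L2_inner_diff_right) (auto simp: L2_inner_scaleR_right)
  \<comment> \<open>The extra factor n turns <y, Az> into |y|^2. Completing the square in |y| then
    leaves (|h| n)^2 / (2 \<nu>).\<close>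
  have main: "2 * L2_inner ?y z' * n \<le> K * e * n * n"
  proof -
    define Y where "Y = L2_norm ?y"
    have "\<bar>L2_inner ?y h\<bar> \<le> Y * L2_norm h" unfolding Y_def by (rule L2_inner_Cauchy_Schwarz[OF yL h])
    then have "- L2_inner ?y h * n \<le> (Y * L2_norm h) * n" using n0 by (intro mult_right_mono) auto
    moreover have "2 * L2_inner ?y z' * n = - 2 * \<nu> * (n * L2_inner ?y (stokes z)) + 2 * (- L2_inner ?y h * n)"
      unfolding ip[OF yL] by (simp add: algebra_simps)
    ultimately have "2 * L2_inner ?y z' * n \<le> - 2 * \<nu> * (n * L2_inner ?y (stokes z)) + 2 * (Y * L2_norm h) * n"
      by linarith
    also have "\<dots> = - 2 * \<nu> * Y\<^sup>2 + 2 * Y * (L2_norm h * n)" using yy by (simp add: Y_def)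
    also have "\<dots> \<le> (L2_norm h * n)\<^sup>2 / (2 * \<nu>)"
    proof -
      have "0 \<le> (2 * \<nu> * Y - L2_norm h * n)\<^sup>2 / (2 * \<nu>)" using \<nu> by simp
      also have "\<dots> = 2 * \<nu> * Y\<^sup>2 - 2 * Y * (L2_norm h * n) + (L2_norm h * n)\<^sup>2 / (2 * \<nu>)"
        using \<nu> by (simp add: power2_eq_square field_simps)
      finally show ?thesis by simp
    qed
    also have "\<dots> \<le> (2 * \<nu> * K * e) * n\<^sup>2 / (2 * \<nu>)"
      using hK \<nu> by (intro divide_right_mono) (auto simp: power_mult_distrib e_def intro!: mult_right_mono)
    also have "\<dots> = K * e * n * n" using \<nu> by (simp add: power2_eq_square)
    finally show ?thesis .
  qed
  show "(2 * L2_inner (stokes z) z') * (L2_norm z)\<^sup>2 - (2 * L2_inner z z') * (V_norm z)\<^sup>2 \<le> K * (V_norm z)\<^sup>2 * (L2_norm z)\<^sup>2"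
  \<comment> \<open>For n = 0 both sides vanish; otherwise the factor n in \<open>main\<close> is
    cancelled.\<close>
  proof (cases "n = 0")
    case True
    then have "L2_norm z = 0" by (simp add: n_def)
    then have "L2_inner z z' = 0" using L2_inner_Cauchy_Schwarz[OF zL z'] by simp
    then show ?thesis using \<open>L2_norm z = 0\<close> by simp
  next
    case False
    then have "2 * L2_inner ?y z' \<le> K * e * n" using main n0 by (simp add: mult_le_cancel_right)
    then show ?thesis using y_inner[OF z'] by (simp add: n_def e_def algebra_simps)
  qed
qed

text \<open>The abstract quotient bound for z = u - v, with coefficients c = 2 \<nu> + 1 and d = 2
  \<nu>. It concerns squared norms, so the exponent is twice the one for the norms.\<close>

lemma backward_stability:
  assumes solu: "strong_solution \<nu> f T u\<^sub>0 u" and solv: "strong_solution \<nu> f T v\<^sub>0 v"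
    and \<nu>: "\<nu> > 0" and T: "T > 0" and f: "f \<in> V_space" and u0: "u\<^sub>0 \<in> V_space" and v0: "v\<^sub>0 \<in> V_space"
    and M: "(V_norm u\<^sub>0)\<^sup>2 + T * (L2_norm f)\<^sup>2 / \<nu> \<le> M" "(V_norm v\<^sub>0)\<^sup>2 + T * (L2_norm f)\<^sup>2 / \<nu> \<le> M"
    and \<kappa>: "\<kappa> = 32 * sobolev_const\<^sup>2 * M / \<nu>\<^sup>2"
    and C: "C = (2 * \<nu> + 1) * T * exp \<kappa> + 2 * \<nu> * \<kappa>"
    and ne: "L2_norm (u\<^sub>0 - v\<^sub>0) \<noteq> 0" and t: "t \<in> {0..T}"
  shows "(L2_norm (u\<^sub>0 - v\<^sub>0))\<^sup>2 \<le> exp (C * ((V_norm (u\<^sub>0 - v\<^sub>0))\<^sup>2 / (L2_norm (u\<^sub>0 - v\<^sub>0))\<^sup>2)) * (L2_norm (u t - v t))\<^sup>2"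
proof -
  obtain w where evu: "evolves T u w"
    and equ: "AE t in lebesgue_on {0..T}. AE x in torus. w t x + \<nu> *\<^sub>R stokes (u t) x + NS_bilinear (u t) (u t) x = f x"
    and siu: "integrable (lebesgue_on {0..T}) (\<lambda>t. (L2_norm (stokes (u t)))\<^sup>2)"
    using strong_solution_evolves[OF solu] by blast
  obtain w' where evv: "evolves T v w'"
    and eqv: "AE t in lebesgue_on {0..T}. AE x in torus. w' t x + \<nu> *\<^sub>R stokes (v t) x + NS_bilinear (v t) (v t) x = f x"
    and siv: "integrable (lebesgue_on {0..T}) (\<lambda>t. (L2_norm (stokes (v t)))\<^sup>2)"
    using strong_solution_evolves[OF solv] by blast
  define z where "z t = (\<lambda>x. u t x - v t x)" for t
  define z' where "z' t = (\<lambda>x. w t x - w' t x)" for t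
  have ev: "evolves T z z'" unfolding z_def z'_def by (rule evolves_diff[OF evu evv])
  have zV: "\<And>t. t \<in> {0..T} \<Longrightarrow> z t \<in> V_space" and uV: "u 0 \<in> V_space" and vV: "v 0 \<in> V_space"
    using ev evu evv T by (auto simp: evolves_def)
  have uS: "AE t in lebesgue_on {0..T}. u t \<in> stokes_domain \<and> w t \<in> H_space"
    and vS: "AE t in lebesgue_on {0..T}. v t \<in> stokes_domain \<and> w' t \<in> H_space"
    using evu evv by (auto simp: evolves_def)
  \<comment> \<open>Chosen so that |h|^2 \<le> 2 \<nu> K |z|_V^2: the factor 4 of the nonlinear
    estimate is squared, and (a + b)^2 \<le> 2 (a^2 + b^2). Each of the two time integrals is at
    most M / \<nu>, so K integrates to at most \<kappa>.\<close>
  define K where "K t = 16 * sobolev_const\<^sup>2 / \<nu> * ((L2_norm (stokes (u t)))\<^sup>2 + (L2_norm (stokes (v t)))\<^sup>2)" for t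
  have Ki: "integrable (lebesgue_on {0..T}) K" unfolding K_def using siu siv by simp
  have K0: "0 \<le> K t" for t unfolding K_def using \<nu> by simp
  have K\<kappa>: "integral {0..T} K \<le> \<kappa>"
  proof -
    have iu: "integral {0..T} (\<lambda>t. (L2_norm (stokes (u t)))\<^sup>2) \<le> M / \<nu>"
    proof -
      have "\<nu> * integral {0..T} (\<lambda>t. (L2_norm (stokes (u t)))\<^sup>2) \<le> M"
        using enstrophy_bound[OF solu \<nu> T f u0, of T] T M(1) zero_le_power2[of "V_norm (u T)"] by linarith
      then show ?thesis using \<nu> by (simp add: pos_le_divide_eq mult.commute)
    qed
    have iv: "integral {0..T} (\<lambda>t. (L2_norm (stokes (v t)))\<^sup>2) \<le> M / \<nu>"
    proof -
      have "\<nu> * integral {0..T} (\<lambda>t. (L2_norm (stokes (v t)))\<^sup>2) \<le> M"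
        using enstrophy_bound[OF solv \<nu> T f v0, of T] T M(2) zero_le_power2[of "V_norm (v T)"] by linarith
      then show ?thesis using \<nu> by (simp add: pos_le_divide_eq mult.commute)
    qed
    have "integral {0..T} K = 16 * sobolev_const\<^sup>2 / \<nu> *
        (integral {0..T} (\<lambda>t. (L2_norm (stokes (u t)))\<^sup>2) + integral {0..T} (\<lambda>t. (L2_norm (stokes (v t)))\<^sup>2))"
      unfolding K_def using lebesgue_on_subinterval(2)[OF siu, of 0 T] lebesgue_on_subinterval(2)[OF siv, of 0 T]
      by (subst Henstock_Kurzweil_Integration.integral_mult_right) (auto simp: Henstock_Kurzweil_Integration.integral_add)
    also have "\<dots> \<le> 16 * sobolev_const\<^sup>2 / \<nu> * (M / \<nu> + M / \<nu>)"
      using iu iv \<nu> by (intro mult_left_mono add_mono) auto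
    also have "\<dots> = \<kappa>" using \<nu> by (simp add: \<kappa> power2_eq_square field_simps)
    finally show ?thesis .
  qed
  have ineq: "AE t in lebesgue_on {0..T}.
      (2 * L2_inner (stokes (z t)) (z' t)) * (L2_norm (z t))\<^sup>2 - (2 * L2_inner (z t) (z' t)) * (V_norm (z t))\<^sup>2 \<le> K t * (V_norm (z t))\<^sup>2 * (L2_norm (z t))\<^sup>2
    \<and> - (2 * L2_inner (z t) (z' t)) \<le> (2 * \<nu> + 1) * (V_norm (z t))\<^sup>2 + (2 * \<nu>) * K t * (L2_norm (z t))\<^sup>2"
    using uS vS equ eqv
  proof eventually_elim
    case (elim t)
    then have S: "u t \<in> stokes_domain" "v t \<in> stokes_domain" and W: "w t \<in> L2_per" "w' t \<in> L2_per"
      by (auto simp: H_space_L2_per)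
    have zS: "z t \<in> stokes_domain" unfolding z_def by (rule stokes_domain_diff[OF S])
    let ?h = "\<lambda>x. NS_bilinear (u t) (u t) x - NS_bilinear (v t) (v t) x"
    have h: "?h \<in> L2_per" using S by (intro L2_per_diff H_space_L2_per NS_bilinear_in_H)
    have z'L: "z' t \<in> L2_per" unfolding z'_def by (rule L2_per_diff[OF W])
    have eq: "AE x in torus. z' t x = - \<nu> *\<^sub>R stokes (z t) x - ?h x"
      using elim(3,4) stokes_diff_AE[OF S] unfolding z_def z'_def
    proof eventually_elim
      case (elim x)
      have wx: "w t x = f x - \<nu> *\<^sub>R stokes (u t) x - NS_bilinear (u t) (u t) x"
        "w' t x = f x - \<nu> *\<^sub>R stokes (v t) x - NS_bilinear (v t) (v t) x"
        using elim(1,2) by (simp_all add: algebra_simps)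
      show ?case unfolding elim(3) wx by (simp add: algebra_simps)
    qed
    let ?a = "L2_norm (stokes (u t))" and ?b = "L2_norm (stokes (v t))"
    have "(L2_norm ?h)\<^sup>2 \<le> (4 * sobolev_const * (?a + ?b) * V_norm (z t))\<^sup>2"
      unfolding z_def by (intro power_mono NS_bilinear_diff_bound S L2_norm_ge0)
    also have "\<dots> = 16 * sobolev_const\<^sup>2 * (?a + ?b)\<^sup>2 * (V_norm (z t))\<^sup>2" by (simp add: power_mult_distrib)
    also have "\<dots> \<le> 16 * sobolev_const\<^sup>2 * (2 * (?a\<^sup>2 + ?b\<^sup>2)) * (V_norm (z t))\<^sup>2"
      using sum_squares_bound[of ?a ?b] by (intro mult_right_mono mult_left_mono) (auto simp: power2_sum)
    also have "\<dots> = 2 * \<nu> * K t * (V_norm (z t))\<^sup>2" using \<nu> by (simp add: K_def field_simps)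
    finally have hK: "(L2_norm ?h)\<^sup>2 \<le> 2 * \<nu> * K t * (V_norm (z t))\<^sup>2" .
    show ?case using difference_inequalities[OF zS h z'L \<nu> eq hK K0] by blast
  qed
  have z0: "AE x in torus. z 0 x = (u\<^sub>0 - v\<^sub>0) x"
  proof -
    have "AE x in torus. u 0 x = u\<^sub>0 x" "AE x in torus. v 0 x = v\<^sub>0 x"
      using solu solv by (auto simp: strong_solution_def)
    then show ?thesis by eventually_elim (simp add: z_def)
  qed
  have d0: "(u\<^sub>0 - v\<^sub>0) \<in> V_space" using V_space_diff[OF u0 v0] by (simp add: fun_diff_def)
  have z0V: "z 0 \<in> V_space" using zV T by simp
  have nz: "L2_norm (z 0) = L2_norm (u\<^sub>0 - v\<^sub>0)"
    by (rule L2_norm_cong_AE[OF V_spaceD(3)[OF z0V] V_spaceD(3)[OF d0] z0])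
  have ez: "V_norm (z 0) = V_norm (u\<^sub>0 - v\<^sub>0)"
    by (intro V_norm_cong V_spaceD z0V d0 fcoeff_cong_AE z0)
  have "(L2_norm (z 0))\<^sup>2 \<le> exp (((2 * \<nu> + 1) * T * exp \<kappa> + 2 * \<nu> * \<kappa>) * ((V_norm (z 0))\<^sup>2 / (L2_norm (z 0))\<^sup>2)) * (L2_norm (z t))\<^sup>2"
  proof (rule dirichlet_quotient_bound[OF evolves_energy(2)[OF ev] evolves_energy(1)[OF ev] _ _ _ _ Ki K0 K\<kappa>])
    show "(L2_norm (z t))\<^sup>2 \<le> (V_norm (z t))\<^sup>2" if "0 \<le> t" "t \<le> T" for t
      using that by (intro power_mono Poincare zV L2_norm_ge0) auto
    show "0 < (L2_norm (z 0))\<^sup>2" using ne nz by simp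
  qed (use ineq \<nu> t in \<open>auto elim!: eventually_mono\<close>)
  then show ?thesis unfolding C nz ez by (simp add: z_def fun_diff_def)
qed

text \<open>The constants are quantified before f, the data and the solutions, with only F = |f|
  fixed; this expresses dependence on U, \<nu>, T and |f| alone. Boundedness accompanies the
  supremum because the supremum of an unbounded set of reals carries no information.\<close>

theorem theorem1:
  fixes U \<nu> T F :: real
  assumes "U > 0" and "\<nu> > 0" and "T > 0"
  shows
    "(\<exists>c\<^sub>1::real. \<forall>f u\<^sub>0 v\<^sub>0 u v.
        f \<in> V_space \<and> L2_norm f = F \<and> u\<^sub>0 \<in> V_space \<and> v\<^sub>0 \<in> V_space \<and>
        V_norm u\<^sub>0 + V_norm v\<^sub>0 \<le> U \<and>
        strong_solution \<nu> f T u\<^sub>0 u \<and> strong_solution \<nu> f T v\<^sub>0 v \<longrightarrow>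
          bdd_above ((\<lambda>t. L2_norm (u t - v t)) ` {0..T}) \<and>
          (SUP t\<in>{0..T}. L2_norm (u t - v t)) < c\<^sub>1 \<and>
          (\<forall>t\<in>{0..T}. L2_norm (u\<^sub>0 - v\<^sub>0) \<le>
             (if L2_norm (u t - v t) = 0 then 0
              else c\<^sub>1 * ln (c\<^sub>1 / L2_norm (u t - v t)) powr (-1/2)))) \<and>
     (\<exists>c\<^sub>2::real. \<forall>f u\<^sub>0 v\<^sub>0 u v c\<^sub>P.
        f \<in> V_space \<and> L2_norm f = F \<and> u\<^sub>0 \<in> V_space \<and> v\<^sub>0 \<in> V_space \<and>
        V_norm u\<^sub>0 + V_norm v\<^sub>0 \<le> U \<and>
        strong_solution \<nu> f T u\<^sub>0 u \<and> strong_solution \<nu> f T v\<^sub>0 v \<and>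
        0 < c\<^sub>P \<and>
        (L2_norm (u\<^sub>0 - v\<^sub>0) \<noteq> 0 \<longrightarrow> (V_norm (u\<^sub>0 - v\<^sub>0))\<^sup>2 / (L2_norm (u\<^sub>0 - v\<^sub>0))\<^sup>2 \<le> c\<^sub>P) \<longrightarrow>
          (\<forall>t\<in>{0..T}. L2_norm (u\<^sub>0 - v\<^sub>0) \<le> exp (c\<^sub>2 * c\<^sub>P) * L2_norm (u t - v t)))"
proof -
  note U = assms(1) and \<nu> = assms(2) and T = assms(3)
  \<comment> \<open>Bounds the enstrophy of either solution at all times, since U bounds both
    initial norms.\<close>
  define M where "M = U\<^sup>2 + T * F\<^sup>2 / \<nu>"
  have M0: "0 \<le> M" using T \<nu> by (simp add: M_def)
  define \<kappa> where "\<kappa> = 32 * sobolev_const\<^sup>2 * M / \<nu>\<^sup>2"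
  define C where "C = (2 * \<nu> + 1) * T * exp \<kappa> + 2 * \<nu> * \<kappa>"
  have "0 \<le> \<kappa>" using M0 by (simp add: \<kappa>_def)
  then have C0: "0 \<le> C" using \<nu> T by (simp add: C_def)
  \<comment> \<open>Half of C, because C belongs to the estimate of the squared norms.\<close>
  define c\<^sub>2 where "c\<^sub>2 = C / 2"
  \<comment> \<open>The first summand bounds the difference of the solutions at all times; the
    summand 1 makes that bound strict and \<open>c\<^sub>1\<close> at least 1. The last two are such
    that D \<open>c\<^sub>1\<close> and \<open>c\<^sub>2\<close> U^2 are each at most half the
    square of \<open>c\<^sub>1\<close>.\<close>
  define c\<^sub>1 where "c\<^sub>1 = 2 * sqrt M + 1 + 2 * U + 2 * (c\<^sub>2 * U\<^sup>2)"
  have c20: "0 \<le> c\<^sub>2 * U\<^sup>2" "0 \<le> c\<^sub>2" using C0 by (auto simp: c\<^sub>2_def)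
  \<comment> \<open>Here q is any upper bound of the initial quotient: estimate B takes q =
    \<open>c\<^sub>P\<close>, estimate A takes the quotient itself.\<close>
  have core: "L2_norm (u\<^sub>0 - v\<^sub>0) \<le> exp (c\<^sub>2 * q) * L2_norm (u t - v t)"
    and sup: "L2_norm (u t - v t) \<le> 2 * sqrt M" and V0: "V_norm (u\<^sub>0 - v\<^sub>0) \<le> U" and D0: "L2_norm (u\<^sub>0 - v\<^sub>0) \<le> U"
    if H: "f \<in> V_space \<and> L2_norm f = F \<and> u\<^sub>0 \<in> V_space \<and> v\<^sub>0 \<in> V_space \<and> V_norm u\<^sub>0 + V_norm v\<^sub>0 \<le> U \<and>
        strong_solution \<nu> f T u\<^sub>0 u \<and> strong_solution \<nu> f T v\<^sub>0 v"
      and t: "t \<in> {0..T}"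
      and q: "L2_norm (u\<^sub>0 - v\<^sub>0) \<noteq> 0 \<longrightarrow> (V_norm (u\<^sub>0 - v\<^sub>0))\<^sup>2 / (L2_norm (u\<^sub>0 - v\<^sub>0))\<^sup>2 \<le> q" for f u\<^sub>0 v\<^sub>0 u v t q
  proof -
    have f: "f \<in> V_space" and F: "L2_norm f = F" and u0: "u\<^sub>0 \<in> V_space" and v0: "v\<^sub>0 \<in> V_space"
      and UV: "V_norm u\<^sub>0 + V_norm v\<^sub>0 \<le> U"
      and solu: "strong_solution \<nu> f T u\<^sub>0 u" and solv: "strong_solution \<nu> f T v\<^sub>0 v" using H by auto
    have nn: "0 \<le> V_norm u\<^sub>0" "0 \<le> V_norm v\<^sub>0" using u0 v0 by (auto intro: V_norm_ge0 V_spaceD(1))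
    have "(V_norm u\<^sub>0)\<^sup>2 \<le> U\<^sup>2" "(V_norm v\<^sub>0)\<^sup>2 \<le> U\<^sup>2" using nn UV by (auto intro!: power_mono)
    then have Mu: "(V_norm u\<^sub>0)\<^sup>2 + T * (L2_norm f)\<^sup>2 / \<nu> \<le> M" and Mv: "(V_norm v\<^sub>0)\<^sup>2 + T * (L2_norm f)\<^sup>2 / \<nu> \<le> M"
      by (auto simp: M_def F)
    have d0: "(u\<^sub>0 - v\<^sub>0) \<in> V_space" using V_space_diff[OF u0 v0] by (simp add: fun_diff_def)
    show V0: "V_norm (u\<^sub>0 - v\<^sub>0) \<le> U"
      using V_norm_triangle_diff[OF V_spaceD(1)[OF u0] V_spaceD(1)[OF v0]] UV by (simp add: fun_diff_def)
    then show D0: "L2_norm (u\<^sub>0 - v\<^sub>0) \<le> U" using Poincare[OF d0] by linarith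
    have bd: "y t \<in> V_space \<and> L2_norm (y t) \<le> sqrt M"
      if sol: "strong_solution \<nu> f T \<theta> y" and \<theta>: "\<theta> \<in> V_space" and M\<theta>: "(V_norm \<theta>)\<^sup>2 + T * (L2_norm f)\<^sup>2 / \<nu> \<le> M" for y \<theta>
    proof -
      have yV: "y t \<in> V_space" using sol t by (auto simp: strong_solution_def continuous_in_def)
      have si: "integrable (lebesgue_on {0..T}) (\<lambda>t. (L2_norm (stokes (y t)))\<^sup>2)"
        using strong_solution_evolves[OF sol] by blast
      have "0 \<le> integral {0..t} (\<lambda>t. (L2_norm (stokes (y t)))\<^sup>2)"
        using lebesgue_on_subinterval(2)[OF si, of 0 t] t by (intro Henstock_Kurzweil_Integration.integral_nonneg) auto
      then have "0 \<le> \<nu> * integral {0..t} (\<lambda>t. (L2_norm (stokes (y t)))\<^sup>2)"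
        using \<nu> by (intro mult_nonneg_nonneg) auto
      moreover have "0 \<le> t" "t \<le> T" using t by auto
      ultimately have "(V_norm (y t))\<^sup>2 \<le> M"
        using enstrophy_bound[OF sol \<nu> T f \<theta>, of t] M\<theta> by linarith
      then have "V_norm (y t) \<le> sqrt M" by (rule real_le_rsqrt)
      then show ?thesis using Poincare[OF yV] yV by linarith
    qed
    show "L2_norm (u t - v t) \<le> 2 * sqrt M"
    proof -
      have "L2_norm (u t - v t) \<le> L2_norm (u t) + L2_norm (v t)"
        unfolding fun_diff_def using bd[OF solu u0 Mu] bd[OF solv v0 Mv]
        by (intro L2_norm_triangle_diff V_spaceD(3)) auto
      then show ?thesis using bd[OF solu u0 Mu] bd[OF solv v0 Mv] by linarith
    qed
    show "L2_norm (u\<^sub>0 - v\<^sub>0) \<le> exp (c\<^sub>2 * q) * L2_norm (u t - v t)"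
    proof (cases "L2_norm (u\<^sub>0 - v\<^sub>0) = 0")
      case False
      have "(L2_norm (u\<^sub>0 - v\<^sub>0))\<^sup>2 \<le> exp (C * ((V_norm (u\<^sub>0 - v\<^sub>0))\<^sup>2 / (L2_norm (u\<^sub>0 - v\<^sub>0))\<^sup>2)) * (L2_norm (u t - v t))\<^sup>2"
        by (rule backward_stability[OF solu solv \<nu> T f u0 v0 Mu Mv \<kappa>_def C_def False t])
      also have "\<dots> \<le> exp (C * q) * (L2_norm (u t - v t))\<^sup>2"
      proof (intro mult_right_mono)
        have "C * ((V_norm (u\<^sub>0 - v\<^sub>0))\<^sup>2 / (L2_norm (u\<^sub>0 - v\<^sub>0))\<^sup>2) \<le> C * q"
          by (rule mult_left_mono) (use q False C0 in auto)
        then show "exp (C * ((V_norm (u\<^sub>0 - v\<^sub>0))\<^sup>2 / (L2_norm (u\<^sub>0 - v\<^sub>0))\<^sup>2)) \<le> exp (C * q)"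
          by (simp only: exp_le_cancel_iff)
      qed simp
      also have "\<dots> = (exp (c\<^sub>2 * q) * L2_norm (u t - v t))\<^sup>2"
        by (simp add: power_mult_distrib c\<^sub>2_def power2_eq_square flip: exp_add)
      finally show ?thesis by (rule power2_le_imp_le) (simp add: L2_norm_ge0)
    qed (simp add: L2_norm_ge0)
  qed
  have c1: "1 \<le> c\<^sub>1" "2 * sqrt M < c\<^sub>1" "2 * U \<le> c\<^sub>1" "2 * (c\<^sub>2 * U\<^sup>2) \<le> c\<^sub>1"
  proof -
    have "0 \<le> sqrt M" using M0 by simp
    then show "1 \<le> c\<^sub>1" "2 * sqrt M < c\<^sub>1" "2 * U \<le> c\<^sub>1" "2 * (c\<^sub>2 * U\<^sup>2) \<le> c\<^sub>1"
      using U c20(1) unfolding c\<^sub>1_def by linarith+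
  qed
  show ?thesis
  proof (intro conjI)
    show "\<exists>c\<^sub>2::real. \<forall>f u\<^sub>0 v\<^sub>0 u v c\<^sub>P.
        f \<in> V_space \<and> L2_norm f = F \<and> u\<^sub>0 \<in> V_space \<and> v\<^sub>0 \<in> V_space \<and>
        V_norm u\<^sub>0 + V_norm v\<^sub>0 \<le> U \<and>
        strong_solution \<nu> f T u\<^sub>0 u \<and> strong_solution \<nu> f T v\<^sub>0 v \<and>
        0 < c\<^sub>P \<and>
        (L2_norm (u\<^sub>0 - v\<^sub>0) \<noteq> 0 \<longrightarrow> (V_norm (u\<^sub>0 - v\<^sub>0))\<^sup>2 / (L2_norm (u\<^sub>0 - v\<^sub>0))\<^sup>2 \<le> c\<^sub>P) \<longrightarrow>
          (\<forall>t\<in>{0..T}. L2_norm (u\<^sub>0 - v\<^sub>0) \<le> exp (c\<^sub>2 * c\<^sub>P) * L2_norm (u t - v t))"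
    proof (intro exI[of _ c\<^sub>2] allI impI ballI)
      fix f u\<^sub>0 v\<^sub>0 u v c\<^sub>P t
      assume H: "f \<in> V_space \<and> L2_norm f = F \<and> u\<^sub>0 \<in> V_space \<and> v\<^sub>0 \<in> V_space \<and>
        V_norm u\<^sub>0 + V_norm v\<^sub>0 \<le> U \<and>
        strong_solution \<nu> f T u\<^sub>0 u \<and> strong_solution \<nu> f T v\<^sub>0 v \<and>
        0 < c\<^sub>P \<and>
        (L2_norm (u\<^sub>0 - v\<^sub>0) \<noteq> 0 \<longrightarrow> (V_norm (u\<^sub>0 - v\<^sub>0))\<^sup>2 / (L2_norm (u\<^sub>0 - v\<^sub>0))\<^sup>2 \<le> c\<^sub>P)"
        and t: "t \<in> {0..T}"
      show "L2_norm (u\<^sub>0 - v\<^sub>0) \<le> exp (c\<^sub>2 * c\<^sub>P) * L2_norm (u t - v t)"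
        by (rule core[of f u\<^sub>0 v\<^sub>0 u v t c\<^sub>P]) (use H t in blast)+
    qed
    show "\<exists>c\<^sub>1::real. \<forall>f u\<^sub>0 v\<^sub>0 u v.
        f \<in> V_space \<and> L2_norm f = F \<and> u\<^sub>0 \<in> V_space \<and> v\<^sub>0 \<in> V_space \<and>
        V_norm u\<^sub>0 + V_norm v\<^sub>0 \<le> U \<and>
        strong_solution \<nu> f T u\<^sub>0 u \<and> strong_solution \<nu> f T v\<^sub>0 v \<longrightarrow>
          bdd_above ((\<lambda>t. L2_norm (u t - v t)) ` {0..T}) \<and>
          (SUP t\<in>{0..T}. L2_norm (u t - v t)) < c\<^sub>1 \<and>
          (\<forall>t\<in>{0..T}. L2_norm (u\<^sub>0 - v\<^sub>0) \<le>
             (if L2_norm (u t - v t) = 0 then 0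
              else c\<^sub>1 * ln (c\<^sub>1 / L2_norm (u t - v t)) powr (-1/2)))"
    proof (intro exI[of _ c\<^sub>1] allI impI)
      fix f u\<^sub>0 v\<^sub>0 u v
      assume H: "f \<in> V_space \<and> L2_norm f = F \<and> u\<^sub>0 \<in> V_space \<and> v\<^sub>0 \<in> V_space \<and>
        V_norm u\<^sub>0 + V_norm v\<^sub>0 \<le> U \<and>
        strong_solution \<nu> f T u\<^sub>0 u \<and> strong_solution \<nu> f T v\<^sub>0 v"
      let ?D = "L2_norm (u\<^sub>0 - v\<^sub>0)"
      \<comment> \<open>If the initial difference vanishes, the division yields 0 and the condition
        on q is vacuous.\<close>
      define q where "q = (V_norm (u\<^sub>0 - v\<^sub>0))\<^sup>2 / ?D\<^sup>2"
      have q: "?D \<noteq> 0 \<longrightarrow> (V_norm (u\<^sub>0 - v\<^sub>0))\<^sup>2 / ?D\<^sup>2 \<le> q" by (simp add: q_def)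
      have supt: "L2_norm (u t - v t) \<le> 2 * sqrt M" if "t \<in> {0..T}" for t by (rule sup[OF H that q])
      have T0: "0 \<in> {0..T}" using T by simp
      have bdd: "bdd_above ((\<lambda>t. L2_norm (u t - v t)) ` {0..T})"
        using supt by (intro bdd_aboveI[of _ "2 * sqrt M"]) auto
      have S: "(SUP t\<in>{0..T}. L2_norm (u t - v t)) < c\<^sub>1"
        using T0 supt c1(2) by (intro le_less_trans[OF cSUP_least[of "{0..T}" _ "2 * sqrt M"]]) auto
      have "?D \<le> (if L2_norm (u t - v t) = 0 then 0 else c\<^sub>1 * ln (c\<^sub>1 / L2_norm (u t - v t)) powr (-1/2))"
        if t: "t \<in> {0..T}" for t
      proof -
        define D y where "D = ?D" and "y = L2_norm (u t - v t)"
        have Dy: "D \<le> exp (c\<^sub>2 * q) * y" unfolding D_def y_def by (rule core[OF H t q])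
        have D: "0 \<le> D" "D \<le> U" using D0[OF H t q] by (auto simp: D_def L2_norm_ge0)
        have y: "0 \<le> y" "y < c\<^sub>1" using supt[OF t] c1(2) by (auto simp: y_def L2_norm_ge0)
        have "D \<le> (if y = 0 then 0 else c\<^sub>1 * ln (c\<^sub>1 / y) powr (-1/2))"
        \<comment> \<open>If y vanishes, the exponential bound forces D = 0, which is backward
          uniqueness; if D vanishes, the right-hand side only has to be nonnegative.\<close>
        proof (cases "y = 0 \<or> D = 0")
          case True
          then show ?thesis using Dy D c1(1) by auto
        next
          case False
          then have yD: "0 < y" "0 < D" using y D by auto
          define L where "L = ln (c\<^sub>1 / y)"
          have L0: "0 < L" using yD y by (simp add: L_def)
          have "D / exp (c\<^sub>2 * q) \<le> y" using Dy by (simp add: divide_le_eq mult.commute)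
          then have "c\<^sub>1 / y \<le> c\<^sub>1 / (D / exp (c\<^sub>2 * q))" using yD c1(1) by (intro divide_left_mono) auto
          then have "L \<le> ln (c\<^sub>1 / D * exp (c\<^sub>2 * q))" unfolding L_def using yD c1(1) by (subst ln_le_cancel_iff) auto
          also have "\<dots> = ln (c\<^sub>1 / D) + c\<^sub>2 * q" using yD c1(1) by (subst ln_mult) auto
          \<comment> \<open>The crude bound of ln x by x is enough: multiplication by D^2 turns
            \<open>c\<^sub>1\<close> / D into D \<open>c\<^sub>1\<close>, and the same factor
            cancels the denominator of q. The logarithm is thus bounded by a multiple of D^-2,
            whence the power -1/2.\<close>
          also have "\<dots> \<le> c\<^sub>1 / D + c\<^sub>2 * q"
            using ln_le_minus_one[of "c\<^sub>1 / D"] yD c1(1) by simp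
          finally have "D\<^sup>2 * L \<le> D\<^sup>2 * (c\<^sub>1 / D + c\<^sub>2 * q)" by (intro mult_left_mono) auto
          also have "\<dots> = D * c\<^sub>1 + c\<^sub>2 * (V_norm (u\<^sub>0 - v\<^sub>0))\<^sup>2"
            using yD by (simp add: q_def D_def[symmetric] power2_eq_square field_simps)
          also have "\<dots> \<le> c\<^sub>1 / 2 * c\<^sub>1 + c\<^sub>1 / 2 * c\<^sub>1"
          proof (intro add_mono)
            show "D * c\<^sub>1 \<le> c\<^sub>1 / 2 * c\<^sub>1" using D c1 by (intro mult_right_mono) auto
            have "0 \<le> V_norm (u\<^sub>0 - v\<^sub>0)"
              using H V_space_diff[of u\<^sub>0 v\<^sub>0] by (intro V_norm_ge0 V_spaceD(1)) (auto simp: fun_diff_def)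
            then have "c\<^sub>2 * (V_norm (u\<^sub>0 - v\<^sub>0))\<^sup>2 \<le> c\<^sub>2 * U\<^sup>2"
              using V0[OF H t q] c20 by (intro mult_left_mono power_mono) auto
            also have "\<dots> \<le> c\<^sub>1 / 2 * 1" using c1(4) by simp
            also have "\<dots> \<le> c\<^sub>1 / 2 * c\<^sub>1" using c1(1) by (intro mult_left_mono) auto
            finally show "c\<^sub>2 * (V_norm (u\<^sub>0 - v\<^sub>0))\<^sup>2 \<le> c\<^sub>1 / 2 * c\<^sub>1" .
          qed
          also have "\<dots> = c\<^sub>1\<^sup>2" by (simp add: power2_eq_square)
          finally have "(D * sqrt L)\<^sup>2 \<le> c\<^sub>1\<^sup>2" using L0 by (simp add: power_mult_distrib)
          then have "D * sqrt L \<le> c\<^sub>1" by (rule power2_le_imp_le) (use c1(1) in simp)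
          then have "D \<le> c\<^sub>1 / sqrt L" using L0 by (simp add: pos_le_divide_eq)
          also have "\<dots> = c\<^sub>1 * L powr (-1/2)"
          proof -
            have "L powr (-1/2) = inverse (L powr (1/2))" using powr_minus[of L "1/2"] by simp
            also have "L powr (1/2) = sqrt L" using L0 by (intro powr_half_sqrt) simp
            finally show ?thesis by (simp only: divide_inverse)
          qed
          finally show ?thesis using yD by (simp add: L_def)
        qed
        then show ?thesis unfolding D_def y_def .
      qed
      then show "bdd_above ((\<lambda>t. L2_norm (u t - v t)) ` {0..T}) \<and>
          (SUP t\<in>{0..T}. L2_norm (u t - v t)) < c\<^sub>1 \<and>
          (\<forall>t\<in>{0..T}. ?D \<le> (if L2_norm (u t - v t) = 0 then 0
              else c\<^sub>1 * ln (c\<^sub>1 / L2_norm (u t - v t)) powr (-1/2)))"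
        using bdd S by blast
    qed
  qed
qed

end
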